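(* In the self-oscillator computing setting described in the context, fix $l\in\mathbb N_{\ge0}$ and consider the dynamics during the $l$-th isentropic time interval $[\tau_l,\tau_l+t_{\max,l})$. There are universal positive numerical constants $\kappa,c_0$ such that, with $\lambda=4.64$, for all $\varepsilon^{\mathrm{gate}}\in[0,1/2]$ the gate frequency $f$ during this interval satisfies: Case 1) if $\rho_{\mathrm{SC}}(\tau_l|\tau_l)\in\mathcal C^{\mathrm{clas.},l}_{\mathrm{SC}}$, then $f\le\frac{\sqrt{T_0^2P^{\mathrm{in}}_l+\varepsilon^0_{\mathrm H}}}{(\lambda+1)c_0T_0}$; Case 2) in general, $f\le\frac{T_0^2P^{\mathrm{in}}_l+\varepsilon^0_{\mathrm H}}{(\lambda+1)\kappa T_0}$.
   Context: Units $\hbar=1$; $T_0>0$ is the cycle time. Self-oscillator setting: $\mathcal H_{\mathrm S}=\mathcal H_{\mathrm L}\otimes\mathcal H_{\mathrm{S\setminus L}}$ and $\mathcal H_{\mathrm C}$ finite-dimensional; $H_{\mathrm{SC}}$ self-adjoint on $\mathcal H_{\mathrm S}\otimes\mathcal H_{\mathrm C}$ with smallest eigenvalue $0$; finitely many operators $J^j_{\mathrm C}$ on $\mathcal H_{\mathrm C}$, $V_{\mathrm C}:=\tfrac12\sum_jJ^{j\dagger}_{\mathrm C}J^j_{\mathrm C}=\sum_jv_j|v_j\rangle\langle v_j|$. Renewal map $\mathcal D^{\mathrm{re}}_{\mathrm C}(X):=\sum_j(\mathbb 1\otimes J^j_{\mathrm C})X(\mathbb 1\otimes J^j_{\mathrm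 C})^\dagger$, assumed such that for a fixed density matrix $\rho^0_{\mathrm C}$, $\sum_jJ^j_{\mathrm C}\sigma J^{j\dagger}_{\mathrm C}$ is a nonnegative multiple of $\rho^0_{\mathrm C}$ for all density matrices $\sigma$. $\mathcal L^{\mathrm{no\,re}}(X):=-i[H_{\mathrm{SC}},X]-\{\mathbb 1\otimes V_{\mathrm C},X\}$. Renewal times $0=\tau_0<\tau_1<\cdots$; $\rho_{\mathrm{SC}}(\tau_0|\tau_0):=\rho_{\mathrm S}(0)\otimes\rho^0_{\mathrm C}$; $\rho_{\mathrm{SC}}(\!(t+\tau_l|\tau_l)\!):=e^{t\mathcal L^{\mathrm{no\,re}}}(\rho_{\mathrm{SC}}(\tau_l|\tau_l))$ for $t\ge0$; for $l\ge1$, $\rho_{\mathrm{SC}}(\tau_l|\tau_l)$ is $\mathcal D^{\mathrm{re}}_{\mathrm C}(\rho_{\mathrm{SC}}(\!(\tau_l|\tau_{l-1})\!))$ normalized to unit trace; $\rho_{\mathrm{SC}}(t+\tau_l|\tau_l)$ is the unit-trace normalization of $\rho_{\mathrm{SC}}(\!(t+\tau_l|\tau_l)\!)$, $\rho_{\mathrm L}(t+\tau_l|\tau_l)$ its reduced state on $\mathrm L$. $P(t+\tau_l,+1|\tau_l):=\mathrm{tr}[\mathcal D^{\mathrm{re}}_{\mathrm C}(\rho_{\mathrm{SC}}(\!(t+\tau_l|\tau_l)\!))]$, assumed to integrate to $1$ over $t\in[0,\infty)$, with universally bounded first moments $\int_0^\infty tP(t+\tau_l,+1|\tau_l)dt\le\mathbb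 M(1)<\infty$ for all $l$. Power consumed in cycle $l$: $P^{\mathrm{in}}_l:=\frac1{T_0}\int_0^\infty\mathrm{tr}[H_{\mathrm{SC}}\mathcal D^{\mathrm{re}}_{\mathrm C}(\rho_{\mathrm{SC}}(\!(s+\tau_l|\tau_l)\!))]ds$. Instantaneous initial-cycle-state parameter: for a Hermitian $H_{\mathrm C}$ on $\mathcal H_{\mathrm C}$ and $\tilde H_{\mathrm{SC}}:=H_{\mathrm{SC}}-\mathbb 1\otimes H_{\mathrm C}$, $\varepsilon^0_{\mathrm H}$ is any real number with $\|\mathrm{tr}_{\mathrm C}[\tilde H_{\mathrm{SC}}(\mathbb 1\otimes\rho^0_{\mathrm C})]\|_F\|\tilde H_{\mathrm{SC}}\|_F\,2\,\mathbb M(1)T_0\le\varepsilon^0_{\mathrm H}$ ($\|\cdot\|_F$ Frobenius norm). Quality: $p_j(t,l):=\mathrm{tr}[(\mathbb 1\otimes|v_j\rangle\langle v_j|)\rho_{\mathrm{SC}}(\!(t+\tau_l|\tau_l)\!)]$, $\varepsilon^{\mathrm{quality}}_l(\tau):=\int_0^\tau(\sum_jv_j^2p_j(t,l))^{1/2}dt$. Gates: in cycle $l$ the logical state should pass through orthonormal $|1,l\rangle_{\mathrm L},|2,l\rangle_{\mathrm L},\dots$ (spanning $\mathcal H_{\mathrm L}$) at times $t_j=jt_1$ after $\tau_l$, with $T(\rho_{\mathrm L}(t_j+\tau_l|\tau_l),|j,l\rangle_{\mathrm L})\le\varepsilon^{\mathrm{gate}}$ ($T$ = trace distance) for all $j\in\mathbb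 Z_{>0}$ with $t_j\in(0,t_{\max,l})$; the gate frequency is $f:=1/t_1$. Isentropic interval: $t_{\max,l}\ge0$ is the largest number with $\frac1{4(1+\lambda)^2}=\varepsilon^{\mathrm{gate}}(2-\varepsilon^{\mathrm{gate}})+2\varepsilon^{\mathrm{quality}}_l(t_{\max,l})\sqrt{1-\varepsilon^{\mathrm{gate}}}$, $\lambda=4.64$. Semi-classical states: $\mathcal C(A,B)$ (for Hermitian dimensionless $A,B$) is the set of $\mathrm{tr}_{\mathrm P}[|\psi\rangle\langle\psi|]$ with $|\psi\rangle$ a normalized eigenvector of $(\lambda'A+iB)\otimes\mathbb 1_{\mathrm P}$ for some $|\lambda'|=1$, finite-dimensional ancilla $\mathrm P$; with $\bar M^{(j,l)}_{\mathrm L}:=\frac1{T_0}\sum_kt_1(1-\delta_{k,j})|k,l\rangle\langle k,l|_{\mathrm L}$ and $\bar H_{\mathrm{SC}}:=T_0H_{\mathrm{SC}}$, $\rho_{\mathrm{SC}}(\tau_l|\tau_l)\in\mathcal C^{\mathrm{clas.},l}_{\mathrm{SC}}$ iff there is $j$ with $t_j,t_{j+1}\in[0,t_{\max,l})$, $\rho_{\mathrm{SC}}(t_j+\tau_l|\tau_l)\in\mathcal C(\bar M^{(j,l)}_{\mathrm L},\bar H_{\mathrm{SC}})$ and $\rho_{\mathrm{SC}}(t_{j+1}+\tau_l|\tau_l)\in\mathcal C(\bar M^{(j+1,l)}_{\mathrm L},\bar H_{\mathrm{SC}})$. The setting presupposes that gates are actually applied during the interval, i.e. there is $j\ge1$ with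 $t_{j+1}<t_{\max,l}$. *)

theory Defs
  imports "HOL-Analysis.Henstock_Kurzweil_Integration" "Jordan_Normal_Form.Matrix"
begin

text \<open>Composite index convention: for a product space A (x) B with dim B = m,
  the basis index of |a> (x) |b> is a*m + b (consistent with kron below).\<close>

definition adj :: "complex mat \<Rightarrow> complex mat" where
  "adj A = mat (dim_col A) (dim_row A) (\<lambda>(i,j). cnj (A $$ (j,i)))"

definition tr :: "complex mat \<Rightarrow> complex" where
  "tr A = (\<Sum>i<dim_row A. A $$ (i,i))"

definition cinner :: "complex vec \<Rightarrow> complex vec \<Rightarrow> complex" where
  "cinner v w = (\<Sum>i<dim_vec v. cnj (v $ i) * w $ i)"

definition hermitian :: "complex mat \<Rightarrow> bool" where
  "hermitian A \<longleftrightarrow> A \<in> carrier_mat (dim_row A) (dim_row A) \<and> adj A = A"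

definition psd :: "complex mat \<Rightarrow> bool" where
  "psd A \<longleftrightarrow> hermitian A \<and> (\<forall>v\<in>carrier_vec (dim_row A). 0 \<le> Re (cinner v (A *\<^sub>v v)))"

definition density :: "nat \<Rightarrow> complex mat \<Rightarrow> bool" where
  "density n \<rho> \<longleftrightarrow> \<rho> \<in> carrier_mat n n \<and> psd \<rho> \<and> tr \<rho> = 1"

definition is_eigvec :: "complex mat \<Rightarrow> complex vec \<Rightarrow> complex \<Rightarrow> bool" where
  "is_eigvec A v \<mu> \<longleftrightarrow> v \<in> carrier_vec (dim_row A) \<and> v \<noteq> 0\<^sub>v (dim_row A) \<and> A *\<^sub>v v = \<mu> \<cdot>\<^sub>v v"

definition ket_bra :: "complex vec \<Rightarrow> complex vec \<Rightarrow> complex mat" where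
  "ket_bra v w = mat (dim_vec v) (dim_vec w) (\<lambda>(i,j). v $ i * cnj (w $ j))"

definition kron :: "complex mat \<Rightarrow> complex mat \<Rightarrow> complex mat" where
  "kron A B = mat (dim_row A * dim_row B) (dim_col A * dim_col B)
     (\<lambda>(i,j). A $$ (i div dim_row B, j div dim_col B) * B $$ (i mod dim_row B, j mod dim_col B))"

definition ptrace_right :: "nat \<Rightarrow> nat \<Rightarrow> complex mat \<Rightarrow> complex mat" where
  "ptrace_right n m X = mat n n (\<lambda>(i,j). \<Sum>k<m. X $$ (i*m+k, j*m+k))"

definition msum :: "nat \<Rightarrow> nat \<Rightarrow> (nat \<Rightarrow> complex mat) \<Rightarrow> complex mat" where
  "msum n m f = mat n n (\<lambda>(i,j). \<Sum>k<m. f k $$ (i,j))"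

definition fro :: "complex mat \<Rightarrow> real" where
  "fro A = sqrt (\<Sum>i<dim_row A. \<Sum>j<dim_col A. (cmod (A $$ (i,j)))\<^sup>2)"

definition mat_abs :: "complex mat \<Rightarrow> complex mat" where
  "mat_abs A = (THE B. B \<in> carrier_mat (dim_col A) (dim_col A) \<and> psd B \<and> B * B = adj A * A)"

definition trace_dist :: "complex mat \<Rightarrow> complex mat \<Rightarrow> real" where
  "trace_dist \<rho> \<sigma> = Re (tr (mat_abs (\<rho> - \<sigma>))) / 2"

definition nrm :: "complex mat \<Rightarrow> complex mat" where
  "nrm X = (1 / tr X) \<cdot>\<^sub>m X"

definition super_exp :: "(complex mat \<Rightarrow> complex mat) \<Rightarrow> real \<Rightarrow> complex mat \<Rightarrow> complex mat" where
  "super_exp L t X = mat (dim_row X) (dim_col X)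
     (\<lambda>(i,j). \<Sum>n. complex_of_real (t ^ n / fact n) * ((L ^^ n) X) $$ (i,j))"

text \<open>Data: dS = dim H_S, dC = dim H_C, H = H_SC, J j (j<m) the jump operators on H_C.\<close>

definition VC :: "(nat \<Rightarrow> complex mat) \<Rightarrow> nat \<Rightarrow> nat \<Rightarrow> complex mat" where
  "VC J m dC = (1/2) \<cdot>\<^sub>m msum dC m (\<lambda>j. adj (J j) * J j)"

definition L_nore :: "complex mat \<Rightarrow> (nat \<Rightarrow> complex mat) \<Rightarrow> nat \<Rightarrow> nat \<Rightarrow> nat \<Rightarrow> complex mat \<Rightarrow> complex mat" where
  "L_nore H J m dS dC X =
     (- \<i>) \<cdot>\<^sub>m (H * X - X * H)
     - (kron (1\<^sub>m dS) (VC J m dC) * X + X * kron (1\<^sub>m dS) (VC J m dC))"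

definition D_re :: "(nat \<Rightarrow> complex mat) \<Rightarrow> nat \<Rightarrow> nat \<Rightarrow> nat \<Rightarrow> complex mat \<Rightarrow> complex mat" where
  "D_re J m dS dC X = msum (dS * dC) m (\<lambda>j. kron (1\<^sub>m dS) (J j) * X * adj (kron (1\<^sub>m dS) (J j)))"

definition evol :: "complex mat \<Rightarrow> (nat \<Rightarrow> complex mat) \<Rightarrow> nat \<Rightarrow> nat \<Rightarrow> nat \<Rightarrow> real \<Rightarrow> complex mat \<Rightarrow> complex mat" where
  "evol H J m dS dC t X = super_exp (L_nore H J m dS dC) t X"

primrec rho_init :: "complex mat \<Rightarrow> (nat \<Rightarrow> complex mat) \<Rightarrow> nat \<Rightarrow> nat \<Rightarrow> nat \<Rightarrow> complex mat
    \<Rightarrow> complex mat \<Rightarrow> (nat \<Rightarrow> real) \<Rightarrow> nat \<Rightarrow> complex mat" where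
  "rho_init H J m dS dC \<rho>S0 \<rho>C0 \<tau> 0 = kron \<rho>S0 \<rho>C0"
| "rho_init H J m dS dC \<rho>S0 \<rho>C0 \<tau> (Suc l) =
     nrm (D_re J m dS dC (evol H J m dS dC (\<tau> (Suc l) - \<tau> l) (rho_init H J m dS dC \<rho>S0 \<rho>C0 \<tau> l)))"

definition rho_un :: "complex mat \<Rightarrow> (nat \<Rightarrow> complex mat) \<Rightarrow> nat \<Rightarrow> nat \<Rightarrow> nat \<Rightarrow> complex mat
    \<Rightarrow> complex mat \<Rightarrow> (nat \<Rightarrow> real) \<Rightarrow> nat \<Rightarrow> real \<Rightarrow> complex mat" where
  "rho_un H J m dS dC \<rho>S0 \<rho>C0 \<tau> l t = evol H J m dS dC t (rho_init H J m dS dC \<rho>S0 \<rho>C0 \<tau> l)"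

definition P_ren :: "complex mat \<Rightarrow> (nat \<Rightarrow> complex mat) \<Rightarrow> nat \<Rightarrow> nat \<Rightarrow> nat \<Rightarrow> complex mat
    \<Rightarrow> complex mat \<Rightarrow> (nat \<Rightarrow> real) \<Rightarrow> nat \<Rightarrow> real \<Rightarrow> real" where
  "P_ren H J m dS dC \<rho>S0 \<rho>C0 \<tau> l t = Re (tr (D_re J m dS dC (rho_un H J m dS dC \<rho>S0 \<rho>C0 \<tau> l t)))"

definition P_in :: "real \<Rightarrow> complex mat \<Rightarrow> (nat \<Rightarrow> complex mat) \<Rightarrow> nat \<Rightarrow> nat \<Rightarrow> nat \<Rightarrow> complex mat
    \<Rightarrow> complex mat \<Rightarrow> (nat \<Rightarrow> real) \<Rightarrow> nat \<Rightarrow> real" where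
  "P_in T0 H J m dS dC \<rho>S0 \<rho>C0 \<tau> l =
     (1 / T0) * integral {0..} (\<lambda>s. Re (tr (H * D_re J m dS dC (rho_un H J m dS dC \<rho>S0 \<rho>C0 \<tau> l s))))"

text \<open>epsilon^quality_l(tau), with V_C = sum_j vval j |vvec j><vvec j|\<close>
definition eps_quality :: "complex mat \<Rightarrow> (nat \<Rightarrow> complex mat) \<Rightarrow> nat \<Rightarrow> nat \<Rightarrow> nat \<Rightarrow> complex mat
    \<Rightarrow> complex mat \<Rightarrow> (nat \<Rightarrow> real) \<Rightarrow> (nat \<Rightarrow> real) \<Rightarrow> (nat \<Rightarrow> complex vec) \<Rightarrow> nat \<Rightarrow> real \<Rightarrow> real" where
  "eps_quality H J m dS dC \<rho>S0 \<rho>C0 \<tau> vval vvec l T =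
     integral {0..T} (\<lambda>t. sqrt (\<Sum>j<dC. (vval j)\<^sup>2 *
        Re (tr (kron (1\<^sub>m dS) (ket_bra (vvec j) (vvec j)) * rho_un H J m dS dC \<rho>S0 \<rho>C0 \<tau> l t))))"

definition semicl :: "nat \<Rightarrow> complex mat \<Rightarrow> complex mat \<Rightarrow> complex mat set" where
  "semicl d A B = {ptrace_right d dP (ket_bra \<psi> \<psi>) | dP \<psi> lam.
      0 < dP \<and> cmod lam = 1 \<and> \<psi> \<in> carrier_vec (d * dP) \<and> cinner \<psi> \<psi> = 1 \<and>
      (\<exists>\<mu>. is_eigvec (kron (lam \<cdot>\<^sub>m A + \<i> \<cdot>\<^sub>m B) (1\<^sub>m dP)) \<psi> \<mu>)}"

text \<open>bar M^{(j,l)}_L (on H_L), with kets k = |k,l>, k = 1..dL\<close>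
definition Mbar :: "real \<Rightarrow> real \<Rightarrow> nat \<Rightarrow> (nat \<Rightarrow> complex vec) \<Rightarrow> nat \<Rightarrow> complex mat" where
  "Mbar T0 t1 dL kets j = msum dL (Suc dL)
     (\<lambda>k. if 1 \<le> k \<and> k \<noteq> j then complex_of_real (t1 / T0) \<cdot>\<^sub>m ket_bra (kets k) (kets k) else 0\<^sub>m dL dL)"

end

theory Submission
  imports Defs "Jordan_Normal_Form.Jordan_Normal_Form_Existence"
begin

text \<open>
  A positive semidefinite state is written as \<open>C C\<^sup>\<dagger>\<close>, so that the matrix \<open>C\<close> with the
  Hilbert--Schmidt inner product plays the role of a purification. Between renewals \<open>C\<close> solves
  \<open>C' = (- i H - W) C\<close> with \<open>W = 1 \<otimes> V\<close>, and the quality parameter is exactly the integral of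
  \<open>\<parallel>W C\<parallel>\<close>, hence bounds the distance of \<open>C\<close> to the unitary orbit \<open>U\<close> of the same initial value.
  Two consecutive logical states are nearly orthogonal, so \<open>U\<close> moves by a fixed amount within the
  time \<open>t\<^sub>1\<close>, whereas a Margolus--Levitin estimate bounds the squared displacement by \<open>2 E t\<^sub>1\<close> with
  \<open>E\<close> the initial energy: \<open>f \<le> 8 E\<close>. At a semi-classical state \<open>C\<close> is an eigenvector of \<open>H\<close> up to an
  error \<open>t\<^sub>1 / T\<^sub>0\<^sup>2\<close>, so it moves by at most \<open>t\<^sub>1\<^sup>2 / T\<^sub>0\<^sup>2\<close> up to a phase, which forces
  \<open>f \<le> 2 / T\<^sub>0\<close>; multiplying both bounds gives the square root law. Finally \<open>E\<close> is compared with the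
  energy after the next renewal: the renewed states are products with a fixed state of C, and
  the reduced state on S changes only through \<open>H - 1 \<otimes> H\<^sub>C\<close> during the mean waiting time.
\<close>

subsection \<open>Matrix algebra\<close>

abbreviation cmat :: "nat \<Rightarrow> nat \<Rightarrow> complex mat set" where "cmat \<equiv> carrier_mat"

declare index_mult_mat(1) [simp del]

text \<open>Entries as plain finite sums, ready for \<open>sum.swap\<close>; this is why
  \<open>index_mult_mat(1)\<close>, which yields scalar products of rows and columns, leaves the
  simp set.\<close>

lemma mult_index:
  assumes "A \<in> cmat n k" "B \<in> cmat k m" "i < n" "j < m"
  shows "(A * B) $$ (i,j) = (\<Sum>l<k. A $$ (i,l) * B $$ (l,j))"
  using assms by (simp add: index_mult_mat(1) scalar_prod_def atLeast0LessThan)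

text \<open>The side conditions are equations between dimensions, so the simplifier can discharge
  them without guessing carrier sizes.\<close>

lemma mult_assoc_dim:
  fixes A B C :: "complex mat"
  shows "dim_col A = dim_row B \<Longrightarrow> dim_col B = dim_row C \<Longrightarrow> A * B * C = A * (B * C)"
  by (rule assoc_mult_mat[of _ "dim_row A" "dim_col A" _ "dim_col B" _ "dim_col C"]) auto

lemma mat_eqI:
  assumes "X \<in> cmat n m" "Y \<in> cmat n m" "\<And>i j. i < n \<Longrightarrow> j < m \<Longrightarrow> X $$ (i,j) = Y $$ (i,j)"
  shows "X = Y"
  using assms by (intro eq_matI) auto

lemma adj_carrier [simp]: "A \<in> cmat n m \<Longrightarrow> adj A \<in> cmat m n"
  by (auto simp: adj_def)

lemma dim_adj [simp]: "dim_row (adj A) = dim_col A" "dim_col (adj A) = dim_row A"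
  by (auto simp: adj_def)

lemma adj_index [simp]: "i < dim_col A \<Longrightarrow> j < dim_row A \<Longrightarrow> adj A $$ (i,j) = cnj (A $$ (j,i))"
  by (auto simp: adj_def)

lemma adj_adj [simp]: "adj (adj A) = A"
  by (rule eq_matI) auto

lemma adj_mult:
  assumes "A \<in> cmat n k" "B \<in> cmat k m"
  shows "adj (A * B) = adj B * adj A"
proof (rule mat_eqI[of _ m n])
  fix i j assume ij: "i < m" "j < n"
  show "adj (A * B) $$ (i, j) = (adj B * adj A) $$ (i, j)"
    using assms ij
    by (simp add: mult_index[OF assms ij(2) ij(1)]
        mult_index[OF adj_carrier[OF assms(2)] adj_carrier[OF assms(1)] ij] mult.commute)
qed (use assms in auto)

lemma adj_minus: "A \<in> cmat n m \<Longrightarrow> B \<in> cmat n m \<Longrightarrow> adj (A - B) = adj A - adj B"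
  by (rule eq_matI) auto

lemma adj_smult: "adj (c \<cdot>\<^sub>m A) = cnj c \<cdot>\<^sub>m adj A"
  by (rule eq_matI) auto

lemma adj_one [simp]: "adj (1\<^sub>m n) = 1\<^sub>m n"
  by (rule eq_matI) auto

lemma hermitian_adj: "hermitian A \<Longrightarrow> adj A = A"
  by (simp add: hermitian_def)

lemma tr_comm:
  assumes "A \<in> cmat n m" "B \<in> cmat m n"
  shows "tr (A * B) = tr (B * A)"
proof -
  have "tr (A * B) = (\<Sum>i<n. \<Sum>l<m. A $$ (i,l) * B $$ (l,i))"
    using assms by (simp add: tr_def mult_index[OF assms])
  also have "\<dots> = (\<Sum>l<m. \<Sum>i<n. B $$ (l,i) * A $$ (i,l))"
    by (subst sum.swap) (simp add: mult.commute)
  also have "\<dots> = tr (B * A)"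
    using assms by (simp add: tr_def mult_index[OF assms(2,1)])
  finally show ?thesis .
qed

lemma tr_add: "A \<in> cmat n n \<Longrightarrow> B \<in> cmat n n \<Longrightarrow> tr (A + B) = tr A + tr B"
  by (simp add: tr_def sum.distrib)

lemma tr_smult: "A \<in> cmat n n \<Longrightarrow> tr (c \<cdot>\<^sub>m A) = c * tr A"
  by (simp add: tr_def sum_distrib_left)

subsection \<open>The real Hilbert--Schmidt inner product\<close>

text \<open>The real part only, that is, the Euclidean structure of matrices seen as real vectors.
  It suffices for norms and energies, and multiplication by \<open>- \<i>\<close> times a Hermitian
  matrix is skew for it.\<close>

definition ip :: "complex mat \<Rightarrow> complex mat \<Rightarrow> real" where
  "ip X Y = (\<Sum>i<dim_row X. \<Sum>j<dim_col X. inner (X $$ (i,j)) (Y $$ (i,j)))"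

lemma ip_eq_tr:
  assumes "X \<in> cmat n m" "Y \<in> cmat n m"
  shows "ip X Y = Re (tr (Y * adj X))"
  using assms
  by (simp add: ip_def tr_def mult_index[OF assms(2) adj_carrier[OF assms(1)]] inner_complex_def
      mult.commute)

lemma ip_commute:
  assumes "X \<in> cmat n m" "Y \<in> cmat n m"
  shows "ip X Y = ip Y X"
  using assms by (simp add: ip_def inner_commute)

lemma ip_add_right: "X \<in> cmat n m \<Longrightarrow> Y \<in> cmat n m \<Longrightarrow> Z \<in> cmat n m \<Longrightarrow>
    ip X (Y + Z) = ip X Y + ip X Z"
  by (simp add: ip_def inner_right_distrib sum.distrib)

lemma ip_minus_right: "X \<in> cmat n m \<Longrightarrow> Y \<in> cmat n m \<Longrightarrow> Z \<in> cmat n m \<Longrightarrow>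
    ip X (Y - Z) = ip X Y - ip X Z"
  by (simp add: ip_def inner_diff_right sum_subtractf)

lemma ip_add_left: "X \<in> cmat n m \<Longrightarrow> Y \<in> cmat n m \<Longrightarrow> Z \<in> cmat n m \<Longrightarrow>
    ip (Y + Z) X = ip Y X + ip Z X"
  by (simp add: ip_def inner_left_distrib sum.distrib)

lemma ip_minus_left: "X \<in> cmat n m \<Longrightarrow> Y \<in> cmat n m \<Longrightarrow> Z \<in> cmat n m \<Longrightarrow>
    ip (Y - Z) X = ip Y X - ip Z X"
  by (simp add: ip_def inner_diff_left sum_subtractf)

lemma ip_smult_right: "X \<in> cmat n m \<Longrightarrow> Y \<in> cmat n m \<Longrightarrow>
    ip X (of_real c \<cdot>\<^sub>m Y) = c * ip X Y"
  by (simp add: ip_def sum_distrib_left inner_complex_def algebra_simps)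

lemma ip_smult_move: "X \<in> cmat n m \<Longrightarrow> Y \<in> cmat n m \<Longrightarrow>
    ip X (c \<cdot>\<^sub>m Y) = ip (cnj c \<cdot>\<^sub>m X) Y"
  by (simp add: ip_def inner_complex_def algebra_simps)

lemma ip_mult_left_move:
  assumes "M \<in> cmat n k" "Y \<in> cmat k m" "X \<in> cmat n m"
  shows "ip X (M * Y) = ip (adj M * X) Y"
proof -
  have "ip X (M * Y) = Re (tr (M * Y * adj X))"
    using assms by (intro ip_eq_tr) auto
  also have "\<dots> = Re (tr (M * (Y * adj X)))"
    using assms by (simp add: mult_assoc_dim)
  also have "\<dots> = Re (tr (Y * adj X * M))"
    using assms by (subst tr_comm[of _ n k]) auto
  also have "\<dots> = Re (tr (Y * (adj X * M)))"
    using assms by (simp add: mult_assoc_dim)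
  also have "\<dots> = Re (tr (Y * adj (adj M * X)))"
    using assms by (subst adj_mult[of _ k n _ m]) auto
  also have "\<dots> = ip (adj M * X) Y"
    using assms by (intro ip_eq_tr[symmetric]) auto
  finally show ?thesis .
qed

lemma fro_L2: "fro X = L2_set (\<lambda>(i,j). cmod (X $$ (i,j))) ({..<dim_row X} \<times> {..<dim_col X})"
  by (simp add: fro_def L2_set_def sum.cartesian_product case_prod_unfold)

lemma fro_nonneg [simp]: "0 \<le> fro X"
  by (simp add: fro_L2)

lemma ip_self: "ip X X = (fro X)\<^sup>2"
  by (simp add: ip_def fro_def sum_nonneg dot_square_norm)

lemma ip_nonneg [simp]: "0 \<le> ip X X"
  by (simp add: ip_self)

lemma ip_Cauchy_Schwarz:
  assumes "X \<in> cmat n m" "Y \<in> cmat n m"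
  shows "\<bar>ip X Y\<bar> \<le> fro X * fro Y"
proof -
  let ?I = "{..<n} \<times> {..<m}"
  have "\<bar>ip X Y\<bar> = \<bar>\<Sum>(i,j)\<in>?I. inner (X $$ (i,j)) (Y $$ (i,j))\<bar>"
    using assms by (simp add: ip_def sum.cartesian_product)
  also have "\<dots> \<le> (\<Sum>(i,j)\<in>?I. \<bar>inner (X $$ (i,j)) (Y $$ (i,j))\<bar>)"
    by (rule order_trans[OF sum_abs]) (simp add: case_prod_unfold)
  also have "\<dots> \<le> (\<Sum>p\<in>?I. \<bar>cmod (X $$ p)\<bar> * \<bar>cmod (Y $$ p)\<bar>)"
    by (rule sum_mono) (auto simp: Cauchy_Schwarz_ineq2)
  also have "\<dots> \<le> L2_set (\<lambda>p. cmod (X $$ p)) ?I * L2_set (\<lambda>p. cmod (Y $$ p)) ?I"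
    by (rule L2_set_mult_ineq)
  also have "\<dots> = fro X * fro Y"
    using assms by (simp add: fro_L2 case_prod_unfold)
  finally show ?thesis .
qed

lemma fro_triangle:
  assumes "X \<in> cmat n m" "Y \<in> cmat n m"
  shows "fro (X + Y) \<le> fro X + fro Y"
proof -
  let ?I = "{..<n} \<times> {..<m}"
  have "fro (X + Y) \<le> L2_set (\<lambda>p. cmod (X $$ p) + cmod (Y $$ p)) ?I"
    using assms unfolding fro_L2 
    by (auto intro!: L2_set_mono simp: norm_triangle_ineq)
  also have "\<dots> \<le> L2_set (\<lambda>p. cmod (X $$ p)) ?I + L2_set (\<lambda>p. cmod (Y $$ p)) ?I"
    by (rule L2_set_triangle_ineq)
  also have "\<dots> = fro X + fro Y"
    using assms by (simp add: fro_L2 case_prod_unfold)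
  finally show ?thesis .
qed

lemma fro_smult [simp]: "fro (c \<cdot>\<^sub>m X) = cmod c * fro X"
proof -
  have "fro (c \<cdot>\<^sub>m X) = sqrt ((cmod c)\<^sup>2 * (\<Sum>i<dim_row X. \<Sum>j<dim_col X. (cmod (X $$ (i,j)))\<^sup>2))"
    by (simp add: fro_def norm_mult power_mult_distrib sum_distrib_left)
  then show ?thesis by (simp add: fro_def real_sqrt_mult)
qed

lemma fro_adj [simp]: "fro (adj X) = fro X"
  unfolding fro_def by (subst sum.swap) simp

lemma fro_triangle_minus:
  assumes "X \<in> cmat n m" "Y \<in> cmat n m"
  shows "fro (X - Y) \<le> fro X + fro Y"
proof -
  have "X - Y = X + (-1) \<cdot>\<^sub>m Y" using assms by (intro eq_matI) auto
  then show ?thesis using fro_triangle[OF assms(1), of "(-1) \<cdot>\<^sub>m Y"] assms by simp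
qed

lemma fro_minus_triangle2:
  assumes "X \<in> cmat n m" "Y \<in> cmat n m"
  shows "fro X - fro Y \<le> fro (X - Y)"
proof -
  have "(X - Y) + Y = X" using assms by (intro eq_matI) auto
  then show ?thesis using fro_triangle[of "X - Y" n m Y] assms by (simp add: minus_carrier_mat)
qed

lemma fro_eq_0:
  assumes "fro X = 0" "X \<in> cmat n m"
  shows "X = 0\<^sub>m n m"
proof -
  have *: "(\<Sum>p\<in>{..<n} \<times> {..<m}. (cmod (X $$ p))\<^sup>2) = 0"
    using assms by (simp add: fro_def sum.cartesian_product case_prod_unfold)
  have "\<forall>p\<in>{..<n} \<times> {..<m}. (cmod (X $$ p))\<^sup>2 = 0"
    using * by (subst (asm) sum_nonneg_eq_0_iff) auto
  then show ?thesis using assms(2) by (intro eq_matI) auto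
qed

text \<open>\<open>\<parallel>P X\<parallel>\<^sup>2 = \<langle>X, P X\<rangle> \<le> \<parallel>X\<parallel> \<parallel>P X\<parallel>\<close>.\<close>

lemma fro_projection:
  assumes P: "P \<in> cmat n n" "adj P = P" "P * P = P" and X: "X \<in> cmat n m"
  shows "(fro (P * X))\<^sup>2 = ip X (P * X)" and "fro (P * X) \<le> fro X"
proof -
  have "P * (P * X) = P * X"
    using assms by (simp add: mult_assoc_dim[symmetric])
  then show eq: "(fro (P * X))\<^sup>2 = ip X (P * X)"
    using assms by (simp flip: ip_self add: ip_mult_left_move[of P n n X m "P * X"] ip_commute[of X n m])
  have "(fro (P * X))\<^sup>2 \<le> fro X * fro (P * X)"
    unfolding eq using ip_Cauchy_Schwarz[of X n m "P * X"] assms by fastforce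
  then show "fro (P * X) \<le> fro X"
    using fro_nonneg[of "P * X"] fro_nonneg[of X]
    by (cases "fro (P * X) = 0") (auto simp: power2_eq_square)
qed

subsection \<open>Tensor products and partial traces\<close>

lemma prod_index_less: "i < n \<Longrightarrow> k < m \<Longrightarrow> i * m + k < n * (m::nat)"
proof -
  assume "i < n" "k < m"
  then have "i * m + k < Suc i * m" by simp
  also have "\<dots> \<le> n * m" using \<open>i < n\<close> by (intro mult_le_mono1) simp
  finally show ?thesis .
qed

lemma sum_prod_index:
  fixes f :: "nat \<Rightarrow> 'a::comm_monoid_add"
  shows "(\<Sum>x<n*m. f x) = (\<Sum>i<n. \<Sum>k<m. f (i*m+k))"
proof -
  have "(\<Sum>x<n*m. f x) = (\<Sum>i<n. sum f {i*m..<i*m+m})"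
    by (simp add: sum.nat_group)
  also have "\<dots> = (\<Sum>i<n. \<Sum>k<m. f (i*m+k))"
  proof (rule sum.cong[OF refl])
    fix i
    show "sum f {i*m..<i*m+m} = (\<Sum>k<m. f (i*m+k))"
      using sum.shift_bounds_nat_ivl[of f 0 "i*m" m] by (simp add: atLeast0LessThan add.commute)
  qed
  finally show ?thesis .
qed

lemma mat_eq_prodI:
  assumes "X \<in> cmat (n*m) (n'*m')" "Y \<in> cmat (n*m) (n'*m')"
    and "\<And>i k j l. i < n \<Longrightarrow> k < m \<Longrightarrow> j < n' \<Longrightarrow> l < m' \<Longrightarrow>
      X $$ (i*m+k, j*m'+l) = Y $$ (i*m+k, j*m'+l)"
  shows "X = Y"
proof (rule eq_matI)
  fix x y assume xy: "x < dim_row Y" "y < dim_col Y"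
  then have lt: "x < n * m" "y < n' * m'" using assms by auto
  then have pos: "0 < m" "0 < m'" by (auto intro: gr0I)
  have "X $$ (x div m * m + x mod m, y div m' * m' + y mod m') =
        Y $$ (x div m * m + x mod m, y div m' * m' + y mod m')"
    using lt pos by (intro assms(3)) (auto simp: less_mult_imp_div_less)
  then show "X $$ (x,y) = Y $$ (x,y)" by simp
qed (use assms in auto)

lemma kron_carrier [simp]:
  "A \<in> cmat n n' \<Longrightarrow> B \<in> cmat m m' \<Longrightarrow> kron A B \<in> cmat (n*m) (n'*m')"
  by (auto simp: kron_def)

lemma dim_kron [simp]:
  "dim_row (kron A B) = dim_row A * dim_row B" "dim_col (kron A B) = dim_col A * dim_col B"
  by (auto simp: kron_def)

lemma kron_index:
  assumes "A \<in> cmat n n'" "B \<in> cmat m m'" "i < n" "k < m" "j < n'" "l < m'"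
  shows "kron A B $$ (i*m+k, j*m'+l) = A $$ (i,j) * B $$ (k,l)"
proof -
  have "(i*m+k) div m = i" "(i*m+k) mod m = k" "(j*m'+l) div m' = j" "(j*m'+l) mod m' = l"
    using assms by auto
  then show ?thesis
    using assms prod_index_less[of i n k m] prod_index_less[of j n' l m'] by (simp add: kron_def)
qed

lemma kron_mult:
  assumes A: "A \<in> cmat n n" and B: "B \<in> cmat m m"
    and C: "C \<in> cmat n n" and D: "D \<in> cmat m m"
  shows "kron A B * kron C D = kron (A * C) (B * D)" (is "?L = ?R")
proof (rule mat_eq_prodI[of _ n m n m])
  fix i k j l assume ij: "i < n" "k < m" "j < n" "l < m"
  have AB: "kron A B \<in> cmat (n*m) (n*m)" and CD: "kron C D \<in> cmat (n*m) (n*m)"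
    using assms by auto
  have "?L $$ (i*m+k, j*m+l) =
      (\<Sum>a<n. \<Sum>b<m. kron A B $$ (i*m+k, a*m+b) * kron C D $$ (a*m+b, j*m+l))"
    using ij by (subst mult_index[OF AB CD]) (auto simp: prod_index_less sum_prod_index)
  also have "\<dots> = (\<Sum>a<n. \<Sum>b<m. (A $$ (i,a) * C $$ (a,j)) * (B $$ (k,b) * D $$ (b,l)))"
    using ij by (intro sum.cong refl) (simp add: kron_index[OF A B] kron_index[OF C D])
  also have "\<dots> = ?R $$ (i*m+k, j*m+l)"
    using ij assms
    by (simp add: kron_index[of "A * C" n n "B * D" m m] mult_index[OF A C] mult_index[OF B D] sum_product)
  finally show "?L $$ (i*m+k, j*m+l) = ?R $$ (i*m+k, j*m+l)" .
qed (use assms in auto)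

lemma kron_comm:
  assumes "A \<in> cmat n n" "B \<in> cmat m m"
  shows "kron A (1\<^sub>m m) * kron (1\<^sub>m n) B = kron (1\<^sub>m n) B * kron A (1\<^sub>m m)"
  using assms by (simp add: kron_mult[of _ n _ m] left_mult_one_mat[of _ n n] right_mult_one_mat[of _ n n]
      left_mult_one_mat[of _ m m] right_mult_one_mat[of _ m m])

lemma adj_kron:
  assumes A: "A \<in> cmat n n'" and B: "B \<in> cmat m m'"
  shows "adj (kron A B) = kron (adj A) (adj B)"
proof (rule mat_eq_prodI[of _ n' m' n m])
  fix i k j l assume ij: "i < n'" "k < m'" "j < n" "l < m"
  have "adj (kron A B) $$ (i*m'+k, j*m+l) = cnj (kron A B $$ (j*m+l, i*m'+k))"
    using ij assms by (intro adj_index) (auto simp: prod_index_less)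
  then show "adj (kron A B) $$ (i*m'+k, j*m+l) = kron (adj A) (adj B) $$ (i*m'+k, j*m+l)"
    using ij assms kron_index[of "adj A" n' n "adj B" m' m]
    by (simp add: kron_index[OF A B])
qed (use assms in auto)

lemma kron_one [simp]: "kron (1\<^sub>m n) (1\<^sub>m m) = 1\<^sub>m (n*m)"
proof (rule mat_eq_prodI[of _ n m n m])
  fix i k j l assume ij: "i < n" "k < m" "j < n" "l < m"
  have "(i*m+k = j*m+l) = (i = j \<and> k = l)"
    using ij by (metis div_mult_self3 div_less mod_less mod_mult_self3 add.right_neutral less_nat_zero_code)
  then show "kron (1\<^sub>m n) (1\<^sub>m m) $$ (i*m+k, j*m+l) = 1\<^sub>m (n*m) $$ (i*m+k, j*m+l)"
    using ij by (simp add: kron_index[of _ n n _ m m] prod_index_less)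
qed auto

lemma tr_kron:
  assumes A: "A \<in> cmat n n" and B: "B \<in> cmat m m"
  shows "tr (kron A B) = tr A * tr B"
  using assms by (simp add: tr_def sum_prod_index kron_index[OF A B] sum_product)

lemma ptrace_carrier [simp]: "ptrace_right n m X \<in> cmat n n"
  by (simp add: ptrace_right_def)

lemma kron_left_mult_index:
  assumes A: "A \<in> cmat n n" and X: "X \<in> cmat (n*m) q" and "i < n" "k < m" "j < q"
  shows "(kron A (1\<^sub>m m) * X) $$ (i*m+k, j) = (\<Sum>a<n. A $$ (i,a) * X $$ (a*m+k, j))"
proof -
  have K: "kron A (1\<^sub>m m) \<in> cmat (n*m) (n*m)" using A by auto
  have "(kron A (1\<^sub>m m) * X) $$ (i*m+k, j) =
      (\<Sum>a<n. \<Sum>b<m. kron A (1\<^sub>m m) $$ (i*m+k, a*m+b) * X $$ (a*m+b, j))"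
    using assms by (subst mult_index[OF K X]) (auto simp: prod_index_less sum_prod_index)
  also have "\<dots> = (\<Sum>a<n. \<Sum>b<m. if b = k then A $$ (i,a) * X $$ (a*m+b, j) else 0)"
    using assms by (intro sum.cong refl) (auto simp: kron_index[OF A, of "1\<^sub>m m" m m])
  also have "\<dots> = (\<Sum>a<n. A $$ (i,a) * X $$ (a*m+k, j))"
    using assms by (simp add: sum.delta)
  finally show ?thesis .
qed

lemma tr_kron_ptrace:
  assumes A: "A \<in> cmat n n" and X: "X \<in> cmat (n*m) (n*m)"
  shows "tr (kron A (1\<^sub>m m) * X) = tr (A * ptrace_right n m X)"
proof -
  have "tr (kron A (1\<^sub>m m) * X) = (\<Sum>i<n. \<Sum>k<m. \<Sum>a<n. A $$ (i,a) * X $$ (a*m+k, i*m+k))"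
    using A by (simp add: tr_def sum_prod_index kron_left_mult_index[OF A X] prod_index_less)
  also have "\<dots> = (\<Sum>i<n. \<Sum>a<n. \<Sum>k<m. A $$ (i,a) * X $$ (a*m+k, i*m+k))"
    by (intro sum.cong refl sum.swap)
  also have "\<dots> = tr (A * ptrace_right n m X)"
    using A by (simp add: tr_def mult_index[OF A, of "ptrace_right n m X" n])
      (simp add: ptrace_right_def sum_distrib_left)
  finally show ?thesis .
qed

text \<open>Traces out the rest of S and the system C in one stroke, so that the gate lemmas can
  treat both as a single ancilla. Both bracketings give the same composite index.\<close>

lemma ptrace_ptrace:
  "ptrace_right n m (ptrace_right (n*m) q X) = ptrace_right n (m*q) X"
proof (rule mat_eqI[of _ n n])
  fix i j assume ij: "i < n" "j < n"
  have "i * (m * q) + (a * q + b) = (i * m + a) * q + b" for i a b by (simp add: algebra_simps)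
  then show "ptrace_right n m (ptrace_right (n*m) q X) $$ (i,j) = ptrace_right n (m*q) X $$ (i,j)"
    using ij by (simp add: ptrace_right_def prod_index_less sum_prod_index add.assoc[symmetric])
qed (auto simp: ptrace_right_def)

text \<open>Cauchy-Schwarz over \<open>a\<close> in each entry, with \<open>k\<close> a spectator.
  The factor is the norm of \<open>A\<close> itself; estimating \<open>kron A (1\<^sub>m m)\<close>
  as a whole would cost an extra \<open>sqrt m\<close> and miss the form of \<epsilon>H.\<close>

lemma fro_kron_left_le:
  assumes A: "A \<in> cmat n n" and X: "X \<in> cmat (n*m) q"
  shows "fro (kron A (1\<^sub>m m) * X) \<le> fro A * fro X"
proof -
  let ?a = "\<lambda>i. \<Sum>a<n. (cmod (A $$ (i,a)))\<^sup>2" and ?x = "\<lambda>k j. \<Sum>a<n. (cmod (X $$ (a*m+k,j)))\<^sup>2"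
  have entry: "(cmod ((kron A (1\<^sub>m m) * X) $$ (i*m+k, j)))\<^sup>2 \<le>
      ?a i * ?x k j"
    if "i < n" "k < m" "j < q" for i k j
  proof -
    have "cmod ((kron A (1\<^sub>m m) * X) $$ (i*m+k, j)) \<le>
        (\<Sum>a<n. \<bar>cmod (A $$ (i,a))\<bar> * \<bar>cmod (X $$ (a*m+k,j))\<bar>)"
      unfolding kron_left_mult_index[OF A X that]
      by (rule order_trans[OF norm_sum]) (simp add: norm_mult)
    also have "\<dots> \<le> L2_set (\<lambda>a. cmod (A $$ (i,a))) {..<n} * L2_set (\<lambda>a. cmod (X $$ (a*m+k,j))) {..<n}"
      by (rule L2_set_mult_ineq)
    finally have "(cmod ((kron A (1\<^sub>m m) * X) $$ (i*m+k, j)))\<^sup>2 \<le>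
        (L2_set (\<lambda>a. cmod (A $$ (i,a))) {..<n} * L2_set (\<lambda>a. cmod (X $$ (a*m+k,j))) {..<n})\<^sup>2"
      by (rule power_mono) simp
    then show ?thesis by (simp add: power_mult_distrib L2_set_def sum_nonneg)
  qed
  have factor: "(\<Sum>i<n. \<Sum>k<m. \<Sum>j<q. F i * G k j) = (\<Sum>i<n. F i) * (\<Sum>k<m. \<Sum>j<q. G k j)"
    for F :: "nat \<Rightarrow> real" and G
    by (simp only: sum_distrib_left[symmetric] sum_distrib_right[symmetric])
  have "(fro (kron A (1\<^sub>m m) * X))\<^sup>2 = (\<Sum>i<n. \<Sum>k<m. \<Sum>j<q. (cmod ((kron A (1\<^sub>m m) * X) $$ (i*m+k, j)))\<^sup>2)"
    using assms by (simp add: fro_def sum_nonneg sum_prod_index)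
  also have "\<dots> \<le> (\<Sum>i<n. \<Sum>k<m. \<Sum>j<q. ?a i * ?x k j)"
    using entry by (intro sum_mono) auto
  also have "\<dots> = (\<Sum>i<n. ?a i) *
      (\<Sum>k<m. \<Sum>j<q. ?x k j)"
    by (rule factor)
  also have "(\<Sum>k<m. \<Sum>j<q. ?x k j) = (\<Sum>k<m. \<Sum>a<n. \<Sum>j<q. (cmod (X $$ (a*m+k,j)))\<^sup>2)"
    by (intro sum.cong refl sum.swap)
  also have "\<dots> = (\<Sum>a<n. \<Sum>k<m. \<Sum>j<q. (cmod (X $$ (a*m+k,j)))\<^sup>2)"
    by (rule sum.swap)
  also have "(\<Sum>i<n. ?a i) * \<dots> = (fro A * fro X)\<^sup>2"
    using assms by (simp add: fro_def sum_nonneg power_mult_distrib sum_prod_index)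
  finally show ?thesis by (rule power2_le_imp_le) simp
qed

lemma fro_mult_le:
  assumes "A \<in> cmat n n" "B \<in> cmat n q"
  shows "fro (A * B) \<le> fro A * fro B"
proof -
  have "kron A (1\<^sub>m 1) = A" using assms by (intro eq_matI) (auto simp: kron_def)
  then show ?thesis using fro_kron_left_le[of A n B 1 q] assms by simp
qed

subsection \<open>Orthonormal families and square roots\<close>

definition onf :: "nat \<Rightarrow> nat set \<Rightarrow> (nat \<Rightarrow> complex vec) \<Rightarrow> bool" where
  "onf d I v \<longleftrightarrow> finite I \<and> (\<forall>k\<in>I. v k \<in> carrier_vec d) \<and>
     (\<forall>k\<in>I. \<forall>l\<in>I. cinner (v k) (v l) = (if k = l then 1 else 0))"

text \<open>A spectral sum over a possibly incomplete orthonormal family. Products act on the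
  coefficients alone, so projections, squares and roots are all handled by changing
  \<open>a\<close>.\<close>

definition osum :: "nat \<Rightarrow> nat set \<Rightarrow> (nat \<Rightarrow> complex) \<Rightarrow> (nat \<Rightarrow> complex vec) \<Rightarrow> complex mat" where
  "osum d I a v = mat d d (\<lambda>(i,j). \<Sum>k\<in>I. a k * (v k $ i * cnj (v k $ j)))"

lemma cinner_carrier: "x \<in> carrier_vec d \<Longrightarrow> cinner x y = (\<Sum>i<d. cnj (x $ i) * y $ i)"
  by (auto simp: cinner_def)

lemma onf_carrier: "onf d I v \<Longrightarrow> k \<in> I \<Longrightarrow> v k \<in> carrier_vec d"
  by (auto simp: onf_def)

lemma osum_carrier [simp]: "osum d I a v \<in> cmat d d"
  by (simp add: osum_def)

lemma osum_mult:
  assumes "onf d I v"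
  shows "osum d I a v * osum d I b v = osum d I (\<lambda>k. a k * b k) v" (is "?L = ?R")
proof (rule mat_eqI[of _ d d])
  fix i j assume ij: "i < d" "j < d"
  let ?g = "\<lambda>l k k'. (a k * (v k $ i * cnj (v k $ l))) * (b k' * (v k' $ l * cnj (v k' $ j)))"
  have fin: "finite I" using assms by (simp add: onf_def)
  have "?L $$ (i,j) =
     (\<Sum>l<d. \<Sum>k\<in>I. \<Sum>k'\<in>I. ?g l k k')"
    using ij by (simp add: mult_index[of _ d d _ d]) (simp add: osum_def sum_product)
  also have "\<dots> = (\<Sum>k\<in>I. \<Sum>l<d. \<Sum>k'\<in>I. ?g l k k')"
    by (rule sum.swap)
  also have "\<dots> = (\<Sum>k\<in>I. \<Sum>k'\<in>I. \<Sum>l<d. ?g l k k')"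
    by (intro sum.cong refl sum.swap)
  also have "\<dots> = (\<Sum>k\<in>I. \<Sum>k'\<in>I. (a k * b k' * v k $ i * cnj (v k' $ j)) * cinner (v k) (v k'))"
    using assms by (intro sum.cong refl) (simp add: cinner_carrier[OF onf_carrier] sum_distrib_left mult_ac)
  also have "\<dots> = (\<Sum>k\<in>I. \<Sum>k'\<in>I. if k = k' then a k * b k' * v k $ i * cnj (v k' $ j) else 0)"
    using assms by (intro sum.cong refl) (auto simp: onf_def)
  also have "\<dots> = ?R $$ (i,j)"
    using ij fin by (simp add: osum_def sum.delta mult_ac)
  finally show "?L $$ (i,j) = ?R $$ (i,j)" .
qed (auto simp: osum_def)

lemma adj_osum: "adj (osum d I a v) = osum d I (\<lambda>k. cnj (a k)) v"
  by (rule eq_matI) (auto simp: osum_def mult_ac)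

lemma osum_vec_index:
  assumes "onf d I v" "w \<in> carrier_vec d" "i < d"
  shows "(osum d I a v *\<^sub>v w) $ i = (\<Sum>k\<in>I. a k * v k $ i * cinner (v k) w)"
proof -
  have "(osum d I a v *\<^sub>v w) $ i = (\<Sum>l<d. \<Sum>k\<in>I. (a k * (v k $ i * cnj (v k $ l))) * w $ l)"
    using assms by (simp add: osum_def scalar_prod_def atLeast0LessThan sum_distrib_right)
  also have "\<dots> = (\<Sum>k\<in>I. \<Sum>l<d. (a k * (v k $ i * cnj (v k $ l))) * w $ l)"
    by (rule sum.swap)
  also have "\<dots> = (\<Sum>k\<in>I. a k * v k $ i * cinner (v k) w)"
    using assms by (intro sum.cong refl) (simp add: cinner_carrier[OF onf_carrier] sum_distrib_left mult_ac)
  finally show ?thesis .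
qed

lemma osum_mult_vec:
  assumes v: "onf d I v" "k \<in> I"
  shows "osum d I a v *\<^sub>v v k = a k \<cdot>\<^sub>v v k"
proof (rule eq_vecI)
  have vk: "v k \<in> carrier_vec d" and fin: "finite I" using v by (auto simp: onf_def)
  show "dim_vec (osum d I a v *\<^sub>v v k) = dim_vec (a k \<cdot>\<^sub>v v k)" using vk by (simp add: osum_def)
  fix i assume "i < dim_vec (a k \<cdot>\<^sub>v v k)"
  then have i: "i < d" using vk by simp
  have "(osum d I a v *\<^sub>v v k) $ i = (\<Sum>k'\<in>I. if k' = k then a k' * v k' $ i else 0)"
    unfolding osum_vec_index[OF v(1) vk i] using v by (intro sum.cong refl) (auto simp: onf_def)
  then show "(osum d I a v *\<^sub>v v k) $ i = (a k \<cdot>\<^sub>v v k) $ i"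
    using v(2) vk i fin by (simp add: sum.delta)
qed

lemma cinner_mult_vec:
  assumes "A \<in> cmat n m" "x \<in> carrier_vec n" "y \<in> carrier_vec m"
  shows "cinner x (A *\<^sub>v y) = cinner (adj A *\<^sub>v x) y"
proof -
  have "cinner x (A *\<^sub>v y) = (\<Sum>i<n. \<Sum>j<m. cnj (x $ i) * (A $$ (i,j) * y $ j))"
    using assms by (simp add: cinner_def scalar_prod_def atLeast0LessThan sum_distrib_left)
  also have "\<dots> = (\<Sum>j<m. \<Sum>i<n. cnj (x $ i) * (A $$ (i,j) * y $ j))"
    by (rule sum.swap)
  also have "\<dots> = cinner (adj A *\<^sub>v x) y"
    using assms by (simp add: cinner_def scalar_prod_def atLeast0LessThan sum_distrib_right)
      (simp add: mult_ac)
  finally show ?thesis .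
qed

lemma cinner_smult: 
  "dim_vec x = dim_vec y \<Longrightarrow> cinner x (c \<cdot>\<^sub>v y) = c * cinner x y"
  "cinner (c \<cdot>\<^sub>v x) y = cnj c * cinner x y"
  by (simp_all add: cinner_def sum_distrib_left mult_ac)

lemma cinner_cnj: "dim_vec x = dim_vec y \<Longrightarrow> cnj (cinner x y) = cinner y x"
  by (simp add: cinner_def mult.commute)

lemma cinner_self: "cinner x x = of_real (\<Sum>i<dim_vec x. (cmod (x $ i))\<^sup>2)"
  by (simp add: cinner_def complex_norm_square mult.commute del: of_real_power)

lemma cinner_self_pos:
  assumes "x \<in> carrier_vec n" "x \<noteq> 0\<^sub>v n"
  shows "0 < (\<Sum>i<dim_vec x. (cmod (x $ i))\<^sup>2)"
proof (rule ccontr)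
  assume "\<not> ?thesis"
  then have "(\<Sum>i<dim_vec x. (cmod (x $ i))\<^sup>2) = 0"
    using sum_nonneg[of "{..<dim_vec x}" "\<lambda>i. (cmod (x $ i))\<^sup>2"] by fastforce
  then have "\<forall>i<dim_vec x. x $ i = 0"
    by (subst (asm) sum_nonneg_eq_0_iff) auto
  then have "x = 0\<^sub>v n" using assms(1) by (intro eq_vecI) auto
  then show False using assms(2) by simp
qed

text \<open>For the projection \<open>P\<close> onto the span, card I = tr P =
  \<parallel>P\<parallel>^2 <= \<parallel>1\<parallel>^2 = d in Frobenius norm. This bound is what
  makes a largest eigenfamily exist.\<close>

lemma onf_card_le:
  assumes "onf d I v"
  shows "card I \<le> d"
proof -
  define P where "P = osum d I (\<lambda>_. 1) v"
  have P: "P \<in> cmat d d" "adj P = P" "P * P = P"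
    unfolding P_def using assms by (simp_all add: adj_osum osum_mult)
  have "tr P = (\<Sum>i<d. \<Sum>k\<in>I. v k $ i * cnj (v k $ i))"
    by (simp add: tr_def P_def osum_def)
  also have "\<dots> = (\<Sum>k\<in>I. \<Sum>i<d. v k $ i * cnj (v k $ i))"
    by (rule sum.swap)
  also have "\<dots> = (\<Sum>k\<in>I. cinner (v k) (v k))"
    using assms by (intro sum.cong refl) (simp add: cinner_carrier[OF onf_carrier] mult.commute)
  also have "\<dots> = of_nat (card I)"
    using assms by (simp add: onf_def)
  finally have trP: "tr P = of_nat (card I)" .
  have "real (card I) = ip (1\<^sub>m d) (P * 1\<^sub>m d)"
    using P trP by (simp add: ip_eq_tr[of _ d d])
  also have "\<dots> = (fro (P * 1\<^sub>m d))\<^sup>2"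
    using fro_projection(1)[OF P, of "1\<^sub>m d" d] by simp
  also have "\<dots> \<le> (fro (1\<^sub>m d :: complex mat))\<^sup>2"
    using fro_projection(2)[OF P, of "1\<^sub>m d" d] by (intro power_mono) auto
  also have "\<dots> = real d"
    by (simp flip: ip_self add: ip_eq_tr[of _ d d]) (simp add: tr_def)
  finally show ?thesis by simp
qed

text \<open>In a Schur form \<open>B\<close> the trace of \<open>M * M\<close> is the sum of the
  squared diagonal entries; for Hermitian \<open>M\<close> it is also the squared Frobenius norm,
  which is not zero. Hence some diagonal entry of \<open>B\<close>, an eigenvalue of
  \<open>M\<close>, is not zero.\<close>

lemma hermitian_nonzero_eigenvalue:
  assumes M: "M \<in> cmat d d" "adj M = M" "M \<noteq> 0\<^sub>m d d"
  shows "\<exists>w \<mu>. \<mu> \<noteq> 0 \<and> w \<in> carrier_vec d \<and> w \<noteq> 0\<^sub>v d \<and> M *\<^sub>v w = \<mu> \<cdot>\<^sub>v w"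
proof -
  obtain es where es: "char_poly M = (\<Prod>a\<leftarrow>es. [:- a, 1:])"
    using char_poly_factorized[OF M(1)] by blast
  obtain B where B: "B \<in> cmat d d" "upper_triangular B" "similar_mat M B"
    using schur_decomposition_exists[OF M(1) es] by blast
  then obtain P Q where sim: "similar_mat_wit M B P Q" by (auto simp: similar_mat_def)
  note w = similar_mat_witD2[OF M(1) sim]
  have "P * (B * Q) * (P * (B * Q)) = P * (B * ((Q * P) * (B * Q)))"
    using w(4-7) by (simp add: mult_assoc_dim)
  then have MM: "M * M = P * (B * B * Q)" using w by (simp add: mult_assoc_dim)
  have "tr (M * M) = tr (B * B * Q * P)"
    unfolding MM using w by (intro tr_comm[of _ d d]) auto
  also have "\<dots> = tr (B * B)" using w by (simp add: mult_assoc_dim)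
  also have "\<dots> = (\<Sum>i<d. B $$ (i,i) * B $$ (i,i))"
  proof -
    have "(B * B) $$ (i,i) = B $$ (i,i) * B $$ (i,i)" if i: "i < d" for i
    proof -
      have "(B * B) $$ (i,i) = (\<Sum>l<d. if l = i then B $$ (i,i) * B $$ (i,i) else 0)"
        unfolding mult_index[OF B(1) B(1) i i]
      proof (intro sum.cong refl)
        fix l assume "l \<in> {..<d}"
        then show "B $$ (i,l) * B $$ (l,i) = (if l = i then B $$ (i,i) * B $$ (i,i) else 0)"
          using upper_triangularD[OF B(2), of i l] upper_triangularD[OF B(2), of l i] i B(1)
          by (cases l i rule: linorder_cases) auto
      qed
      then show ?thesis using i by simp
    qed
    then show ?thesis using B(1) by (simp add: tr_def)
  qed
  finally have trM: "tr (M * M) = (\<Sum>i<d. B $$ (i,i) * B $$ (i,i))" .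
  have "fro M \<noteq> 0" using fro_eq_0[of M d d] M by auto
  moreover have "(fro M)\<^sup>2 = Re (tr (M * M))"
    using M by (simp flip: ip_self add: ip_eq_tr[of _ d d])
  ultimately have "tr (M * M) \<noteq> 0" by auto
  then obtain i where i: "i < d" "B $$ (i,i) \<noteq> 0"
    unfolding trM by (metis (no_types, lifting) lessThan_iff mult_zero_left sum.neutral)
  have "char_poly M = (\<Prod>a\<leftarrow>diag_mat B. [:- a, 1:])"
    using char_poly_similar[OF B(3)] char_poly_upper_triangular[OF B(1,2)] by simp
  moreover have "B $$ (i,i) \<in> set (diag_mat B)"
    using i B(1) by (auto simp: diag_mat_def)
  ultimately have "poly (char_poly M) (B $$ (i,i)) = 0"
    by (auto simp: poly_prod_list prod_list_zero_iff image_iff intro!: bexI[of _ "B $$ (i,i)"])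
  then have "eigenvalue M (B $$ (i,i))"
    using eigenvalue_root_char_poly[OF M(1)] by simp
  then show ?thesis
    using i M(1) by (auto simp: eigenvalue_def eigenvector_def)
qed

text \<open>Take a largest orthonormal eigenfamily and subtract its spectral sum. If the remainder
  \<open>M\<close> were not zero, an eigenvector of it with nonzero eigenvalue would enlarge the
  family. Completeness is not part of the claim: zero eigenvalues add nothing to the sum.\<close>

lemma hermitian_spectral:
  assumes A: "A \<in> cmat d d" "adj A = A"
  shows "\<exists>I (a::nat \<Rightarrow> real) v. onf d I v \<and> A = osum d I (\<lambda>k. of_real (a k)) v \<and>
     (\<forall>k\<in>I. A *\<^sub>v v k = of_real (a k) \<cdot>\<^sub>v v k)"
proof -
  define fam where "fam N \<longleftrightarrow> (\<exists>(a::nat \<Rightarrow> real) v. onf d {..<N} v \<and>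
     (\<forall>k<N. A *\<^sub>v v k = of_real (a k) \<cdot>\<^sub>v v k))" for N
  have "fam 0" by (simp add: fam_def onf_def)
  moreover have "N \<le> d" if "fam N" for N
    using that onf_card_le[of d "{..<N}"] by (auto simp: fam_def)
  ultimately have fam: "fam (Greatest fam)" and max: "\<And>N. fam N \<Longrightarrow> N \<le> Greatest fam"
    by (auto intro: GreatestI_nat Greatest_le_nat)
  define N where "N = Greatest fam"
  obtain a :: "nat \<Rightarrow> real" and v where v: "onf d {..<N} v"
    and av: "\<And>k. k < N \<Longrightarrow> A *\<^sub>v v k = of_real (a k) \<cdot>\<^sub>v v k"
    using fam unfolding N_def[symmetric] fam_def by blast
  define S where "S = osum d {..<N} (\<lambda>k. of_real (a k)) v"
  define M where "M = A - S"
  have S: "S \<in> cmat d d" "adj S = S" by (simp_all add: S_def adj_osum)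
  have M: "M \<in> cmat d d" "adj M = M"
    using A S by (simp_all add: M_def minus_carrier_mat adj_minus[of _ d d])
  have vc: "v k \<in> carrier_vec d" if "k < N" for k using v that by (auto simp: onf_def)
  have Mv: "M *\<^sub>v v k = 0\<^sub>v d" if "k < N" for k
  proof -
    have "M *\<^sub>v v k = A *\<^sub>v v k - S *\<^sub>v v k"
      using A S vc[OF that] by (simp add: M_def minus_mult_distrib_mat_vec[of _ d d])
    also have "S *\<^sub>v v k = of_real (a k) \<cdot>\<^sub>v v k"
      using osum_mult_vec[OF v] that by (simp add: S_def)
    finally show ?thesis using av[OF that] vc[OF that] by auto
  qed
  have "M = 0\<^sub>m d d"
  proof (rule ccontr)
    assume "M \<noteq> 0\<^sub>m d d"
    then obtain w \<mu> where w: "\<mu> \<noteq> 0" "w \<in> carrier_vec d" "w \<noteq> 0\<^sub>v d" "M *\<^sub>v w = \<mu> \<cdot>\<^sub>v w"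
      using hermitian_nonzero_eigenvalue[OF M] by blast
    \<comment> \<open>Orthogonality is automatic: \<open>M\<close> annihilates \<open>v k\<close>
      but multiplies \<open>w\<close> by a nonzero scalar.\<close>
    have perp: "cinner (v k) w = 0" if k: "k < N" for k
    proof -
      have "\<mu> * cinner (v k) w = cinner (v k) (M *\<^sub>v w)"
        using w vc[OF k] by (simp add: cinner_smult)
      also have "\<dots> = cinner (M *\<^sub>v v k) w"
        using cinner_mult_vec[OF M(1) vc[OF k] w(2)] M(2) by simp
      also have "\<dots> = 0" using Mv[OF k] by (simp add: cinner_def)
      finally show ?thesis using w(1) by simp
    qed
    have Sw: "S *\<^sub>v w = 0\<^sub>v d"
    proof (rule eq_vecI)
      fix i assume "i < dim_vec (0\<^sub>v d)"
      then have i: "i < d" by simp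
      then show "(S *\<^sub>v w) $ i = 0\<^sub>v d $ i"
        unfolding S_def osum_vec_index[OF v w(2) i] using perp by simp
    qed (use S w in auto)
    have "M *\<^sub>v w = A *\<^sub>v w - S *\<^sub>v w"
      using A S w(2) by (simp add: M_def minus_mult_distrib_mat_vec[of _ d d])
    moreover have "A *\<^sub>v w - 0\<^sub>v d = A *\<^sub>v w"
      using A w(2) by (intro eq_vecI) auto
    ultimately have Aw: "A *\<^sub>v w = \<mu> \<cdot>\<^sub>v w" using w Sw by simp
    define r where "r = (\<Sum>i<dim_vec w. (cmod (w $ i))\<^sup>2)"
    have r: "0 < r" "cinner w w = of_real r"
      using cinner_self_pos[OF w(2,3)] cinner_self[of w] by (simp_all add: r_def)
    have "\<mu> * cinner w w = cinner w (A *\<^sub>v w)" using Aw by (simp add: cinner_smult)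
    also have "\<dots> = cinner (A *\<^sub>v w) w" using cinner_mult_vec[OF A(1) w(2) w(2)] A(2) by simp
    also have "\<dots> = cnj \<mu> * cinner w w" using Aw by (simp add: cinner_smult)
    finally have "\<mu> = cnj \<mu>" using r by simp
    then have mu: "\<mu> = of_real (Re \<mu>)" by (simp add: complex_eq_iff)
    define u where "u = of_real (1 / sqrt r) \<cdot>\<^sub>v w"
    have u: "u \<in> carrier_vec d" using w(2) by (simp add: u_def)
    have uu: "cinner u u = 1"
      using r by (simp add: u_def cinner_smult flip: of_real_mult of_real_divide power2_eq_square)
    have vu: "cinner (v k) u = 0" "cinner u (v k) = 0" if "k < N" for k
    proof -
      show *: "cinner (v k) u = 0" using perp[OF that] vc[OF that] w(2) by (simp add: u_def cinner_smult)
      show "cinner u (v k) = 0"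
        using cinner_cnj[of "v k" u] vc[OF that] u * by simp
    qed
    have Au: "A *\<^sub>v u = of_real (Re \<mu>) \<cdot>\<^sub>v u"
    proof -
      have "A *\<^sub>v u = of_real (1 / sqrt r) \<cdot>\<^sub>v (A *\<^sub>v w)"
        unfolding u_def by (rule mult_mat_vec[OF A(1) w(2)])
      then show ?thesis using Aw mu by (simp add: u_def smult_smult_assoc mult.commute)
    qed
    have "fam (Suc N)"
      unfolding fam_def
    proof (intro exI conjI)
      show "onf d {..<Suc N} (v(N := u))"
        using v u uu vu by (auto simp: onf_def less_Suc_eq)
      show "\<forall>k<Suc N. A *\<^sub>v (v(N := u)) k = of_real ((a(N := Re \<mu>)) k) \<cdot>\<^sub>v (v(N := u)) k"
        using av Au by (auto simp: less_Suc_eq)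
    qed
    then show False using max[of "Suc N"] by (simp add: N_def)
  qed
  then have "A = S"
    using A S unfolding M_def by (intro eq_matI) (auto simp: mat_eq_iff)
  then show ?thesis using v av by (intro exI[of _ "{..<N}"] exI[of _ a] exI[of _ v]) (auto simp: S_def)
qed

lemma mult_carrier_sq [simp]:
  "A \<in> cmat d d \<Longrightarrow> B \<in> cmat d m \<Longrightarrow> A * B \<in> cmat d m"
  "A \<in> cmat m d \<Longrightarrow> B \<in> cmat d d \<Longrightarrow> A * B \<in> cmat m d"
  by auto

lemma osum_cong: "(\<And>k. k \<in> I \<Longrightarrow> a k = b k) \<Longrightarrow> osum d I a v = osum d I b v"
  by (simp add: osum_def cong: sum.cong)

lemma Re_cinner_self_nonneg [simp]: "0 \<le> Re (cinner x x)"
  by (simp add: cinner_self sum_nonneg)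

section \<open>Positive matrices, their square roots and the trace distance\<close>

lemma psdI:
  assumes "A \<in> cmat d d" "adj A = A"
    and "\<And>x. x \<in> carrier_vec d \<Longrightarrow> 0 \<le> Re (cinner x (A *\<^sub>v x))"
  shows "psd A"
  using assms by (auto simp: psd_def hermitian_def)

lemma psd_adj: "psd A \<Longrightarrow> adj A = A"
  by (simp add: psd_def hermitian_def)

lemma psd_gram:
  assumes X: "X \<in> cmat n m"
  shows "psd (adj X * X)"
proof (rule psdI[of _ m])
  show "adj (adj X * X) = adj X * X"
    using adj_mult[OF adj_carrier[OF X] X] by simp
  fix x :: "complex vec" assume x: "x \<in> carrier_vec m"
  have "cinner x (adj X * X *\<^sub>v x) = cinner x (adj X *\<^sub>v (X *\<^sub>v x))"
    using X x by (simp add: assoc_mult_mat_vec[OF adj_carrier[OF X] X x])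
  also have "\<dots> = cinner (X *\<^sub>v x) (X *\<^sub>v x)"
    using cinner_mult_vec[OF adj_carrier[OF X] x, of "X *\<^sub>v x"] X x by simp
  finally show "0 \<le> Re (cinner x (adj X * X *\<^sub>v x))" by simp
qed (use X in auto)

lemma osum_nonneg_root:
  assumes v: "onf d I v" and a: "\<And>k. k \<in> I \<Longrightarrow> 0 \<le> a k"
  defines "R \<equiv> osum d I (\<lambda>k. of_real (sqrt (a k))) v"
  shows "R \<in> cmat d d" "psd R" "R * R = osum d I (\<lambda>k. of_real (a k)) v"
proof -
  \<comment> \<open>Fourth roots of \<open>a\<close>: they exhibit \<open>R\<close> as a Gram
    matrix, hence as positive.\<close>
  define Q where "Q = osum d I (\<lambda>k. of_real (sqrt (sqrt (a k)))) v"
  have Q: "Q \<in> cmat d d" "adj Q = Q" by (simp_all add: Q_def adj_osum)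
  have "adj Q * Q = R"
    unfolding Q(2) unfolding Q_def R_def osum_mult[OF v]
    using a by (intro osum_cong) (simp flip: of_real_mult)
  then show "psd R" using psd_gram[OF Q(1)] by simp
  show "R * R = osum d I (\<lambda>k. of_real (a k)) v"
    unfolding R_def osum_mult[OF v] using a by (intro osum_cong) (simp flip: of_real_mult)
qed (simp add: R_def)

text \<open>The hypothesis speaks of eigenvalues only, so it serves positive matrices as well as a
  Hamiltonian whose positivity is still to be derived from its spectrum.\<close>

lemma hermitian_root:
  assumes A: "A \<in> cmat d d" "adj A = A"
    and ev: "\<And>x \<mu>. x \<in> carrier_vec d \<Longrightarrow> cinner x x = 1 \<Longrightarrow> A *\<^sub>v x = of_real \<mu> \<cdot>\<^sub>v x \<Longrightarrow> 0 \<le> \<mu>"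
  obtains R where "R \<in> cmat d d" "psd R" "R * R = A"
proof -
  obtain I and a :: "nat \<Rightarrow> real" and v where v: "onf d I v"
    and eq: "A = osum d I (\<lambda>k. of_real (a k)) v"
    and av: "\<And>k. k \<in> I \<Longrightarrow> A *\<^sub>v v k = of_real (a k) \<cdot>\<^sub>v v k"
    using hermitian_spectral[OF A] by blast
  have nn: "0 \<le> a k" if k: "k \<in> I" for k
    using ev[OF onf_carrier[OF v k] _ av[OF k]] v k by (simp add: onf_def)
  show thesis
    by (rule that[of "osum d I (\<lambda>k. of_real (sqrt (a k))) v"])
      (simp_all add: osum_nonneg_root[OF v nn] eq)
qed

lemma psd_root:
  assumes A: "A \<in> cmat d d" "psd A"
  obtains R where "R \<in> cmat d d" "psd R" "R * R = A"
proof (rule hermitian_root[OF A(1) psd_adj[OF A(2)]])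
  fix x and \<mu> :: real
  assume x: "x \<in> carrier_vec d" "cinner x x = 1" and "A *\<^sub>v x = of_real \<mu> \<cdot>\<^sub>v x"
  then have "Re (cinner x (A *\<^sub>v x)) = \<mu>" by (simp add: cinner_smult)
  moreover have "0 \<le> Re (cinner x (A *\<^sub>v x))" using A x by (auto simp: psd_def)
  ultimately show "0 \<le> \<mu>" by simp
qed (rule that)

lemma nonneg_eigenvalues_psd:
  assumes A: "A \<in> cmat d d" "adj A = A" and ev: "\<And>v \<mu>. is_eigvec A v \<mu> \<Longrightarrow> 0 \<le> Re \<mu>"
  shows "psd A"
proof (rule hermitian_root[OF A])
  fix x and \<mu> :: real
  assume x: "x \<in> carrier_vec d" "cinner x x = 1" and "A *\<^sub>v x = of_real \<mu> \<cdot>\<^sub>v x"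
  moreover have "x \<noteq> 0\<^sub>v d" using x(2) by (auto simp: cinner_def)
  ultimately have "is_eigvec A x (of_real \<mu>)" using A(1) by (simp add: is_eigvec_def)
  then show "0 \<le> \<mu>" using ev by fastforce
next
  fix R assume "R \<in> cmat d d" "psd R" "R * R = A"
  then show "psd A" using psd_gram[of R d d] psd_adj[of R] by simp
qed

lemma psd_ip:
  assumes A: "A \<in> cmat d d" "psd A" and X: "X \<in> cmat d m"
  shows "0 \<le> ip X (A * X)"
proof -
  obtain R where R: "R \<in> cmat d d" "psd R" "R * R = A" using psd_root[OF A] .
  have "ip X (A * X) = ip X (R * (R * X))"
    using R X by (simp flip: R(3) add: mult_assoc_dim)
  also have "\<dots> = ip (R * X) (R * X)"
    using R X psd_adj[OF R(2)] by (subst ip_mult_left_move[of R d d _ m]) auto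
  finally show ?thesis by simp
qed

text \<open>With A = R R the form is \<parallel>R X\<parallel>^2, so its zeros are killed by
  \<open>R\<close> and hence by \<open>A\<close>.\<close>

lemma psd_ip_zero:
  assumes A: "A \<in> cmat d d" "psd A" and X: "X \<in> cmat d m" and z: "ip X (A * X) = 0"
  shows "A * X = 0\<^sub>m d m"
proof -
  obtain R where R: "R \<in> cmat d d" "psd R" "R * R = A" using psd_root[OF A] .
  have eq: "A * X = R * (R * X)" using R X by (simp flip: R(3) add: mult_assoc_dim)
  have "ip (R * X) (R * X) = 0"
    using z R X psd_adj[OF R(2)] unfolding eq by (subst (asm) ip_mult_left_move[of R d d _ m]) auto
  then have "R * X = 0\<^sub>m d m" using fro_eq_0[of "R * X" d m] R X by (simp add: ip_self)
  then show ?thesis using eq R by simp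
qed

lemma ip_adj:
  assumes "X \<in> cmat n m" "Y \<in> cmat n m"
  shows "ip (adj X) (adj Y) = ip X Y"
proof -
  have "ip (adj X) (adj Y) = Re (tr (adj Y * X))" using assms by (simp add: ip_eq_tr[of _ m n])
  also have "\<dots> = Re (tr (X * adj Y))" using assms by (simp add: tr_comm[of "adj Y" m n X])
  also have "\<dots> = ip Y X" using assms by (simp add: ip_eq_tr[of _ n m])
  finally show ?thesis using ip_commute[OF assms] by simp
qed

text \<open>With \<open>D = B - C\<close> one has \<open>B D + D C = 0\<close>; pairing with \<open>D\<close> gives
  \<open>\<langle>D, B D\<rangle> + \<langle>D, C D\<rangle> = 0\<close>, so both terms vanish, hence \<open>B D = C D = 0\<close> and \<open>D\<^sup>2 = 0\<close>.\<close>

lemma psd_root_unique: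
  assumes B: "B \<in> cmat d d" "psd B" and C: "C \<in> cmat d d" "psd C"
    and eq: "B * B = C * C"
  shows "B = C"
proof -
  define D where "D = B - C"
  have D: "D \<in> cmat d d" "adj D = D"
    using B C by (simp_all add: D_def minus_carrier_mat adj_minus[of _ d d] psd_adj)
  have BD: "B * D = B * B - B * C" "D * C = B * C - C * C"
    using B C by (simp_all add: D_def mult_minus_distrib_mat[of _ d d] minus_mult_distrib_mat[of _ d d])
  have "B * D + D * C = 0\<^sub>m d d"
    unfolding BD eq using B C by (intro eq_matI) auto
  then have "ip D (B * D) + ip D (D * C) = ip D (0\<^sub>m d d)"
    using B C D by (simp flip: ip_add_right[of D d d])
  also have "ip D (0\<^sub>m d d) = 0" using D by (simp add: ip_def)
  also have "ip D (D * C) = ip D (C * D)"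
    using ip_adj[of D d d "D * C"] C D adj_mult[of D d d C d] by (simp add: psd_adj)
  finally have "ip D (B * D) = 0" "ip D (C * D) = 0"
    using psd_ip[OF B D(1)] psd_ip[OF C D(1)] by linarith+
  then have z: "B * D = 0\<^sub>m d d" "C * D = 0\<^sub>m d d"
    using psd_ip_zero[OF B D(1)] psd_ip_zero[OF C D(1)] by auto
  have "D * D = B * D - C * D"
    using B C D minus_mult_distrib_mat[of B d d C D d] by (simp add: D_def)
  also have "\<dots> = 0\<^sub>m d d" unfolding z by simp
  finally have "ip D D = 0"
    using D by (simp add: ip_eq_tr[of D d d D]) (simp add: tr_def)
  then have "D = 0\<^sub>m d d" using fro_eq_0[of D d d] D by (simp add: ip_self)
  then show ?thesis using B C unfolding D_def by (intro eq_matI) (auto simp: mat_eq_iff)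
qed

text \<open>\<open>mat_abs\<close> is a definite description, so existence and uniqueness of the
  positive root must be known before the trace distance means anything.\<close>

lemma mat_abs_props:
  assumes A: "A \<in> cmat n m"
  shows "mat_abs A \<in> cmat m m" "psd (mat_abs A)" "mat_abs A * mat_abs A = adj A * A"
proof -
  let ?Q = "\<lambda>B. B \<in> cmat (dim_col A) (dim_col A) \<and> psd B \<and> B * B = adj A * A"
  have AA: "adj A * A \<in> cmat m m" using A by auto
  obtain R where R: "R \<in> cmat m m" "psd R" "R * R = adj A * A"
    using psd_root[OF AA psd_gram[OF A]] .
  have "?Q (mat_abs A)"
    unfolding mat_abs_def
  proof (rule theI)
    show "?Q R" using R A by auto
    show "B = R" if "?Q B" for B
      using psd_root_unique[of B m R] that R A by auto
  qed
  then show "mat_abs A \<in> cmat m m" "psd (mat_abs A)" "mat_abs A * mat_abs A = adj A * A"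
    using A by auto
qed

text \<open>Hilbert-Schmidt norm at most trace norm: if \<open>R * R\<close> is the modulus of the
  difference, the norm of the modulus is at most \<parallel>R\<parallel>^2, which is its trace. The
  2 undoes the half in \<open>trace_dist\<close>.\<close>

lemma fro_le_trace_dist:
  assumes "\<rho> \<in> cmat n n" "\<sigma> \<in> cmat n n"
  shows "fro (\<rho> - \<sigma>) \<le> 2 * trace_dist \<rho> \<sigma>"
proof -
  define A where "A = \<rho> - \<sigma>"
  have A: "A \<in> cmat n n" using assms by (simp add: A_def minus_carrier_mat)
  define B where "B = mat_abs A"
  have B: "B \<in> cmat n n" "psd B" "B * B = adj A * A"
    using mat_abs_props[OF A] by (auto simp: B_def)
  obtain R where R: "R \<in> cmat n n" "psd R" "R * R = B" using psd_root[OF B(1,2)] .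
  have "(fro A)\<^sup>2 = Re (tr (adj A * A))"
    using A tr_comm[of "adj A" n n A] by (simp flip: ip_self add: ip_eq_tr[of _ n n])
  also have "\<dots> = (fro B)\<^sup>2"
    unfolding B(3)[symmetric] using B by (simp flip: ip_self add: ip_eq_tr[of _ n n] psd_adj)
  finally have "fro A = fro B" by simp
  also have "\<dots> \<le> fro R * fro R" using fro_mult_le[OF R(1) R(1)] R(3) by simp
  also have "\<dots> = ip R R" by (simp add: ip_self power2_eq_square)
  also have "\<dots> = Re (tr B)" using R by (simp add: ip_eq_tr[of _ n n] psd_adj)
  finally show ?thesis by (simp add: trace_dist_def A_def B_def)
qed

subsection \<open>Exponentials of two-sided multiplication operators\<close>

text \<open>One series covers two exponentials: \<open>M = adj K\<close> gives the no-renewal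
  generator on states, \<open>M = 0\<close> the linear flow on amplitudes.\<close>

definition sylv :: "complex mat \<Rightarrow> complex mat \<Rightarrow> complex mat \<Rightarrow> complex mat" where
  "sylv K M X = K * X + X * M"

text \<open>Entrywise, since matrices of all sizes share one type; \<open>d\<close> records the
  size.\<close>

definition mderiv :: "nat \<Rightarrow> (real \<Rightarrow> complex mat) \<Rightarrow> complex mat \<Rightarrow> real \<Rightarrow> bool" where
  "mderiv d F F' t \<longleftrightarrow> (\<forall>i<d. \<forall>j<d. ((\<lambda>s. F s $$ (i,j)) has_vector_derivative F' $$ (i,j)) (at t))"

lemma sylv_carrier [simp]:
  "K \<in> cmat d d \<Longrightarrow> M \<in> cmat d d \<Longrightarrow> X \<in> cmat d d \<Longrightarrow> sylv K M X \<in> cmat d d"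
  by (simp add: sylv_def)

lemma sylv_pow_carrier [simp]:
  "K \<in> cmat d d \<Longrightarrow> M \<in> cmat d d \<Longrightarrow> X \<in> cmat d d \<Longrightarrow> (sylv K M ^^ n) X \<in> cmat d d"
  by (induction n) auto

lemma sylv_pow_fro:
  assumes "K \<in> cmat d d" "M \<in> cmat d d" "X \<in> cmat d d"
  shows "fro ((sylv K M ^^ n) X) \<le> (fro K + fro M) ^ n * fro X"
proof (induction n)
  case (Suc n)
  let ?Y = "(sylv K M ^^ n) X"
  have Y: "?Y \<in> cmat d d" using assms by simp
  have "fro (sylv K M ?Y) \<le> fro (K * ?Y) + fro (?Y * M)"
    using assms Y by (subst sylv_def) (intro fro_triangle[of _ d d], auto)
  also have "\<dots> \<le> fro K * fro ?Y + fro ?Y * fro M"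
    using assms Y by (intro add_mono fro_mult_le[of _ d _ d]) auto
  also have "\<dots> = (fro K + fro M) * fro ?Y" by (simp add: algebra_simps)
  also have "\<dots> \<le> (fro K + fro M) * ((fro K + fro M) ^ n * fro X)"
    using Suc by (intro mult_left_mono) auto
  finally show ?case by simp
qed simp

lemma cmod_entry_le_fro:
  assumes "X \<in> cmat n m" "i < n" "j < m"
  shows "cmod (X $$ (i,j)) \<le> fro X"
  using member_le_L2_set[of "{..<n} \<times> {..<m}" "(i,j)" "\<lambda>p. cmod (X $$ p)"] assms
  by (simp add: fro_L2 case_prod_unfold)

text \<open>The argument \<open>z\<close> is complex although time is real: an everywhere convergent
  complex power series can be differentiated term by term and then restricted to the real
  axis.\<close>

lemma sylv_exp_summable:
  assumes "K \<in> cmat d d" "M \<in> cmat d d" "X \<in> cmat d d" "i < d" "j < d"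
  shows "summable (\<lambda>n. ((sylv K M ^^ n) X $$ (i,j) / fact n) * z ^ n)"
proof (rule summable_comparison_test')
  let ?c = "fro K + fro M"
  show "summable (\<lambda>n. fro X * ((?c * cmod z) ^ n / fact n))"
    using summable_exp[of "?c * cmod z"] by (intro summable_mult) (simp add: divide_inverse mult.commute)
  fix n :: nat
  have "cmod ((sylv K M ^^ n) X $$ (i,j)) \<le> ?c ^ n * fro X"
    using cmod_entry_le_fro[of "(sylv K M ^^ n) X" d d i j] sylv_pow_fro[of K d M X n] assms by simp
  then have "cmod ((sylv K M ^^ n) X $$ (i,j)) / fact n * cmod z ^ n \<le> ?c ^ n * fro X / fact n * cmod z ^ n"
    by (intro mult_right_mono divide_right_mono) auto
  then show "norm (((sylv K M ^^ n) X $$ (i,j) / fact n) * z ^ n) \<le> fro X * ((?c * cmod z) ^ n / fact n)"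
    by (simp add: norm_mult norm_divide norm_power power_mult_distrib mult_ac)
qed

lemma super_exp_carrier [simp]: "X \<in> cmat n m \<Longrightarrow> super_exp L t X \<in> cmat n m"
  by (simp add: super_exp_def)

lemma sylv_exp_sums:
  assumes "K \<in> cmat d d" "M \<in> cmat d d" "X \<in> cmat d d" "i < d" "j < d"
  shows "(\<lambda>n. ((sylv K M ^^ n) X $$ (i,j) / fact n) * of_real t ^ n) sums
     (super_exp (sylv K M) t X $$ (i,j))"
proof -
  have "super_exp (sylv K M) t X $$ (i,j) =
      (\<Sum>n. ((sylv K M ^^ n) X $$ (i,j) / fact n) * of_real t ^ n)"
    using assms by (simp add: super_exp_def mult_ac)
  then show ?thesis using summable_sums[OF sylv_exp_summable[OF assms, of "of_real t"]] by simp
qed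

lemma sylv_exp_mderiv:
  assumes K: "K \<in> cmat d d" and M: "M \<in> cmat d d" and X: "X \<in> cmat d d"
  shows "mderiv d (\<lambda>t. super_exp (sylv K M) t X) (sylv K M (super_exp (sylv K M) t X)) t"
  unfolding mderiv_def
proof (intro allI impI)
  fix i j assume ij: "i < d" "j < d"
  define E where "E = super_exp (sylv K M) t X"
  have E: "E \<in> cmat d d" using X by (simp add: E_def)
  let ?a = "\<lambda>n. (sylv K M ^^ n) X"
  let ?c = "\<lambda>n. ?a n $$ (i,j) / fact n"
  have "((\<lambda>z. \<Sum>n. ?c n * z ^ n) has_field_derivative (\<Sum>n. diffs ?c n * of_real t ^ n)) (at (of_real t))"
    by (rule termdiffs_strong_converges_everywhere) (rule sylv_exp_summable[OF K M X ij])
  then have "((\<lambda>s. \<Sum>n. ?c n * of_real s ^ n) has_vector_derivative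
       (\<Sum>n. diffs ?c n * of_real t ^ n)) (at t)"
    by (rule has_vector_derivative_real_field)
  moreover have "(\<lambda>s. \<Sum>n. ?c n * of_real s ^ n) = (\<lambda>s. super_exp (sylv K M) s X $$ (i,j))"
    using sylv_exp_sums[OF K M X ij] by (simp add: sums_iff)
  \<comment> \<open>With L the generator, the differentiated series has the coefficients (L^(n+1) X)
    / n!. It is the series of \<open>E\<close> with one generator pulled out in front.\<close>
  moreover have "(\<Sum>n. diffs ?c n * of_real t ^ n) = sylv K M E $$ (i,j)"
  proof -
    let ?T = "\<lambda>n. (\<Sum>l<d. K $$ (i,l) * (?a n $$ (l,j) / fact n * of_real t ^ n)) +
        (\<Sum>l<d. (?a n $$ (i,l) / fact n * of_real t ^ n) * M $$ (l,j))"
    have "?T sums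
        ((\<Sum>l<d. K $$ (i,l) * E $$ (l,j)) + (\<Sum>l<d. E $$ (i,l) * M $$ (l,j)))"
      unfolding E_def
      by (intro sums_add sums_sum sums_mult sums_mult2 sylv_exp_sums[OF K M X]) (use ij in auto)
    also have "(\<Sum>l<d. K $$ (i,l) * E $$ (l,j)) + (\<Sum>l<d. E $$ (i,l) * M $$ (l,j)) = sylv K M E $$ (i,j)"
      using ij K M E by (simp add: sylv_def mult_index[OF K E] mult_index[OF E M])
    also have "?T = (\<lambda>n. diffs ?c n * of_real t ^ n)"
    proof
      fix n
      have a: "?a n \<in> cmat d d" using K M X by simp
      have "diffs ?c n * of_real t ^ n = ?a (Suc n) $$ (i,j) / fact n * of_real t ^ n"
        by (simp add: diffs_def fact_Suc field_simps del: of_nat_Suc funpow.simps)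
      also have "?a (Suc n) $$ (i,j) = (\<Sum>l<d. K $$ (i,l) * ?a n $$ (l,j)) + (\<Sum>l<d. ?a n $$ (i,l) * M $$ (l,j))"
        using ij K M a by (simp add: sylv_def mult_index[OF K a] mult_index[OF a M])
      finally have "diffs ?c n * of_real t ^ n = (\<Sum>l<d. K $$ (i,l) * ?a n $$ (l,j)) / fact n * of_real t ^ n
          + (\<Sum>l<d. ?a n $$ (i,l) * M $$ (l,j)) / fact n * of_real t ^ n"
        by (simp only: add_divide_distrib distrib_right)
      then show "?T n = diffs ?c n * of_real t ^ n"
        by (simp only: sum_divide_distrib sum_distrib_right) (simp add: mult_ac)
    qed
    finally show ?thesis by (simp add: sums_iff)
  qed
  ultimately show "((\<lambda>s. super_exp (sylv K M) s X $$ (i,j)) has_vector_derivative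
      sylv K M (super_exp (sylv K M) t X) $$ (i,j)) (at t)"
    by (simp add: E_def)
qed

lemma sylv_exp_0:
  assumes "K \<in> cmat d d" "M \<in> cmat d d" "X \<in> cmat d d"
  shows "super_exp (sylv K M) 0 X = X"
proof (rule eq_matI)
  fix i j assume "i < dim_row X" "j < dim_col X"
  then have ij: "i < d" "j < d" using assms by auto
  have "(\<lambda>n. ((sylv K M ^^ n) X $$ (i,j) / fact n) * of_real 0 ^ n) sums
      (\<Sum>n\<in>{0}. ((sylv K M ^^ n) X $$ (i,j) / fact n) * of_real 0 ^ n)"
    by (rule sums_finite) auto
  then have "(\<lambda>n. ((sylv K M ^^ n) X $$ (i,j) / fact n) * of_real 0 ^ n) sums (X $$ (i,j))"
    by simp
  then show "super_exp (sylv K M) 0 X $$ (i,j) = X $$ (i,j)"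
    using sylv_exp_sums[OF assms ij, of 0] sums_unique2 by blast
qed (auto simp: super_exp_def)

section \<open>Calculus of matrix-valued functions and uniqueness of the evolution\<close>

lemma mderiv_minus:
  assumes "\<And>t. F t \<in> cmat d d" "\<And>t. G t \<in> cmat d d" "F' \<in> cmat d d" "G' \<in> cmat d d"
    "mderiv d F F' t" "mderiv d G G' t"
  shows "mderiv d (\<lambda>t. F t - G t) (F' - G') t"
  unfolding mderiv_def
proof (intro allI impI)
  fix i j assume ij: "i < d" "j < d"
  have "((\<lambda>s. F s $$ (i,j) - G s $$ (i,j)) has_vector_derivative F' $$ (i,j) - G' $$ (i,j)) (at t)"
    using assms(5,6) ij by (intro has_vector_derivative_diff) (auto simp: mderiv_def)
  moreover have "(\<lambda>s. F s $$ (i,j) - G s $$ (i,j)) = (\<lambda>s. (F s - G s) $$ (i,j))"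
    using assms(1,2) ij by (metis carrier_matD(1,2) index_minus_mat(1))
  ultimately show "((\<lambda>s. (F s - G s) $$ (i,j)) has_vector_derivative (F' - G') $$ (i,j)) (at t)"
    using assms(3,4) ij by simp
qed

lemma mderiv_mult:
  assumes F: "\<And>t. F t \<in> cmat d d" and G: "\<And>t. G t \<in> cmat d d"
    and F': "F' \<in> cmat d d" and G': "G' \<in> cmat d d"
    and "mderiv d F F' t" "mderiv d G G' t"
  shows "mderiv d (\<lambda>t. F t * G t) (F' * G t + F t * G') t"
  unfolding mderiv_def
proof (intro allI impI)
  fix i j assume ij: "i < d" "j < d"
  have "((\<lambda>s. \<Sum>l<d. F s $$ (i,l) * G s $$ (l,j)) has_vector_derivative
      (\<Sum>l<d. F t $$ (i,l) * G' $$ (l,j) + F' $$ (i,l) * G t $$ (l,j))) (at t)"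
    using assms(5,6) ij by (intro has_vector_derivative_sum has_vector_derivative_mult) (auto simp: mderiv_def)
  then show "((\<lambda>s. (F s * G s) $$ (i,j)) has_vector_derivative (F' * G t + F t * G') $$ (i,j)) (at t)"
    using ij F[of t] G[of t] F' G'
    by (simp add: mult_index[OF F G] mult_index[OF F' G] mult_index[OF F G'] sum.distrib add.commute)
qed

lemma mderiv_adj:
  assumes F: "\<And>t. F t \<in> cmat d d" and F': "F' \<in> cmat d d" and D: "mderiv d F F' t"
  shows "mderiv d (\<lambda>t. adj (F t)) (adj F') t"
  unfolding mderiv_def
proof (intro allI impI)
  fix i j assume ij: "i < d" "j < d"
  have "((\<lambda>s. cnj (F s $$ (j,i))) has_vector_derivative cnj (F' $$ (j,i))) (at t)"
    using D ij bounded_linear.has_vector_derivative[OF bounded_linear_cnj] by (auto simp: mderiv_def)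
  moreover have "(\<lambda>s. cnj (F s $$ (j,i))) = (\<lambda>s. adj (F s) $$ (i,j))"
    using F ij by (metis adj_index carrier_matD(1,2))
  ultimately show "((\<lambda>s. adj (F s) $$ (i,j)) has_vector_derivative adj F' $$ (i,j)) (at t)"
    using ij F' by simp
qed

lemma mderiv_const: "mderiv d (\<lambda>_. X) (0\<^sub>m d d) t"
  by (auto simp: mderiv_def)

lemma mderiv_const_mult:
  assumes "M \<in> cmat d d" "\<And>t. C t \<in> cmat d d" "C' \<in> cmat d d" "mderiv d C C' t"
  shows "mderiv d (\<lambda>t. M * C t) (M * C') t"
proof -
  have "mderiv d (\<lambda>t. M * C t) (0\<^sub>m d d * C t + M * C') t"
    using assms by (intro mderiv_mult mderiv_const) auto
  then show ?thesis using assms(1,3) assms(2)[of t] by simp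
qed

lemma mderiv_ip:
  assumes F: "\<And>t. F t \<in> cmat d d" and G: "\<And>t. G t \<in> cmat d d"
    and F': "F' \<in> cmat d d" and G': "G' \<in> cmat d d"
    and "mderiv d F F' t" "mderiv d G G' t"
  shows "((\<lambda>t. ip (F t) (G t)) has_real_derivative (ip F' (G t) + ip (F t) G')) (at t)"
proof -
  have "((\<lambda>s. \<Sum>i<d. \<Sum>j<d. inner (F s $$ (i,j)) (G s $$ (i,j))) has_vector_derivative
     (\<Sum>i<d. \<Sum>j<d. inner (F t $$ (i,j)) (G' $$ (i,j)) + inner (F' $$ (i,j)) (G t $$ (i,j)))) (at t)"
    using assms(5,6)
    by (intro has_vector_derivative_sum bounded_bilinear.has_vector_derivative[OF bounded_bilinear_inner])
      (auto simp: mderiv_def)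
  moreover have "(\<lambda>s. \<Sum>i<d. \<Sum>j<d. inner (F s $$ (i,j)) (G s $$ (i,j))) = (\<lambda>t. ip (F t) (G t))"
    using F by (simp add: ip_def carrier_matD[OF F])
  moreover have "(\<Sum>i<d. \<Sum>j<d. inner (F t $$ (i,j)) (G' $$ (i,j)) + inner (F' $$ (i,j)) (G t $$ (i,j)))
      = ip F' (G t) + ip (F t) G'"
    using F[of t] F' by (simp add: ip_def sum.distrib add.commute)
  ultimately show ?thesis by (simp add: has_real_derivative_iff_has_vector_derivative)
qed

text \<open>Uniqueness for the two-sided equation: the squared norm of the difference of two solutions
  is nonincreasing.\<close>

lemma sylv_exp_factor:
  assumes K: "K \<in> cmat d d" and B: "B \<in> cmat d d"
    and diss: "\<And>Z. Z \<in> cmat d d \<Longrightarrow> ip Z (K * Z) \<le> 0" and t: "0 \<le> t"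
    and C: "\<And>t. C t \<in> cmat d d" "C 0 = B" "\<And>t. mderiv d C (K * C t) t"
  shows "super_exp (sylv K (adj K)) t (B * adj B) = C t * adj (C t)"
proof -
  define S where "S t = super_exp (sylv K (adj K)) t (B * adj B)" for t
  define Y where "Y t = S t - C t * adj (C t)" for t
  have S: "S t \<in> cmat d d" "mderiv d S (sylv K (adj K) (S t)) t" for t
    using sylv_exp_mderiv[of K d "adj K" "B * adj B"] K B
    by (auto simp: S_def[abs_def])
  have Y: "Y t \<in> cmat d d" for t using S C by (simp add: Y_def minus_carrier_mat)
  have CC: "mderiv d (\<lambda>t. C t * adj (C t)) (K * C t * adj (C t) + C t * adj (K * C t)) t" for t
    using C K by (intro mderiv_mult mderiv_adj) auto
  have Y': "mderiv d Y (sylv K (adj K) (Y t)) t" for t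
  proof -
    have "mderiv d Y (sylv K (adj K) (S t) - (K * C t * adj (C t) + C t * adj (K * C t))) t"
      unfolding Y_def using S CC C K by (intro mderiv_minus) auto
    moreover have "sylv K (adj K) (S t) - (K * C t * adj (C t) + C t * adj (K * C t)) = sylv K (adj K) (Y t)"
    proof -
      have Ct: "C t * adj (C t) \<in> cmat d d" "C t \<in> cmat d d" using C(1)[of t] by auto
      have "sylv K (adj K) (Y t) =
        (K * S t - K * (C t * adj (C t))) + (S t * adj K - C t * adj (C t) * adj K)"
        unfolding sylv_def Y_def
        using K S Ct by (simp add: mult_minus_distrib_mat[of _ d d _ d] minus_mult_distrib_mat[of _ d d _ _ d])
      moreover have "K * C t * adj (C t) = K * (C t * adj (C t))"
        "C t * adj (K * C t) = C t * adj (C t) * adj K"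
        using K Ct by (simp_all add: mult_assoc_dim adj_mult[of K d d _ d])
      ultimately show ?thesis
        unfolding sylv_def using K S[of t] Ct by (intro eq_matI) auto
    qed
    ultimately show ?thesis by simp
  qed
  have "ip (Y t) (Y t) \<le> ip (Y 0) (Y 0)"
  proof (rule DERIV_nonpos_imp_nonincreasing[OF t])
    fix s assume "0 \<le> s" "s \<le> t"
    let ?Z = "sylv K (adj K) (Y s)"
    have "ip (Y s) ?Z = ip (Y s) (K * Y s) + ip (Y s) (Y s * adj K)"
      unfolding sylv_def using K Y by (intro ip_add_right[of _ d d]) auto
    \<comment> \<open>Taking adjoints turns right multiplication by \<open>adj K\<close> into left
      multiplication by \<open>K\<close>, so dissipativity of \<open>K\<close> controls both
      sides.\<close>
    also have "ip (Y s) (Y s * adj K) = ip (adj (Y s)) (K * adj (Y s))"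
      using ip_adj[of "Y s" d d "Y s * adj K"] K Y[of s] adj_mult[of "Y s" d d "adj K" d] by simp
    finally have "ip (Y s) ?Z \<le> 0"
      using diss[OF Y[of s]] diss[OF adj_carrier[OF Y[of s]]] by linarith
    moreover have "ip ?Z (Y s) = ip (Y s) ?Z" using K Y by (intro ip_commute[of _ d d]) auto
    moreover have "((\<lambda>s. ip (Y s) (Y s)) has_real_derivative ip ?Z (Y s) + ip (Y s) ?Z) (at s)"
      using Y Y' K by (intro mderiv_ip[of _ d]) auto
    ultimately show "\<exists>y. ((\<lambda>s. ip (Y s) (Y s)) has_real_derivative y) (at s) \<and> y \<le> 0"
      by (intro exI[of _ "ip ?Z (Y s) + ip (Y s) ?Z"]) linarith
  qed
  also have "Y 0 = 0\<^sub>m d d"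
    using K B C(2) sylv_exp_0[of K d "adj K" "B * adj B"] by (simp add: Y_def S_def)
  also have "ip (0\<^sub>m d d) (0\<^sub>m d d) = 0" by (simp add: ip_def)
  finally have "fro (Y t) = 0" by (simp add: ip_self)
  then have "Y t = 0\<^sub>m d d" using fro_eq_0 Y by blast
  then show ?thesis
    using S[of t] C(1)[of t] unfolding Y_def S_def by (intro eq_matI) (auto simp: mat_eq_iff)
qed

text \<open>The matrix exponential e^(t K) applied to \<open>B\<close>.\<close>

definition flow :: "complex mat \<Rightarrow> complex mat \<Rightarrow> real \<Rightarrow> complex mat" where
  "flow K B t = super_exp (sylv K (0\<^sub>m (dim_row K) (dim_row K))) t B"

lemma flow:
  assumes "K \<in> cmat d d" "B \<in> cmat d d"
  shows "flow K B t \<in> cmat d d" "flow K B 0 = B" "mderiv d (flow K B) (K * flow K B t) t"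
proof -
  show c: "flow K B t \<in> cmat d d" for t using assms by (simp add: flow_def)
  show "flow K B 0 = B" using assms sylv_exp_0[of K d "0\<^sub>m d d" B] by (simp add: flow_def)
  have "sylv K (0\<^sub>m d d) (flow K B t) = K * flow K B t"
    using assms c[of t] by (simp add: sylv_def right_mult_zero_mat[of _ d d])
  then show "mderiv d (flow K B) (K * flow K B t) t"
    using sylv_exp_mderiv[of K d "0\<^sub>m d d" B t] assms unfolding flow_def by simp
qed

subsection \<open>Norm and speed estimates\<close>

lemma smult_mult_right:
  fixes A B :: "complex mat"
  shows "dim_col A = dim_row B \<Longrightarrow> A * (c \<cdot>\<^sub>m B) = c \<cdot>\<^sub>m (A * B)"
  by (rule mult_smult_distrib[of _ "dim_row A" "dim_col A" _ "dim_col B"]) auto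

lemma smult_mult_left:
  fixes A B :: "complex mat"
  shows "dim_col A = dim_row B \<Longrightarrow> (c \<cdot>\<^sub>m A) * B = c \<cdot>\<^sub>m (A * B)"
  by (rule mult_smult_assoc_mat[of _ "dim_row A" "dim_col A" _ "dim_col B"]) auto

lemma ip_smult_both:
  assumes "X \<in> cmat n m" "Y \<in> cmat n m"
  shows "ip (c \<cdot>\<^sub>m X) (c \<cdot>\<^sub>m Y) = (cmod c)\<^sup>2 * ip X Y"
proof -
  have "ip (c \<cdot>\<^sub>m X) (c \<cdot>\<^sub>m Y) = ip (cnj c \<cdot>\<^sub>m (c \<cdot>\<^sub>m X)) Y"
    using assms by (intro ip_smult_move[of _ n m]) auto
  also have "cnj c \<cdot>\<^sub>m (c \<cdot>\<^sub>m X) = of_real ((cmod c)\<^sup>2) \<cdot>\<^sub>m X"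
    by (rule eq_matI) (auto simp: complex_norm_square mult_ac simp del: of_real_power)
  also have "ip \<dots> Y = (cmod c)\<^sup>2 * ip X Y"
    using assms ip_smult_right[of Y n m X "(cmod c)\<^sup>2"] ip_commute[of _ n m Y] by (simp del: of_real_power)
  finally show ?thesis .
qed

lemma ip_selfadjoint:
  assumes "H \<in> cmat d d" "adj H = H" "X \<in> cmat d m" "Y \<in> cmat d m"
  shows "ip X (H * Y) = ip (H * X) Y"
  using ip_mult_left_move[of H d d Y m X] assms by simp

text \<open>A Hermitian form takes real values, so its multiple by -i has no real part: the
  Hamiltonian term never changes a norm.\<close>

lemma ip_skew:
  assumes H: "H \<in> cmat d d" "adj H = H" and X: "X \<in> cmat d m"
  shows "ip X ((- \<i>) \<cdot>\<^sub>m (H * X)) = 0"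
proof -
  have "ip X ((- \<i>) \<cdot>\<^sub>m (H * X)) = ip (\<i> \<cdot>\<^sub>m X) (H * X)"
    using H X ip_smult_move[of X d m "H * X" "- \<i>"] by simp
  also have "\<dots> = ip (H * (\<i> \<cdot>\<^sub>m X)) X"
    using H X by (intro ip_selfadjoint) auto
  also have "H * (\<i> \<cdot>\<^sub>m X) = \<i> \<cdot>\<^sub>m (H * X)" using H X by (simp add: smult_mult_right)
  also have "ip (\<i> \<cdot>\<^sub>m (H * X)) X = ip X (\<i> \<cdot>\<^sub>m (H * X))"
    using H X by (intro ip_commute[of _ d m]) auto
  also have "\<i> \<cdot>\<^sub>m (H * X) = of_real (-1) \<cdot>\<^sub>m ((- \<i>) \<cdot>\<^sub>m (H * X))"
    by (rule eq_matI) auto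
  also have "ip X \<dots> = - ip X ((- \<i>) \<cdot>\<^sub>m (H * X))"
    using H X ip_smult_right[of X d m "(- \<i>) \<cdot>\<^sub>m (H * X)" "-1"] by simp
  finally show ?thesis by simp
qed

lemma mderiv_ip_self:
  assumes "\<And>t. F t \<in> cmat d d" "F' \<in> cmat d d" "mderiv d F F' t"
  shows "((\<lambda>t. ip (F t) (F t)) has_real_derivative 2 * ip (F t) F') (at t)"
  using mderiv_ip[of F d F F' F' t] ip_commute[of F' d d "F t"] assms by simp

text \<open>Differentiating \<open>sqrt (\<parallel>D\<parallel>\<^sup>2 + \<delta>\<^sup>2)\<close> instead of \<open>\<parallel>D\<parallel>\<close> avoids the zeros of \<open>D\<close>.\<close>

lemma duhamel:
  assumes H: "H \<in> cmat d d" "adj H = H"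
    and D: "\<And>t. D t \<in> cmat d d" and R: "\<And>t. R t \<in> cmat d d"
    and deriv: "\<And>t. mderiv d D ((- \<i>) \<cdot>\<^sub>m (H * D t) + R t) t"
    and cont: "continuous_on {s..T} r" and le: "\<And>t. s \<le> t \<Longrightarrow> t \<le> T \<Longrightarrow> fro (R t) \<le> r t" and sT: "s < T"
  shows "fro (D T) \<le> fro (D s) + integral {s..T} r"
proof (rule field_le_epsilon)
  fix \<delta> :: real assume \<delta>: "0 < \<delta>"
  define \<phi> where "\<phi> t = sqrt (ip (D t) (D t) + \<delta>\<^sup>2)" for t
  have pos: "0 < ip (D t) (D t) + \<delta>\<^sup>2" for t using \<delta> by (intro add_nonneg_pos) auto
  have phi_ge: "fro (D t) \<le> \<phi> t" for t
    unfolding \<phi>_def by (rule real_le_rsqrt) (simp add: ip_self)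
  have phi_pos: "0 < \<phi> t" for t using pos by (simp add: \<phi>_def)
  have HD: "(- \<i>) \<cdot>\<^sub>m (H * D t) \<in> cmat d d" for t using H D by simp
  have phi': "(\<phi> has_real_derivative ip (D t) (R t) / \<phi> t) (at t)" for t
  proof -
    have "((\<lambda>t. ip (D t) (D t)) has_real_derivative 2 * ip (D t) ((- \<i>) \<cdot>\<^sub>m (H * D t) + R t)) (at t)"
      using D R HD deriv by (intro mderiv_ip_self[of _ d]) auto
    also have "ip (D t) ((- \<i>) \<cdot>\<^sub>m (H * D t) + R t) = ip (D t) (R t)"
      using D R HD H ip_add_right[of "D t" d d "(- \<i>) \<cdot>\<^sub>m (H * D t)" "R t"] ip_skew[of H d "D t" d] by simp
    finally have ipd: "((\<lambda>t. ip (D t) (D t)) has_real_derivative 2 * ip (D t) (R t)) (at t)" .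
    have "((\<lambda>t. sqrt (ip (D t) (D t) + \<delta>\<^sup>2)) has_real_derivative
        inverse (sqrt (ip (D t) (D t) + \<delta>\<^sup>2)) / 2 * (2 * ip (D t) (R t) + 0)) (at t)"
      by (rule DERIV_chain2[OF DERIV_real_sqrt[OF pos] DERIV_add[OF ipd DERIV_const]])
    then have "((\<lambda>t. sqrt (ip (D t) (D t) + \<delta>\<^sup>2)) has_real_derivative ip (D t) (R t) / \<phi> t) (at t)"
      by (rule DERIV_cong) (simp add: \<phi>_def inverse_eq_divide)
    moreover have "\<phi> = (\<lambda>t. sqrt (ip (D t) (D t) + \<delta>\<^sup>2))" by (simp add: fun_eq_iff \<phi>_def)
    ultimately show ?thesis by metis
  qed
  \<comment> \<open>Monotonicity is needed in its open-interval version: the integral of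
    \<open>r\<close> is differentiable from both sides only in the interior.\<close>
  define F where "F t = \<phi> t - integral {s..t} r" for t
  have "F T \<le> F s"
  proof (rule DERIV_nonpos_imp_decreasing_open[OF order_less_imp_le[OF sT]])
    fix t assume t: "s < t" "t < T"
    have "((\<lambda>u. integral {s..u} r) has_real_derivative r t) (at t within {s..T})"
      using integral_has_real_derivative[OF cont, of t] t by simp
    then have "((\<lambda>u. integral {s..u} r) has_real_derivative r t) (at t)"
      using t by (simp add: at_within_Icc_at)
    then have "(F has_real_derivative ip (D t) (R t) / \<phi> t - r t) (at t)"
      unfolding F_def[abs_def] by (intro DERIV_diff phi')
    moreover have "ip (D t) (R t) / \<phi> t \<le> r t"
    proof -
      have "ip (D t) (R t) \<le> fro (D t) * fro (R t)" using ip_Cauchy_Schwarz[OF D R, of t t] by simp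
      also have "\<dots> \<le> \<phi> t * r t"
        using le[of t] t phi_ge[of t] by (intro mult_mono) (auto intro: order_trans[OF fro_nonneg])
      finally show ?thesis using phi_pos[of t] by (simp add: pos_divide_le_eq mult.commute)
    qed
    ultimately show "\<exists>y. (F has_real_derivative y) (at t) \<and> y \<le> 0"
      by (intro exI[of _ "ip (D t) (R t) / \<phi> t - r t"]) simp
  next
    have "continuous_on {s..T} \<phi>"
      using phi' by (meson DERIV_isCont continuous_at_imp_continuous_on)
    moreover have "continuous_on {s..T} (\<lambda>t. integral {s..t} r)"
      by (rule indefinite_integral_continuous_1[OF integrable_continuous_real[OF cont]])
    ultimately show "continuous_on {s..T} F" unfolding F_def[abs_def] by (intro continuous_on_diff)
  qed
  then have "\<phi> T \<le> \<phi> s + integral {s..T} r" by (simp add: F_def)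
  moreover have "\<phi> s \<le> fro (D s) + \<delta>"
    unfolding \<phi>_def using sqrt_add_le_add_sqrt[of "ip (D s) (D s)" "\<delta>\<^sup>2"] \<delta> by (simp add: ip_self)
  ultimately show "fro (D T) \<le> fro (D s) + integral {s..T} r + \<delta>"
    using phi_ge[of T] by linarith
qed

lemma unitary_flow_conserved:
  assumes H: "H \<in> cmat d d" "adj H = H"
    and U: "\<And>t. U t \<in> cmat d d" and deriv: "\<And>t. mderiv d U ((- \<i>) \<cdot>\<^sub>m (H * U t)) t"
  shows "ip (U t) (H * U t) = ip (U s) (H * U s)"
proof -
  have HU: "H * U t \<in> cmat d d" for t using H U by simp
  \<comment> \<open>\<open>ip_skew\<close> for the identity matrix: -i Z is orthogonal to Z for
    every Z.\<close>
  have zero: "ip ((- \<i>) \<cdot>\<^sub>m (H * U t)) (H * U t) = 0" for t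
  proof -
    have "ip ((- \<i>) \<cdot>\<^sub>m (H * U t)) (H * U t) = ip (H * U t) ((- \<i>) \<cdot>\<^sub>m (H * U t))"
      using HU by (intro ip_commute[of _ d d]) auto
    then show ?thesis
      using ip_skew[of "1\<^sub>m d" d "H * U t" d] HU[of t] left_mult_one_mat[OF HU[of t]] by simp
  qed
  have const: "mderiv d (\<lambda>t. H * U t) (H * ((- \<i>) \<cdot>\<^sub>m (H * U t))) t" for t
    using H U HU deriv by (intro mderiv_const_mult) auto
  have "((\<lambda>t. ip (U t) (H * U t)) has_real_derivative 0) (at t)" for t
  proof -
    have "((\<lambda>t. ip (U t) (H * U t)) has_real_derivative
       ip ((- \<i>) \<cdot>\<^sub>m (H * U t)) (H * U t) + ip (U t) (H * ((- \<i>) \<cdot>\<^sub>m (H * U t)))) (at t)"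
      using H U HU deriv const by (intro mderiv_ip[of _ d]) auto
    moreover have "ip (U t) (H * ((- \<i>) \<cdot>\<^sub>m (H * U t))) = ip (H * U t) ((- \<i>) \<cdot>\<^sub>m (H * U t))"
      using H U HU by (intro ip_selfadjoint) auto
    moreover have "\<dots> = ip ((- \<i>) \<cdot>\<^sub>m (H * U t)) (H * U t)"
      using HU by (intro ip_commute[of _ d d]) auto
    ultimately show ?thesis using zero by simp
  qed
  then show ?thesis by (intro DERIV_isconst_all) auto
qed

text \<open>A Margolus--Levitin type speed limit: the derivative of the squared distance is
  \<open>2 Re \<langle>U s, H (i U t)\<rangle>\<close>, and polarization of the form \<open>\<langle>X, H X\<rangle>\<close> bounds it by twice the
  conserved energy.\<close>

lemma unitary_flow_speed:
  assumes H: "H \<in> cmat d d" "psd H"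
    and U: "\<And>t. U t \<in> cmat d d" and deriv: "\<And>t. mderiv d U ((- \<i>) \<cdot>\<^sub>m (H * U t)) t"
    and st: "s \<le> t"
  shows "(fro (U t - U s))\<^sup>2 \<le> 2 * ip (U s) (H * U s) * (t - s)"
proof -
  have adjH: "adj H = H" using H(2) by (rule psd_adj)
  define E where "E = ip (U s) (H * U s)"
  define g where "g u = ip (U u - U s) (U u - U s) - 2 * E * (u - s)" for u
  have "g t \<le> g s"
  proof (rule DERIV_nonpos_imp_nonincreasing[OF st])
    fix u
    let ?V = "(- \<i>) \<cdot>\<^sub>m (H * U u)"
    have V: "?V \<in> cmat d d" using H U by simp
    have D: "U u - U s \<in> cmat d d" for u using U by (simp add: minus_carrier_mat)
    have "mderiv d (\<lambda>u. U u - U s) (?V - 0\<^sub>m d d) u"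
      using U V deriv by (intro mderiv_minus mderiv_const) auto
    moreover have "?V - 0\<^sub>m d d = ?V" using V H(1) U[of u] by (intro eq_matI) auto
    ultimately have "((\<lambda>u. ip (U u - U s) (U u - U s)) has_real_derivative 2 * ip (U u - U s) ?V) (at u)"
      using D V by (intro mderiv_ip_self[of _ d]) auto
    then have g': "(g has_real_derivative 2 * ip (U u - U s) ?V - 2 * E * 1) (at u)"
      unfolding g_def[abs_def] by (auto intro!: derivative_eq_intros)
    \<comment> \<open>The factor i moves from the velocity into the argument. \<open>Y\<close> keeps
      the energy of \<open>U u\<close>, so both diagonal terms of the polarization below equal
      \<open>E\<close>.\<close>
    define Y where "Y = \<i> \<cdot>\<^sub>m U u"
    have Y: "Y \<in> cmat d d" using U by (simp add: Y_def)
    have "ip (U u - U s) ?V = - ip (U s) ?V"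
      using U V ip_minus_left[of ?V d d "U u" "U s"] ip_skew[OF H(1) adjH U, of u] by simp
    also have "\<dots> = ip (U s) (H * Y)"
    proof -
      have "H * Y = of_real (-1) \<cdot>\<^sub>m ?V"
        using H U[of u] by (auto simp: Y_def smult_mult_right intro!: eq_matI)
      then show ?thesis using ip_smult_right[OF U V, of s "-1"] by simp
    qed
    finally have eq: "ip (U u - U s) ?V = ip (U s) (H * Y)" .
    have "0 \<le> ip (U s - Y) (H * (U s - Y))"
      using H U Y by (intro psd_ip[of _ d]) (auto simp: minus_carrier_mat)
    also have "H * (U s - Y) = H * U s - H * Y"
      using H U Y by (simp add: mult_minus_distrib_mat[of _ d d _ d])
    also have "ip (U s - Y) (H * U s - H * Y) = ip (U s) (H * U s) - ip (U s) (H * Y)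
        - (ip Y (H * U s) - ip Y (H * Y))"
      using H U Y by (simp add: ip_minus_left[of _ d d] ip_minus_right[of _ d d] minus_carrier_mat)
    also have "ip Y (H * U s) = ip (U s) (H * Y)"
      using ip_selfadjoint[OF H(1) adjH Y U, of s] ip_commute[of "H * Y" d d "U s"] H U Y by simp
    also have "ip Y (H * Y) = ip (U u) (H * U u)"
      using H U[of u] by (simp add: Y_def smult_mult_right ip_smult_both[of _ d d])
    also have "\<dots> = E" unfolding E_def using unitary_flow_conserved[OF H(1) adjH U deriv] .
    finally have "ip (U s) (H * Y) \<le> E" by (simp add: E_def)
    then show "\<exists>y. (g has_real_derivative y) (at u) \<and> y \<le> 0"
      using g' eq by (intro exI[of _ "2 * ip (U u - U s) ?V - 2 * E * 1"]) simp
  qed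
  moreover have "U s - U s = 0\<^sub>m d d" using U by (intro eq_matI) (auto simp: carrier_matD[OF U])
  ultimately show ?thesis by (simp add: g_def ip_self E_def fro_def)
qed

subsection \<open>Renewal maps\<close>

lemma msum_carrier [simp]: "msum n m f \<in> cmat n n"
  by (simp add: msum_def)

lemma msum_index [simp]: "i < n \<Longrightarrow> j < n \<Longrightarrow> msum n m f $$ (i,j) = (\<Sum>k<m. f k $$ (i,j))"
  by (simp add: msum_def)

lemma msum_cong: "m = m' \<Longrightarrow> (\<And>j. j < m' \<Longrightarrow> f j = g j) \<Longrightarrow> msum n m f = msum n m' g"
  by (simp add: msum_def)

lemma tr_mult_msum:
  assumes Y: "Y \<in> cmat n n" and f: "\<And>j. j < m \<Longrightarrow> f j \<in> cmat n n"
  shows "tr (Y * msum n m f) = (\<Sum>j<m. tr (Y * f j))"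
proof -
  let ?g = "\<lambda>i l j. Y $$ (i,l) * f j $$ (l,i)"
  have "tr (Y * msum n m f) = (\<Sum>i<n. \<Sum>l<n. \<Sum>j<m. ?g i l j)"
    using Y by (simp add: tr_def mult_index[OF Y msum_carrier] sum_distrib_left)
  also have "\<dots> = (\<Sum>i<n. \<Sum>j<m. \<Sum>l<n. ?g i l j)"
    by (intro sum.cong refl sum.swap)
  also have "\<dots> = (\<Sum>j<m. \<Sum>i<n. \<Sum>l<n. ?g i l j)"
    by (rule sum.swap)
  also have "\<dots> = (\<Sum>j<m. tr (Y * f j))"
    using Y by (intro sum.cong refl) (simp add: tr_def mult_index[OF Y f])
  finally show ?thesis .
qed

lemma kron_one_msum:
  assumes f: "\<And>j. j < m \<Longrightarrow> f j \<in> cmat q q"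
  shows "kron (1\<^sub>m n) (msum q m (\<lambda>j. c j \<cdot>\<^sub>m f j)) = msum (n*q) m (\<lambda>j. c j \<cdot>\<^sub>m kron (1\<^sub>m n) (f j))"
    (is "?A = ?B")
proof (rule mat_eq_prodI[of _ n q n q])
  fix i a k b assume ij: "i < n" "a < q" "k < n" "b < q"
  note lt = prod_index_less[OF ij(1,2)] prod_index_less[OF ij(3,4)]
  have "?A $$ (i*q+a, k*q+b) = (\<Sum>j<m. 1\<^sub>m n $$ (i,k) * (c j \<cdot>\<^sub>m f j) $$ (a,b))"
    unfolding kron_index[OF one_carrier_mat msum_carrier ij] using ij by (simp add: sum_distrib_left)
  also have "\<dots> = (\<Sum>j<m. (c j \<cdot>\<^sub>m kron (1\<^sub>m n) (f j)) $$ (i*q+a, k*q+b))"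
  proof (rule sum.cong[OF refl])
    fix j assume "j \<in> {..<m}"
    then have fj: "f j \<in> cmat q q" using f by simp
    show "1\<^sub>m n $$ (i,k) * (c j \<cdot>\<^sub>m f j) $$ (a,b) = (c j \<cdot>\<^sub>m kron (1\<^sub>m n) (f j)) $$ (i*q+a, k*q+b)"
      using ij lt fj kron_index[OF one_carrier_mat fj ij] by simp
  qed
  also have "\<dots> = ?B $$ (i*q+a, k*q+b)" using lt by simp
  finally show "?A $$ (i*q+a, k*q+b) = ?B $$ (i*q+a, k*q+b)" .
qed simp_all

text \<open>The operator on C standing between the S-basis states \<open>i\<close> and
  \<open>j\<close>; the renewal map acts on each such block separately.\<close>

definition blk :: "nat \<Rightarrow> complex mat \<Rightarrow> nat \<Rightarrow> nat \<Rightarrow> complex mat" where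
  "blk m X i j = mat m m (\<lambda>(k,l). X $$ (i*m+k, j*m+l))"

lemma blk_carrier [simp]: "blk m X i j \<in> cmat m m"
  by (simp add: blk_def)

lemma kron_right_mult_index:
  assumes A: "A \<in> cmat m m" and X: "X \<in> cmat (n*m) q" and "i < n" "k < m" "j < q"
  shows "(kron (1\<^sub>m n) A * X) $$ (i*m+k, j) = (\<Sum>b<m. A $$ (k,b) * X $$ (i*m+b, j))"
proof -
  have K: "kron (1\<^sub>m n) A \<in> cmat (n*m) (n*m)" using A by auto
  have "(kron (1\<^sub>m n) A * X) $$ (i*m+k, j) =
      (\<Sum>a<n. \<Sum>b<m. kron (1\<^sub>m n) A $$ (i*m+k, a*m+b) * X $$ (a*m+b, j))"
    using assms by (subst mult_index[OF K X]) (auto simp: prod_index_less sum_prod_index)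
  also have "\<dots> = (\<Sum>a<n. if a = i then \<Sum>b<m. A $$ (k,b) * X $$ (a*m+b, j) else 0)"
    using assms by (intro sum.cong refl) (auto simp: kron_index[OF _ A, of "1\<^sub>m n" n n])
  also have "\<dots> = (\<Sum>b<m. A $$ (k,b) * X $$ (i*m+b, j))"
    using assms by (simp add: sum.delta)
  finally show ?thesis .
qed

lemma kron_conj_index:
  assumes A: "A \<in> cmat m m" and X: "X \<in> cmat (n*m) (n*m)"
    and ij: "i < n" "a < m" "j < n" "b < m"
  shows "(kron (1\<^sub>m n) A * X * adj (kron (1\<^sub>m n) A)) $$ (i*m+a, j*m+b) = (A * blk m X i j * adj A) $$ (a,b)"
proof -
  let ?K = "kron (1\<^sub>m n) A"
  have K: "?K \<in> cmat (n*m) (n*m)" using A by auto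
  have KX: "?K * X \<in> cmat (n*m) (n*m)" using K X by simp
  have "?K * X * adj ?K = adj (?K * adj (?K * X))"
    using adj_mult[OF K adj_carrier[OF KX]] by simp
  then have "(?K * X * adj ?K) $$ (i*m+a, j*m+b) = cnj ((?K * adj (?K * X)) $$ (j*m+b, i*m+a))"
    using ij A X K KX by (simp add: prod_index_less)
  also have "\<dots> = cnj (\<Sum>l<m. A $$ (b,l) * cnj (\<Sum>k<m. A $$ (a,k) * X $$ (i*m+k, j*m+l)))"
    using ij A X K KX
    by (simp add: kron_right_mult_index[OF A adj_carrier[OF KX]] prod_index_less
        kron_right_mult_index[OF A X])
  also have "\<dots> = (\<Sum>l<m. (A * blk m X i j) $$ (a,l) * adj A $$ (l,b))"
    using ij A by (simp add: mult_index[OF A blk_carrier] mult.commute) (simp add: blk_def)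
  also have "\<dots> = (A * blk m X i j * adj A) $$ (a,b)"
    using A ij by (subst mult_index[of _ m m _ m]) auto
  finally show ?thesis .
qed

text \<open>Polarization: basis vectors give the diagonal, and e_k + c e_l with c = 1 and c = i
  separates \<open>w k l\<close> from \<open>w l k\<close>.\<close>

lemma sesquilinear_zero:
  fixes w :: "nat \<Rightarrow> nat \<Rightarrow> complex"
  assumes z: "\<And>v. v \<in> carrier_vec n \<Longrightarrow> (\<Sum>k<n. \<Sum>l<n. w k l * (v $ k * cnj (v $ l))) = 0"
    and kl: "k < n" "l < n"
  shows "w k l = 0"
proof -
  have two: "(\<Sum>a<n. \<Sum>b<n. w a b * (u a * cnj (u b))) =
      w k k * (u k * cnj (u k)) + w k l * (u k * cnj (u l)) + w l k * (u l * cnj (u k)) + w l l * (u l * cnj (u l))"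
    if "\<And>a. a \<noteq> k \<Longrightarrow> a \<noteq> l \<Longrightarrow> u a = 0" "k \<noteq> l" for u :: "nat \<Rightarrow> complex"
  proof -
    have inner: "(\<Sum>b<n. w a b * (u a * cnj (u b))) = w a k * (u a * cnj (u k)) + w a l * (u a * cnj (u l))" for a
    proof -
      have "(\<Sum>b<n. w a b * (u a * cnj (u b))) = (\<Sum>b\<in>{k,l}. w a b * (u a * cnj (u b)))"
        using that kl by (intro sum.mono_neutral_right) auto
      then show ?thesis using that by simp
    qed
    have "(\<Sum>a<n. \<Sum>b<n. w a b * (u a * cnj (u b))) = (\<Sum>a\<in>{k,l}. \<Sum>b<n. w a b * (u a * cnj (u b)))"
      using that kl by (intro sum.mono_neutral_right) auto
    then show ?thesis using that by (simp add: inner)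
  qed
  have diag: "w i i = 0" if i: "i < n" for i
  proof -
    let ?e = "vec n (\<lambda>a. if a = i then 1 else 0) :: complex vec"
    have "(\<Sum>a<n. \<Sum>b<n. w a b * (?e $ a * cnj (?e $ b))) = 0"
      by (rule z) simp
    also have "(\<Sum>a<n. \<Sum>b<n. w a b * (?e $ a * cnj (?e $ b)))
       = (\<Sum>a<n. \<Sum>b<n. if b = i then (if a = i then w a b else 0) else 0)"
      by (intro sum.cong refl) auto
    finally show ?thesis using i by (simp add: sum.delta)
  qed
  show ?thesis
  proof (cases "k = l")
    case False
    have val: "w k l * cnj c + w l k * c = 0" for c
    proof -
      let ?u = "\<lambda>a. if a = k then 1 else if a = l then c else 0"
      have "(\<Sum>a<n. \<Sum>b<n. w a b * (vec n ?u $ a * cnj (vec n ?u $ b))) = 0" by (rule z) simp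
      also have "(\<Sum>a<n. \<Sum>b<n. w a b * (vec n ?u $ a * cnj (vec n ?u $ b))) = (\<Sum>a<n. \<Sum>b<n. w a b * (?u a * cnj (?u b)))"
        by (intro sum.cong refl) simp
      finally show ?thesis using two[of ?u] False diag[OF kl(1)] diag[OF kl(2)] by simp
    qed
    from val[of 1] val[of \<i>] have "w k l + w l k = 0" "- (w k l * \<i>) + w l k * \<i> = 0" by simp_all
    then have "w k l + w l k = 0" "\<i> * (w l k - w k l) = 0" by (simp_all add: algebra_simps)
    then show ?thesis by simp
  qed (use diag kl in simp)
qed

lemma tr_mult_adj_self:
  assumes Y: "Y \<in> cmat n m"
  shows "tr (Y * adj Y) = of_real ((fro Y)\<^sup>2)"
proof -
  have "tr (Y * adj Y) = (\<Sum>i<n. \<Sum>l<m. Y $$ (i,l) * cnj (Y $$ (i,l)))"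
    using Y by (simp add: tr_def mult_index[OF Y adj_carrier[OF Y]])
  also have "\<dots> = of_real ((fro Y)\<^sup>2)"
    using Y by (simp add: fro_def sum_nonneg complex_norm_square del: of_real_power)
  finally show ?thesis .
qed

lemma ket_bra_density:
  assumes v: "v \<in> carrier_vec n" "v \<noteq> 0\<^sub>v n"
  defines "s \<equiv> \<Sum>i<dim_vec v. (cmod (v $ i))\<^sup>2"
  shows "density n (of_real (1 / s) \<cdot>\<^sub>m ket_bra v v)"
proof -
  have s: "0 < s" unfolding s_def using cinner_self_pos[OF v] .
  \<comment> \<open>A single row whose Gram matrix is the normalized projector; positivity follows
    from \<open>psd_gram\<close>.\<close>
  define X where "X = mat 1 n (\<lambda>(_,j). cnj (v $ j) / of_real (sqrt s))"
  have X: "X \<in> cmat 1 n" by (simp add: X_def)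
  have sq: "of_real (sqrt s) * of_real (sqrt s) = of_real s"
    using s by (simp flip: of_real_mult)
  have eq: "adj X * X = of_real (1 / s) \<cdot>\<^sub>m ket_bra v v"
  proof (rule mat_eqI[of _ n n])
    fix i j assume ij: "i < n" "j < n"
    have "(adj X * X) $$ (i,j) = cnj (X $$ (0,i)) * X $$ (0,j)"
      using ij X by (simp add: mult_index[OF adj_carrier[OF X] X])
    also have "\<dots> = v $ i * cnj (v $ j) / of_real s"
      using ij by (simp add: X_def sq)
    finally show "(adj X * X) $$ (i,j) = (of_real (1 / s) \<cdot>\<^sub>m ket_bra v v) $$ (i,j)"
      using ij v by (simp add: ket_bra_def)
  qed (use v X in \<open>auto simp: ket_bra_def\<close>)
  have "tr (of_real (1 / s) \<cdot>\<^sub>m ket_bra v v) = of_real (1 / s) * (\<Sum>i<n. v $ i * cnj (v $ i))"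
    using v by (simp add: tr_def ket_bra_def sum_distrib_left)
  also have "(\<Sum>i<n. v $ i * cnj (v $ i)) = of_real s"
    using v by (simp add: s_def complex_norm_square del: of_real_power)
  finally have "tr (of_real (1 / s) \<cdot>\<^sub>m ket_bra v v) = 1" using s by simp
  then show ?thesis
    using psd_gram[OF X] v unfolding eq by (auto simp: density_def ket_bra_def)
qed

locale renewal =
  fixes H :: "complex mat" and J :: "nat \<Rightarrow> complex mat" and m dS dC :: nat and \<rho>C0 :: "complex mat"
  assumes H [simp]: "H \<in> cmat (dS*dC) (dS*dC)" and H_psd: "psd H"
    and J: "\<And>j. j < m \<Longrightarrow> J j \<in> cmat dC dC"
    and C0: "density dC \<rho>C0"
    and renew: "\<And>\<sigma>. density dC \<sigma> \<Longrightarrow>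
      \<exists>c::real. 0 \<le> c \<and> msum dC m (\<lambda>j. J j * \<sigma> * adj (J j)) = of_real c \<cdot>\<^sub>m \<rho>C0"
begin

abbreviation N :: nat where "N \<equiv> dS * dC"

definition R :: "complex mat \<Rightarrow> complex mat" where
  "R Y = msum dC m (\<lambda>j. J j * Y * adj (J j))"

definition Jx :: "nat \<Rightarrow> complex mat" where "Jx j = kron (1\<^sub>m dS) (J j)"

definition W :: "complex mat" where "W = kron (1\<^sub>m dS) (VC J m dC)"

definition K :: "complex mat" where "K = (- \<i>) \<cdot>\<^sub>m H - W"

lemma C0_carrier [simp]: "\<rho>C0 \<in> cmat dC dC" and tr_C0 [simp]: "tr \<rho>C0 = 1"
  using C0 by (auto simp: density_def)

lemma Jx [simp]: "j < m \<Longrightarrow> Jx j \<in> cmat N N"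
  using J by (simp add: Jx_def)

lemma VC_carrier [simp]: "VC J m dC \<in> cmat dC dC"
  by (simp add: VC_def)

lemma W [simp]: "W \<in> cmat N N"
  by (simp add: W_def)

lemma K [simp]: "K \<in> cmat N N"
  by (simp add: K_def minus_carrier_mat)

lemma adj_H: "adj H = H"
  using H_psd by (rule psd_adj)

lemma adj_VC: "adj (VC J m dC) = VC J m dC"
proof (rule mat_eqI[of _ dC dC])
  fix a b assume ab: "a < dC" "b < dC"
  have "cnj ((adj (J j) * J j) $$ (b,a)) = (adj (J j) * J j) $$ (a,b)" if j: "j < m" for j
  proof -
    have "cnj ((adj (J j) * J j) $$ (b,a)) = adj (adj (J j) * J j) $$ (a,b)"
      using ab J[OF j] by simp
    then show ?thesis using adj_mult[OF adj_carrier[OF J[OF j]] J[OF j]] by simp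
  qed
  then show "adj (VC J m dC) $$ (a,b) = VC J m dC $$ (a,b)"
    using ab by (simp add: VC_def carrier_matD[OF msum_carrier])
qed simp_all

lemma adj_W: "adj W = W"
  by (simp add: W_def adj_kron[of _ dS dS _ dC dC] adj_VC)

lemma R_index:
  assumes Y: "Y \<in> cmat dC dC" and ab: "a < dC" "b < dC"
  shows "R Y $$ (a,b) = (\<Sum>k<dC. \<Sum>l<dC. (\<Sum>j<m. J j $$ (a,k) * cnj (J j $$ (b,l))) * Y $$ (k,l))"
proof -
  let ?f = "\<lambda>j k l. J j $$ (a,k) * Y $$ (k,l) * cnj (J j $$ (b,l))"
  have "R Y $$ (a,b) = (\<Sum>j<m. \<Sum>l<dC. \<Sum>k<dC. ?f j k l)"
    unfolding R_def msum_index[OF ab]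
  proof (rule sum.cong[OF refl])
    fix j assume "j \<in> {..<m}"
    then have Jj: "J j \<in> cmat dC dC" using J by simp
    have JY: "J j * Y \<in> cmat dC dC" using Jj Y by simp
    show "(J j * Y * adj (J j)) $$ (a,b) = (\<Sum>l<dC. \<Sum>k<dC. ?f j k l)"
      using ab Jj by (simp add: mult_index[OF JY adj_carrier[OF Jj]] mult_index[OF Jj Y] sum_distrib_right)
  qed
  also have "\<dots> = (\<Sum>l<dC. \<Sum>j<m. \<Sum>k<dC. ?f j k l)"
    by (rule sum.swap)
  also have "\<dots> = (\<Sum>l<dC. \<Sum>k<dC. \<Sum>j<m. ?f j k l)"
    by (intro sum.cong refl sum.swap)
  also have "\<dots> = (\<Sum>k<dC. \<Sum>l<dC. \<Sum>j<m. ?f j k l)"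
    by (rule sum.swap)
  also have "\<dots> = (\<Sum>k<dC. \<Sum>l<dC. (\<Sum>j<m. J j $$ (a,k) * cnj (J j $$ (b,l))) * Y $$ (k,l))"
    by (simp only: sum_distrib_right) (simp add: mult_ac)
  finally show ?thesis .
qed

lemma R_carrier [simp]: "R Y \<in> cmat dC dC"
  by (simp add: R_def)

text \<open>The density matrices span all matrices, so the hypothesis on the renewal map extends by linearity.\<close>

lemma R_multiple:
  assumes Y: "Y \<in> cmat dC dC"
  shows "R Y = tr (R Y) \<cdot>\<^sub>m \<rho>C0"
proof (rule mat_eqI[of _ dC dC])
  fix a b assume ab: "a < dC" "b < dC"
  define r where "r a b k l = (\<Sum>j<m. J j $$ (a,k) * cnj (J j $$ (b,l)))" for a b k l
  \<comment> \<open>The claim at entry \<open>(a,b)\<close> is the vanishing of a functional with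
    these coefficients. Since \<open>\<rho>C0\<close> has unit trace, the multiple granted by the
    hypothesis is tr (R Z), and written so it is linear in Z.\<close>
  define w where "w k l = r a b k l - (\<Sum>c<dC. r c c k l) * \<rho>C0 $$ (a,b)" for k l
  have lin: "(\<Sum>k<dC. \<Sum>l<dC. w k l * Z $$ (k,l)) = R Z $$ (a,b) - tr (R Z) * \<rho>C0 $$ (a,b)"
    if Z: "Z \<in> cmat dC dC" for Z
  proof -
    have "tr (R Z) = (\<Sum>c<dC. \<Sum>k<dC. \<Sum>l<dC. r c c k l * Z $$ (k,l))"
      by (simp add: tr_def carrier_matD[OF R_carrier] R_index[OF Z] r_def)
    also have "\<dots> = (\<Sum>k<dC. \<Sum>c<dC. \<Sum>l<dC. r c c k l * Z $$ (k,l))" by (rule sum.swap)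
    also have "\<dots> = (\<Sum>k<dC. \<Sum>l<dC. \<Sum>c<dC. r c c k l * Z $$ (k,l))" by (intro sum.cong refl sum.swap)
    finally have "tr (R Z) * \<rho>C0 $$ (a,b) =
        (\<Sum>k<dC. \<Sum>l<dC. (\<Sum>c<dC. r c c k l) * \<rho>C0 $$ (a,b) * Z $$ (k,l))"
      by (simp only: sum_distrib_right) (simp add: mult_ac)
    then show ?thesis
      using ab by (simp add: w_def left_diff_distrib sum_subtractf R_index[OF Z] flip: r_def)
  qed
  have w0: "w k l = 0" if "k < dC" "l < dC" for k l
  proof (rule sesquilinear_zero[of dC w])
    fix v :: "complex vec" assume v: "v \<in> carrier_vec dC"
    show "(\<Sum>k<dC. \<Sum>l<dC. w k l * (v $ k * cnj (v $ l))) = 0"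
    proof (cases "v = 0\<^sub>v dC")
      case False
      define s where "s = (\<Sum>i<dim_vec v. (cmod (v $ i))\<^sup>2)"
      have s: "0 < s" using cinner_self_pos[OF v False] by (simp add: s_def)
      define Z where "Z = of_real (1 / s) \<cdot>\<^sub>m ket_bra v v"
      have Zd: "density dC Z" using ket_bra_density[OF v False] by (simp add: Z_def s_def)
      then have Z: "Z \<in> cmat dC dC" by (simp add: density_def)
      obtain c :: real where c: "R Z = of_real c \<cdot>\<^sub>m \<rho>C0" using renew[OF Zd] by (auto simp: R_def)
      then have trc: "tr (R Z) = of_real c" using tr_smult[OF C0_carrier] by simp
      have "(\<Sum>k<dC. \<Sum>l<dC. w k l * Z $$ (k,l)) = 0"
        unfolding lin[OF Z] trc unfolding c using ab carrier_matD[OF C0_carrier] by simp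
      moreover have "(\<Sum>k<dC. \<Sum>l<dC. w k l * Z $$ (k,l)) =
          of_real (1 / s) * (\<Sum>k<dC. \<Sum>l<dC. w k l * (v $ k * cnj (v $ l)))"
        using v by (simp add: Z_def ket_bra_def sum_distrib_left mult_ac)
      ultimately show ?thesis using s by simp
    qed simp
  qed (use that in auto)
  have "R Y $$ (a,b) - tr (R Y) * \<rho>C0 $$ (a,b) = 0"
    unfolding lin[OF Y, symmetric] by (intro sum.neutral ballI) (simp add: w0)
  then show "R Y $$ (a,b) = (tr (R Y) \<cdot>\<^sub>m \<rho>C0) $$ (a,b)"
    using ab carrier_matD[OF C0_carrier] by simp
qed simp_all

abbreviation D :: "complex mat \<Rightarrow> complex mat" where "D X \<equiv> D_re J m dS dC X"

lemma D_carrier [simp]: "D X \<in> cmat N N"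
  by (simp add: D_re_def)

lemma D_index:
  assumes X: "X \<in> cmat N N" and ij: "i < dS" "a < dC" "j < dS" "b < dC"
  shows "D X $$ (i*dC+a, j*dC+b) = R (blk dC X i j) $$ (a,b)"
  using ij J by (simp add: D_re_def R_def prod_index_less kron_conj_index[OF _ X])

text \<open>Every block of \<open>D X\<close> is a multiple of \<open>\<rho>C0\<close>, so a renewal
  leaves no correlation between S and C, whatever \<open>X\<close> was.\<close>

lemma D_product:
  assumes X: "X \<in> cmat N N"
  shows "D X = kron (ptrace_right dS dC (D X)) \<rho>C0" (is "_ = ?R")
proof (rule mat_eq_prodI[of _ dS dC dS dC])
  fix i a j b assume ij: "i < dS" "a < dC" "j < dS" "b < dC"
  have "ptrace_right dS dC (D X) $$ (i,j) = tr (R (blk dC X i j))"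
    using ij by (simp add: ptrace_right_def D_index[OF X] tr_def carrier_matD[OF R_carrier])
  then have "?R $$ (i*dC+a, j*dC+b) = tr (R (blk dC X i j)) * \<rho>C0 $$ (a,b)"
    using ij by (simp add: kron_index[OF ptrace_carrier C0_carrier])
  also have "\<dots> = (tr (R (blk dC X i j)) \<cdot>\<^sub>m \<rho>C0) $$ (a,b)"
    using ij carrier_matD[OF C0_carrier] by simp
  also have "\<dots> = D X $$ (i*dC+a, j*dC+b)"
    using R_multiple[OF blk_carrier, of X i j] D_index[OF X ij] by simp
  finally show "D X $$ (i*dC+a, j*dC+b) = ?R $$ (i*dC+a, j*dC+b)" by simp
qed auto

lemma Jx_conj:
  assumes C: "C \<in> cmat N N" and j: "j < m"
  shows "Jx j * (C * adj C) * adj (Jx j) = Jx j * C * adj (Jx j * C)"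
  using adj_mult[OF Jx[OF j] C] carrier_matD[OF Jx[OF j]] carrier_matD[OF C] by (simp add: mult_assoc_dim)

lemma tr_mult_D:
  assumes Z: "Z \<in> cmat N N" and X: "X \<in> cmat N N"
  shows "tr (Z * D X) = (\<Sum>j<m. tr (Z * (Jx j * X * adj (Jx j))))"
  unfolding D_re_def Jx_def[symmetric] using Z X by (intro tr_mult_msum) auto

lemma W_eq: "W = msum N m (\<lambda>j. (1/2) \<cdot>\<^sub>m (adj (Jx j) * Jx j))"
proof -
  have "adj (Jx j) * Jx j = kron (1\<^sub>m dS) (adj (J j) * J j)" if "j < m" for j
    using J[OF that] by (simp add: Jx_def adj_kron[of _ dS dS _ dC dC] kron_mult[of _ dS _ dC])
  moreover have "VC J m dC = msum dC m (\<lambda>j. (1/2) \<cdot>\<^sub>m (adj (J j) * J j))"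
    unfolding VC_def using J
    by (intro mat_eqI[of _ dC dC])
      (auto simp: carrier_matD[OF msum_carrier] sum_divide_distrib carrier_matD[OF J] intro!: sum.cong)
  ultimately show ?thesis
    unfolding W_def using kron_one_msum[of m "\<lambda>j. adj (J j) * J j" dC dS "\<lambda>_. 1/2"] J
    by (simp cong: msum_cong)
qed

text \<open>An observable on S commutes with the jumps on C, so in the Heisenberg picture the jumps
  turn it into its product with the sum of \<open>adj (Jx j) * Jx j\<close>, which is twice
  \<open>W\<close>. For the identity this says that the renewal rate is the rate at which trace is
  lost.\<close>

lemma tr_kron_D:
  assumes A: "A \<in> cmat dS dS" and X: "X \<in> cmat N N"
  shows "tr (kron A (1\<^sub>m dC) * D X) = 2 * tr (kron A (1\<^sub>m dC) * (W * X))"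
proof -
  define Z where "Z = kron A (1\<^sub>m dC)"
  have Z: "Z \<in> cmat N N" using A by (simp add: Z_def)
  have "Z * (W * X) = Z * W * X" using Z X carrier_matD[OF W] by (simp add: mult_assoc_dim)
  then have "tr (Z * (W * X)) = tr (X * (Z * W))"
    using tr_comm[of "Z * W" N N X] Z X by simp
  also have "X * (Z * W) = X * Z * W" using Z X carrier_matD[OF W] by (simp add: mult_assoc_dim)
  also have "tr \<dots> = (\<Sum>j<m. tr (X * Z * ((1/2) \<cdot>\<^sub>m (adj (Jx j) * Jx j))))"
    unfolding W_eq using Z X by (intro tr_mult_msum) auto
  also have "\<dots> = (\<Sum>j<m. (1/2) * tr (Z * (Jx j * X * adj (Jx j))))"
  proof (rule sum.cong[OF refl])
    fix j assume "j \<in> {..<m}"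
    then have j: "j < m" by simp
    note [simp] = carrier_matD[OF Jx[OF j]] carrier_matD[OF Z] carrier_matD[OF X]
    have "tr (X * Z * ((1/2) \<cdot>\<^sub>m (adj (Jx j) * Jx j))) = (1/2) * tr (X * Z * (adj (Jx j) * Jx j))"
      using Z X Jx[OF j] by (simp add: smult_mult_right tr_smult[of _ N])
    also have "X * Z * (adj (Jx j) * Jx j) = X * (Z * adj (Jx j) * Jx j)" by (simp add: mult_assoc_dim)
    also have "Z * adj (Jx j) = adj (Jx j) * Z" 
      using kron_comm[OF A adj_carrier[OF J[OF j]]] J[OF j] by (simp add: Z_def Jx_def adj_kron[of _ dS dS _ dC dC])
    also have "tr (X * (adj (Jx j) * Z * Jx j)) = tr (X * adj (Jx j) * (Z * Jx j))" by (simp add: mult_assoc_dim)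
    also have "\<dots> = tr (Z * Jx j * (X * adj (Jx j)))"
      using Z X Jx[OF j] by (intro tr_comm[of _ N N]) auto
    also have "Z * Jx j * (X * adj (Jx j)) = Z * (Jx j * X * adj (Jx j))" by (simp add: mult_assoc_dim)
    finally show "tr (X * Z * ((1/2) \<cdot>\<^sub>m (adj (Jx j) * Jx j))) = (1/2) * tr (Z * (Jx j * X * adj (Jx j)))" .
  qed
  also have "\<dots> = (1/2) * tr (Z * D X)"
    unfolding tr_mult_D[OF Z X] by (simp add: sum_distrib_left)
  finally show ?thesis unfolding Z_def[symmetric] by (simp add: field_simps)
qed

lemma tr_D:
  assumes X: "X \<in> cmat N N"
  shows "tr (D X) = 2 * tr (W * X)"
  using tr_kron_D[OF one_carrier_mat X] X
  by (simp add: left_mult_one_mat[OF D_carrier] left_mult_one_mat[of "W * X" N N])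

lemma tr_mult_D_self:
  assumes Z: "Z \<in> cmat N N" and C: "C \<in> cmat N N"
  shows "Re (tr (Z * D (C * adj C))) = (\<Sum>j<m. ip (Jx j * C) (Z * (Jx j * C)))"
proof -
  have "Re (tr (Z * (Jx j * (C * adj C) * adj (Jx j)))) = ip (Jx j * C) (Z * (Jx j * C))" if j: "j < m" for j
  proof -
    note [simp] = carrier_matD[OF Jx[OF j]] carrier_matD[OF Z] carrier_matD[OF C]
    have "Z * (Jx j * (C * adj C) * adj (Jx j)) = Z * (Jx j * C) * adj (Jx j * C)"
      unfolding Jx_conj[OF C j] by (simp add: mult_assoc_dim)
    then show ?thesis using Z C Jx[OF j] by (simp add: ip_eq_tr[of _ N N])
  qed
  then show ?thesis using Z C by (simp add: tr_mult_D)
qed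

lemma tr_D_self:
  assumes C: "C \<in> cmat N N"
  shows "tr (D (C * adj C)) = of_real (\<Sum>j<m. (fro (Jx j * C))\<^sup>2)"
proof -
  have "tr (D (C * adj C)) = tr (1\<^sub>m N * D (C * adj C))"
    by (simp add: left_mult_one_mat[OF D_carrier])
  also have "\<dots> = (\<Sum>j<m. tr (1\<^sub>m N * (Jx j * (C * adj C) * adj (Jx j))))"
    using C by (intro tr_mult_D) auto
  also have "\<dots> = (\<Sum>j<m. of_real ((fro (Jx j * C))\<^sup>2))"
  proof (rule sum.cong[OF refl])
    fix j assume "j \<in> {..<m}"
    then have j: "j < m" by simp
    have JC: "Jx j * C \<in> cmat N N" using Jx[OF j] C by simp
    then show "tr (1\<^sub>m N * (Jx j * (C * adj C) * adj (Jx j))) = of_real ((fro (Jx j * C))\<^sup>2)"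
      unfolding Jx_conj[OF C j]
      using left_mult_one_mat[of "Jx j * C * adj (Jx j * C)" N N] tr_mult_adj_self[OF JC] by simp
  qed
  finally show ?thesis by simp
qed

lemma ip_W:
  assumes C: "C \<in> cmat N N"
  shows "2 * ip C (W * C) = (\<Sum>j<m. (fro (Jx j * C))\<^sup>2)"
proof -
  have "2 * ip C (W * C) = Re (2 * tr (W * C * adj C))"
    using C by (simp add: ip_eq_tr[of _ N N])
  also have "W * C * adj C = W * (C * adj C)" using carrier_matD[OF W] C by (simp add: mult_assoc_dim)
  also have "2 * tr (W * (C * adj C)) = tr (D (C * adj C))"
    using C by (intro tr_D[symmetric]) auto
  finally show ?thesis using tr_D_self[OF C] by simp
qed

lemma K_mult:
  assumes "C \<in> cmat N n"
  shows "K * C = (- \<i>) \<cdot>\<^sub>m (H * C) - W * C"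
  unfolding K_def using assms carrier_matD[OF H]
  by (simp add: minus_mult_distrib_mat[of _ N N _ _ n] smult_mult_left)

text \<open>The Hamiltonian part is skew and drops out. Hence the squared norm decays exactly at the
  renewal rate, and \<open>K\<close> is dissipative, as the uniqueness argument for the evolution
  requires.\<close>

lemma ip_K:
  assumes C: "C \<in> cmat N N"
  shows "2 * ip C (K * C) = - (\<Sum>j<m. (fro (Jx j * C))\<^sup>2)"
proof -
  have "ip C (K * C) = ip C ((- \<i>) \<cdot>\<^sub>m (H * C)) - ip C (W * C)"
    unfolding K_mult[OF C] using C by (intro ip_minus_right[of _ N N]) auto
  then show ?thesis using ip_skew[OF H adj_H C] ip_W[OF C] by simp
qed

lemma adj_K: "adj K = \<i> \<cdot>\<^sub>m H - W"
  unfolding K_def using adj_minus[of "(- \<i>) \<cdot>\<^sub>m H" N N W] by (simp add: adj_smult adj_H adj_W)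

lemma L_nore_eq:
  assumes X: "X \<in> cmat N N"
  shows "L_nore H J m dS dC X = sylv K (adj K) X"
proof -
  have "X * adj K = \<i> \<cdot>\<^sub>m (X * H) - X * W"
    unfolding adj_K using X carrier_matD[OF H]
    by (simp add: mult_minus_distrib_mat[of _ N N _ N] smult_mult_right)
  then have "sylv K (adj K) X = ((- \<i>) \<cdot>\<^sub>m (H * X) - W * X) + (\<i> \<cdot>\<^sub>m (X * H) - X * W)"
    by (simp add: sylv_def K_mult[OF X])
  also have "\<dots> = (- \<i>) \<cdot>\<^sub>m (H * X - X * H) - (W * X + X * W)"
    using X carrier_matD[OF H] carrier_matD[OF W] by (intro eq_matI) (auto simp: algebra_simps)
  finally show ?thesis by (simp add: L_nore_def W_def)
qed

lemma evol_eq: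
  assumes X: "X \<in> cmat N N"
  shows "evol H J m dS dC t X = super_exp (sylv K (adj K)) t X"
proof -
  have "(L_nore H J m dS dC ^^ n) X = (sylv K (adj K) ^^ n) X" for n
    by (induction n) (use X in \<open>simp_all add: L_nore_eq sylv_pow_carrier[OF K adj_carrier[OF K]]\<close>)
  then show ?thesis by (simp add: evol_def super_exp_def)
qed

lemma evol_factor:
  assumes B: "B \<in> cmat N N" and t: "0 \<le> t"
  shows "evol H J m dS dC t (B * adj B) = flow K B t * adj (flow K B t)"
proof -
  have "ip Z (K * Z) \<le> 0" if "Z \<in> cmat N N" for Z
    using ip_K[OF that] sum_nonneg[of "{..<m}" "\<lambda>j. (fro (Jx j * Z))\<^sup>2"] by simp
  then have "super_exp (sylv K (adj K)) t (B * adj B) = flow K B t * adj (flow K B t)"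
    using t B flow[OF K B] by (intro sylv_exp_factor[of K N]) auto
  then show ?thesis using evol_eq[of "B * adj B" t] B by simp
qed

text \<open>Split \<open>H\<close> into \<open>H - kron (1\<^sub>m dS) HC\<close> and
  \<open>kron (1\<^sub>m dS) HC\<close>. On a product with \<open>\<rho>C0\<close> the second part
  gives a fixed energy per unit trace, and the first is seen only through its average over
  \<open>\<rho>C0\<close>, the observable \<open>A\<close> on S.\<close>

lemma tr_product_state:
  assumes \<sigma>: "\<sigma> \<in> cmat dS dS" and HC: "HC \<in> cmat dC dC"
  defines "A \<equiv> ptrace_right dS dC ((H - kron (1\<^sub>m dS) HC) * kron (1\<^sub>m dS) \<rho>C0)"
  shows "tr (H * kron \<sigma> \<rho>C0) = tr (kron A (1\<^sub>m dC) * kron \<sigma> \<rho>C0) + tr (HC * \<rho>C0) * tr (kron \<sigma> \<rho>C0)"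
proof -
  define Ht where "Ht = H - kron (1\<^sub>m dS) HC"
  have I: "kron (1\<^sub>m dS) HC \<in> cmat N N" using HC by simp
  have Ht: "Ht \<in> cmat N N" using I by (simp add: Ht_def minus_carrier_mat)
  have Z: "kron \<sigma> \<rho>C0 \<in> cmat N N" "kron (1\<^sub>m dS) \<rho>C0 \<in> cmat N N"
    "kron \<sigma> (1\<^sub>m dC) \<in> cmat N N" using \<sigma> by auto
  have A: "A \<in> cmat dS dS" by (simp add: A_def)
  have "H = Ht + kron (1\<^sub>m dS) HC"
    using I carrier_matD[OF H] unfolding Ht_def by (intro eq_matI) auto
  then have "H * kron \<sigma> \<rho>C0 = Ht * kron \<sigma> \<rho>C0 + kron (1\<^sub>m dS) HC * kron \<sigma> \<rho>C0"
    using add_mult_distrib_mat[OF Ht I Z(1)] by simp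
  then have "tr (H * kron \<sigma> \<rho>C0) = tr (Ht * kron \<sigma> \<rho>C0) + tr (kron (1\<^sub>m dS) HC * kron \<sigma> \<rho>C0)"
    using Ht I Z by (simp add: tr_add[of _ N])
  also have "tr (kron (1\<^sub>m dS) HC * kron \<sigma> \<rho>C0) = tr (HC * \<rho>C0) * tr (kron \<sigma> \<rho>C0)"
    using HC \<sigma> by (simp add: kron_mult[of _ dS _ dC] left_mult_one_mat[OF \<sigma>] tr_kron[of _ dS _ dC])
  also have "tr (Ht * kron \<sigma> \<rho>C0) = tr (kron A (1\<^sub>m dC) * kron \<sigma> \<rho>C0)"
  proof -
    have "kron \<sigma> \<rho>C0 = kron (1\<^sub>m dS) \<rho>C0 * kron \<sigma> (1\<^sub>m dC)"
      using \<sigma> by (simp add: kron_mult[of _ dS _ dC] left_mult_one_mat[OF \<sigma>] right_mult_one_mat[OF C0_carrier])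
    then have "Ht * kron \<sigma> \<rho>C0 = Ht * kron (1\<^sub>m dS) \<rho>C0 * kron \<sigma> (1\<^sub>m dC)"
      using Ht Z \<sigma> carrier_matD[OF C0_carrier] by (simp add: mult_assoc_dim)
    then have "tr (Ht * kron \<sigma> \<rho>C0) = tr (kron \<sigma> (1\<^sub>m dC) * (Ht * kron (1\<^sub>m dS) \<rho>C0))"
      using tr_comm[of "Ht * kron (1\<^sub>m dS) \<rho>C0" N N "kron \<sigma> (1\<^sub>m dC)"] mult_carrier_mat[OF Ht Z(2)] Z(3)
      by simp
    also have "\<dots> = tr (\<sigma> * A)"
      unfolding A_def Ht_def[symmetric] using Ht Z \<sigma> by (intro tr_kron_ptrace) auto
    also have "\<dots> = tr (A * \<sigma>)" using \<sigma> A by (rule tr_comm)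
    also have "\<dots> = tr (kron A (1\<^sub>m dC) * kron \<sigma> \<rho>C0)"
      using \<sigma> A by (simp add: kron_mult[of _ dS _ dC] left_mult_one_mat[OF C0_carrier] tr_kron[of _ dS _ dC])
    finally show ?thesis .
  qed
  finally show ?thesis .
qed

end

section \<open>Integrals over the half line and survival probabilities\<close>

lemma integral_atLeast_tendsto:
  fixes f :: "real \<Rightarrow> real"
  assumes "(f has_integral I) {0..}"
  shows "((\<lambda>T. integral {0..T} f) \<longlongrightarrow> I) at_top"
proof (rule tendstoI)
  fix e :: real assume "0 < e"
  then obtain B where B: "0 < B" "\<And>a b. ball 0 B \<subseteq> cbox a b \<Longrightarrow>
      norm (integral (cbox a b) (\<lambda>x. if x \<in> {0..} then f x else 0) - I) < e"
    using assms unfolding has_integral_alt' by blast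
  have "dist (integral {0..T} f) I < e" if T: "B \<le> T" for T
  proof -
    have "integral (cbox (- B) T) (\<lambda>x. if x \<in> {0..} then f x else 0) = integral ({0..} \<inter> cbox (- B) T) f"
      by (rule integral_restrict_Int)
    also have "{0..} \<inter> cbox (- B) T = {0..T}" using B(1) by auto
    finally have "integral (cbox (- B) T) (\<lambda>x. if x \<in> {0..} then f x else 0) = integral {0..T} f" .
    moreover have "ball 0 B \<subseteq> cbox (- B) T" using T by auto
    ultimately show ?thesis
      using B(2)[of "- B" T] by (simp add: dist_norm)
  qed
  then show "\<forall>\<^sub>F T in at_top. dist (integral {0..T} f) I < e"
    by (rule eventually_at_top_linorderI)
qed

text \<open>Monotone convergence along integer truncations of the half line.\<close>

lemma nonneg_integrable_atLeast:
  fixes g :: "real \<Rightarrow> real"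
  assumes cont: "\<And>T. continuous_on {0..T} g" and nonneg: "\<And>t. 0 \<le> g t"
    and bound: "\<And>T. 0 \<le> T \<Longrightarrow> integral {0..T} g \<le> M"
  shows "g integrable_on {0..}"
proof -
  define f where "f k x = (if x \<in> {0..real k} then g x else 0)" for k x
  have int: "g integrable_on {0..real k}" for k by (intro integrable_continuous_real cont)
  have sub: "{0..real k} \<inter> {0..} = {0..real k}" for k by auto
  have f_int: "f k integrable_on {0..}" "integral {0..} (f k) = integral {0..real k} g" for k
    using int[of k] unfolding f_def[abs_def] integrable_restrict_Int integral_restrict_Int sub by auto
  have "g integrable_on {0..} \<and> (\<lambda>k. integral {0..} (f k)) \<longlonglongrightarrow> integral {0..} g"
  proof (rule monotone_convergence_increasing)
    show "f k x \<le> f (Suc k) x" for k x by (auto simp: f_def nonneg)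
    show "(\<lambda>k. f k x) \<longlonglongrightarrow> g x" if "x \<in> {0..}" for x
    proof (rule tendsto_eventually, rule eventually_sequentiallyI)
      fix k assume "nat \<lceil>x\<rceil> \<le> k"
      then show "f k x = g x" using that by (auto simp: f_def)
    qed
    have "0 \<le> integral {0..real k} g" for k using nonneg by (intro integral_nonneg int) auto
    then show "bounded (range (\<lambda>k. integral {0..} (f k)))"
      unfolding f_int using bound by (intro boundedI[of _ M]) auto
  qed (rule f_int)
  then show ?thesis by blast
qed

lemma integral_has_derivative_at:
  fixes f :: "real \<Rightarrow> real"
  assumes "continuous_on UNIV f" "0 < u"
  shows "((\<lambda>u. integral {0..u} f) has_real_derivative f u) (at u)"
proof -
  have "continuous_on {0..u + 1} f" using assms(1) continuous_on_subset by blast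
  then have "((\<lambda>u. integral {0..u} f) has_real_derivative f u) (at u within {0..u+1})"
    using assms(2) by (intro integral_has_real_derivative) auto
  then show ?thesis using assms(2) by (simp add: at_within_Icc_at)
qed

lemma integral_continuous_upper:
  fixes f :: "real \<Rightarrow> real"
  assumes "continuous_on UNIV f"
  shows "continuous_on {0..T} (\<lambda>u. integral {0..u} f)"
  by (intro indefinite_integral_continuous_1 integrable_continuous_real continuous_on_subset[OF assms]) simp

text \<open>With \<open>n\<close> the survival probability and \<open>p\<close> the renewal density,
  this is the fact that survival integrates to the mean waiting time. Integration by parts leaves S
  n(S), which is at most the tail of the first moment because t >= S there.\<close>

lemma survival_integral_le:
  fixes n p :: "real \<Rightarrow> real"
  assumes n': "\<And>t. (n has_real_derivative - p t) (at t)" and cont: "continuous_on UNIV p"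
    and p: "\<And>t. 0 \<le> p t" and lim: "(n \<longlongrightarrow> 0) at_top"
    and int: "(\<lambda>t. t * p t) integrable_on {0..}" "integral {0..} (\<lambda>t. t * p t) \<le> M1" and S: "0 \<le> S"
  shows "integral {0..S} n \<le> M1"
proof -
  have cn: "continuous_on A n" for A
    using n' DERIV_isCont continuous_at_imp_continuous_on by blast
  have cq: "continuous_on UNIV (\<lambda>t. t * p t)" using cont by (intro continuous_intros)
  \<comment> \<open>The derivative is zero: integration by parts in differential form.\<close>
  define F where "F u = integral {0..u} (\<lambda>t. t * p t) + u * n u - integral {0..u} n" for u
  have "F 0 \<le> F S"
  proof (rule DERIV_nonneg_imp_increasing_open[OF S])
    fix u assume u: "0 < u" "u < S"
    have "(F has_real_derivative u * p u + (1 * n u + - p u * u) - n u) (at u)"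
      unfolding F_def[abs_def]
      by (intro DERIV_diff DERIV_add DERIV_mult DERIV_ident n' integral_has_derivative_at cq cn u)
    then show "\<exists>y. (F has_real_derivative y) (at u) \<and> 0 \<le> y" by (intro exI conjI) auto
  next
    show "continuous_on {0..S} F"
      unfolding F_def[abs_def] by (intro continuous_intros integral_continuous_upper cq cn)
  qed
  then have 1: "integral {0..S} n \<le> integral {0..S} (\<lambda>t. t * p t) + S * n S" by (simp add: F_def)
  have 2: "integral {0..S} n \<le> M1 + S * n T" if T: "S \<le> T" for T
  proof -
    \<comment> \<open>The derivative (u - S) p(u) is nonnegative beyond S; letting T grow then
      removes the term \<open>S * n T\<close>.\<close>
    define G where "G u = integral {0..u} (\<lambda>t. t * p t) + S * n u" for u
    have "G S \<le> G T"
    proof (rule DERIV_nonneg_imp_increasing_open[OF T])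
      fix u assume u: "S < u" "u < T"
      have "(G has_real_derivative u * p u + S * (- p u)) (at u)"
        unfolding G_def[abs_def] using u S
        by (intro DERIV_add DERIV_cmult n' integral_has_derivative_at cq) auto
      moreover have "0 \<le> u * p u + S * (- p u)" using u p[of u] by (simp add: mult_right_mono)
      ultimately show "\<exists>y. (G has_real_derivative y) (at u) \<and> 0 \<le> y" by blast
    next
      have "continuous_on {0..T} G"
        unfolding G_def[abs_def] by (intro continuous_intros integral_continuous_upper cq cn)
      then show "continuous_on {S..T} G" using S by (rule_tac continuous_on_subset) auto
    qed
    moreover have "integral {0..T} (\<lambda>t. t * p t) \<le> integral {0..} (\<lambda>t. t * p t)"
      using int(1) p by (intro integral_subset_le integrable_continuous_real continuous_on_subset[OF cq]) auto
    ultimately show ?thesis using 1 int(2) by (simp add: G_def)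
  qed
  have "((\<lambda>T. M1 + S * n T) \<longlongrightarrow> M1 + S * 0) at_top" by (intro tendsto_intros lim)
  then have "integral {0..S} n \<le> M1 + S * 0"
    by (rule tendsto_lowerbound) (use 2 in \<open>auto simp: eventually_at_top_linorder\<close>)
  then show ?thesis by simp
qed

section \<open>Energy balance over one cycle\<close>

context renewal
begin

lemma flow_ip_deriv:
  assumes B: "B \<in> cmat N N"
    and M: "M \<in> cmat N N" and L: "L \<in> cmat N N"
  shows "((\<lambda>t. ip (M * flow K B t) (L * flow K B t)) has_real_derivative
     ip (M * (K * flow K B t)) (L * flow K B t) + ip (M * flow K B t) (L * (K * flow K B t))) (at t)"
  using flow[OF K B] M L by (intro mderiv_ip[of _ N] mderiv_const_mult) auto

lemma flow_ip_cont:
  assumes B: "B \<in> cmat N N"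
    and M: "M \<in> cmat N N" and L: "L \<in> cmat N N"
  shows "continuous_on S (\<lambda>t. ip (M * flow K B t) (L * flow K B t))"
  using flow_ip_deriv[OF assms] DERIV_isCont continuous_at_imp_continuous_on by blast

lemma flow_norm_deriv:
  assumes B: "B \<in> cmat N N"
  shows "((\<lambda>t. (fro (flow K B t))\<^sup>2) has_real_derivative - (\<Sum>j<m. (fro (Jx j * flow K B t))\<^sup>2)) (at t)"
proof -
  have "((\<lambda>t. ip (flow K B t) (flow K B t)) has_real_derivative 2 * ip (flow K B t) (K * flow K B t)) (at t)"
    using flow[OF K B] by (intro mderiv_ip_self[of _ N]) auto
  then show ?thesis using ip_K[OF flow(1)[OF K B]] by (simp add: ip_self)
qed

text \<open>The derivative of the expectation of \<open>Ac\<close> along the flow and the energy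
  found after a renewal contain the same \<open>W\<close>-term with opposite signs. In the sum these
  cancel, and so does the commutator with \<open>kron (1\<^sub>m dS) HC\<close>; the commutator with
  \<open>Ht\<close> remains and is bounded by Cauchy-Schwarz.\<close>

lemma energy_identity:
  assumes C: "C \<in> cmat N N" and HC: "HC \<in> cmat dC dC" "hermitian HC"
  defines "Ht \<equiv> H - kron (1\<^sub>m dS) HC"
  defines "A \<equiv> ptrace_right dS dC (Ht * kron (1\<^sub>m dS) \<rho>C0)"
  defines "Ac \<equiv> kron A (1\<^sub>m dC)"
  defines "p \<equiv> (\<Sum>j<m. (fro (Jx j * C))\<^sup>2)"
  shows "- (2 * fro A * fro Ht * (fro C)\<^sup>2) \<le>
    Re (tr (H * D (C * adj C))) - Re (tr (HC * \<rho>C0)) * p + (ip (K * C) (Ac * C) + ip C (Ac * (K * C)))"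
proof -
  define HI where "HI = kron (1\<^sub>m dS) HC"
  have HI: "HI \<in> cmat N N" using HC by (simp add: HI_def)
  have adjHI: "adj HI = HI" using HC by (simp add: HI_def adj_kron[of _ dS dS _ dC dC] hermitian_adj)
  have Ht: "Ht \<in> cmat N N" using HI by (simp add: Ht_def HI_def minus_carrier_mat)
  have A: "A \<in> cmat dS dS" by (simp add: A_def)
  have Ac: "Ac \<in> cmat N N" using A by (simp add: Ac_def)
  note [simp] = C HI Ht Ac
  note dims [simp] = carrier_matD[OF C] carrier_matD[OF HI] carrier_matD[OF Ht] carrier_matD[OF Ac]
    carrier_matD[OF W] carrier_matD[OF H]
  define V where "V = (- \<i>) \<cdot>\<^sub>m (H * C)"
  define Vt where "Vt = (- \<i>) \<cdot>\<^sub>m (Ht * C)"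
  define V0 where "V0 = (- \<i>) \<cdot>\<^sub>m (HI * C)"
  have V [simp]: "V \<in> cmat N N" "Vt \<in> cmat N N" "V0 \<in> cmat N N"
    by (simp_all add: V_def Vt_def V0_def)
  have X: "C * adj C \<in> cmat N N" by simp
  have trD: "tr (D (C * adj C)) = of_real p" unfolding p_def by (rule tr_D_self[OF C])
  have "tr (H * D (C * adj C)) = tr (Ac * D (C * adj C)) + tr (HC * \<rho>C0) * tr (D (C * adj C))"
    using tr_product_state[OF ptrace_carrier HC(1), of dC "D (C * adj C)"] D_product[OF X]
    by (simp add: Ac_def A_def Ht_def)
  then have g: "Re (tr (H * D (C * adj C))) = Re (tr (Ac * D (C * adj C))) + Re (tr (HC * \<rho>C0)) * p"
    by (simp add: trD)
  have "tr (Ac * D (C * adj C)) = 2 * tr (Ac * (W * (C * adj C)))"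
    unfolding Ac_def by (rule tr_kron_D[OF A X])
  also have "Ac * (W * (C * adj C)) = Ac * (W * C) * adj C" by (simp add: mult_assoc_dim)
  finally have g2: "Re (tr (Ac * D (C * adj C))) = 2 * ip C (Ac * (W * C))"
    by (simp add: ip_eq_tr[of _ N N])
  have KC: "K * C = V - W * C" unfolding V_def by (rule K_mult[OF C])
  have 1: "ip (K * C) (Ac * C) = ip V (Ac * C) - ip (W * C) (Ac * C)"
    unfolding KC by (rule ip_minus_left[of _ N N]) simp_all
  have "Ac * (K * C) = Ac * V - Ac * (W * C)"
    unfolding KC by (simp add: mult_minus_distrib_mat[of _ N N _ N])
  then have 2: "ip C (Ac * (K * C)) = ip C (Ac * V) - ip C (Ac * (W * C))"
    by (simp add: ip_minus_right[of _ N N])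
  \<comment> \<open>\<open>W\<close> and \<open>Ac\<close> act on different tensor factors;
    commuting them shows that both halves of the derivative contribute the same
    \<open>W\<close>-term.\<close>
  have "ip (W * C) (Ac * C) = ip C (W * (Ac * C))"
    using ip_selfadjoint[OF W adj_W C, of "Ac * C"] by simp
  also have "W * (Ac * C) = Ac * W * C"
    using kron_comm[OF A VC_carrier, folded Ac_def W_def] by (simp add: mult_assoc_dim)
  also have "\<dots> = Ac * (W * C)" by (simp add: mult_assoc_dim)
  finally have 3: "ip (W * C) (Ac * C) = ip C (Ac * (W * C))" .
  have H_eq: "H = Ht + HI" unfolding Ht_def HI_def[symmetric] by (rule eq_matI) auto
  have "V = Vt + V0"
    unfolding V_def Vt_def V0_def H_eq using add_mult_distrib_mat[OF Ht HI C] by (auto intro!: eq_matI simp: algebra_simps)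
  then have 4: "ip V (Ac * C) + ip C (Ac * V) = (ip Vt (Ac * C) + ip C (Ac * Vt)) + (ip V0 (Ac * C) + ip C (Ac * V0))"
    by (simp add: ip_add_left[of _ N N] ip_add_right[of _ N N] mult_add_distrib_mat[of _ N N _ N])
  \<comment> \<open>\<open>Ac\<close> commutes with \<open>HI\<close>, so the two halves of the
    \<open>HI\<close>-part cancel.\<close>
  have "ip C (Ac * V0) = ip (\<i> \<cdot>\<^sub>m C) (Ac * (HI * C))"
    using ip_smult_move[of C N N "Ac * (HI * C)" "- \<i>"] by (simp add: V0_def smult_mult_right)
  also have "Ac * (HI * C) = HI * (Ac * C)"
  proof -
    have "Ac * HI = HI * Ac" unfolding Ac_def HI_def by (rule kron_comm[OF A HC(1)])
    moreover have "Ac * (HI * C) = Ac * HI * C" "HI * (Ac * C) = HI * Ac * C" by (simp_all add: mult_assoc_dim)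
    ultimately show ?thesis by simp
  qed
  also have "ip (\<i> \<cdot>\<^sub>m C) (HI * (Ac * C)) = ip (HI * (\<i> \<cdot>\<^sub>m C)) (Ac * C)"
    by (rule ip_selfadjoint[OF HI adjHI, of _ N]) simp_all
  also have "HI * (\<i> \<cdot>\<^sub>m C) = of_real (-1) \<cdot>\<^sub>m V0"
    by (auto simp: V0_def smult_mult_right intro!: eq_matI)
  also have "ip \<dots> (Ac * C) = - ip V0 (Ac * C)"
    using ip_smult_right[of "Ac * C" N N V0 "-1"] ip_commute[of _ N N "Ac * C"] by simp
  finally have 5: "ip V0 (Ac * C) + ip C (Ac * V0) = 0" by simp
  have fVt: "fro Vt \<le> fro Ht * fro C" unfolding Vt_def using fro_mult_le[OF Ht C] by simp
  have fAc: "fro (Ac * C) \<le> fro A * fro C" unfolding Ac_def by (rule fro_kron_left_le[OF A C])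
  \<comment> \<open>Self-adjointness of \<open>A\<close> has not been established, so the adjoint is
    bounded separately, with the same norm.\<close>
  have adjAc: "adj Ac = kron (adj A) (1\<^sub>m dC)" using A by (simp add: Ac_def adj_kron[of _ dS dS _ dC dC])
  have fAc': "fro (adj Ac * C) \<le> fro A * fro C"
    using fro_kron_left_le[OF adj_carrier[OF A] C] by (simp add: adjAc)
  have "\<bar>ip Vt (Ac * C)\<bar> \<le> fro Vt * fro (Ac * C)" by (rule ip_Cauchy_Schwarz[of _ N N]) simp_all
  also have "\<dots> \<le> (fro Ht * fro C) * (fro A * fro C)" using fVt fAc by (intro mult_mono) auto
  finally have 6: "\<bar>ip Vt (Ac * C)\<bar> \<le> fro A * fro Ht * (fro C)\<^sup>2" by (simp add: power2_eq_square mult_ac)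
  have "ip C (Ac * Vt) = ip (adj Ac * C) Vt" by (rule ip_mult_left_move[of _ N N _ N]) simp_all
  also have "\<bar>\<dots>\<bar> \<le> fro (adj Ac * C) * fro Vt"
    by (rule ip_Cauchy_Schwarz[of _ N N]) (simp_all add: mult_carrier_mat[of _ N N])
  also have "\<dots> \<le> (fro A * fro C) * (fro Ht * fro C)" using fVt fAc' by (intro mult_mono) auto
  finally have 7: "\<bar>ip C (Ac * Vt)\<bar> \<le> fro A * fro Ht * (fro C)\<^sup>2" by (simp add: power2_eq_square mult_ac)
  show ?thesis using g g2 1 2 3 4 5 6 7 by (simp add: algebra_simps)
qed

text \<open>Integrates \<open>energy_identity\<close> over the cycle: the initial energy is
  \<open>e + a 0\<close>, both \<open>n\<close> and \<open>a\<close> die out at infinity, and the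
  drift is weighted by the survival probability, whose integral is at most
  \<open>M1\<close>.\<close>

lemma energy_bound:
  assumes B: "B \<in> cmat N N" "B * adj B = kron \<sigma> \<rho>C0" "\<sigma> \<in> cmat dS dS" "fro B = 1"
    and HC: "HC \<in> cmat dC dC" "hermitian HC"
    and P1: "((\<lambda>t. Re (tr (D (evol H J m dS dC t (B * adj B))))) has_integral 1) {0..}"
    and P2: "(\<lambda>t. t * Re (tr (D (evol H J m dS dC t (B * adj B))))) integrable_on {0..}"
      "integral {0..} (\<lambda>t. t * Re (tr (D (evol H J m dS dC t (B * adj B))))) \<le> M1"
  defines "Ht \<equiv> H - kron (1\<^sub>m dS) HC"
  defines "A \<equiv> ptrace_right dS dC (Ht * kron (1\<^sub>m dS) \<rho>C0)"
  shows "ip B (H * B) \<le> integral {0..} (\<lambda>t. Re (tr (H * D (evol H J m dS dC t (B * adj B))))) + 2 * fro A * fro Ht * M1"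
proof -
  define C where "C = flow K B"
  have C: "C t \<in> cmat N N" "C 0 = B" for t using flow[OF K B(1)] by (auto simp: C_def)
  have ev: "evol H J m dS dC t (B * adj B) = C t * adj (C t)" if "0 \<le> t" for t
    using evol_factor[OF B(1) that] by (simp add: C_def)
  define n where "n t = (fro (C t))\<^sup>2" for t
  define p where "p t = (\<Sum>j<m. (fro (Jx j * C t))\<^sup>2)" for t
  define g where "g t = Re (tr (H * D (C t * adj (C t))))" for t
  define Ac where "Ac = kron A (1\<^sub>m dC)"
  define a where "a t = ip (C t) (Ac * C t)" for t
  define e where "e = Re (tr (HC * \<rho>C0))"
  define k where "k = 2 * fro A * fro Ht"
  have A: "A \<in> cmat dS dS" by (simp add: A_def)
  have Ac: "Ac \<in> cmat N N" using A by (simp add: Ac_def)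
  have one: "1\<^sub>m N * C t = C t" for t using C(1) by (simp add: left_mult_one_mat[of _ N N])
  have p_eq: "Re (tr (D (evol H J m dS dC t (B * adj B)))) = p t" if "0 \<le> t" for t
    using ev[OF that] tr_D_self[OF C(1)] by (simp add: p_def)
  have p0: "0 \<le> p t" for t by (simp add: p_def sum_nonneg)
  have n': "(n has_real_derivative - p t) (at t)" for t
    unfolding n_def[abs_def] p_def C_def by (rule flow_norm_deriv[OF B(1)])
  have cp: "continuous_on S p" for S
    unfolding p_def[abs_def] ip_self[symmetric] C_def
    by (intro continuous_on_sum flow_ip_cont[OF B(1)]) auto
  have g_sum: "g t = (\<Sum>j<m. ip (Jx j * C t) (H * (Jx j * C t)))" for t
    unfolding g_def by (rule tr_mult_D_self[OF H C(1)])
  have cg: "continuous_on S g" for S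
  proof -
    have "g = (\<lambda>t. \<Sum>j<m. ip (Jx j * C t) (H * Jx j * C t))"
    proof
      fix t
      have "H * (Jx j * C t) = H * Jx j * C t" if "j < m" for j
        using carrier_matD[OF H] carrier_matD[OF Jx[OF that]] carrier_matD[OF C(1)[of t]] by (simp add: mult_assoc_dim)
      then show "g t = (\<Sum>j<m. ip (Jx j * C t) (H * Jx j * C t))" unfolding g_sum by simp
    qed
    then show ?thesis unfolding C_def by (simp only:) (intro continuous_on_sum flow_ip_cont[OF B(1)], auto)
  qed
  have g_le: "\<bar>g t\<bar> \<le> fro H * p t" for t
  proof -
    have "\<bar>ip (Jx j * C t) (H * (Jx j * C t))\<bar> \<le> fro H * (fro (Jx j * C t))\<^sup>2" if j: "j < m" for j
    proof -
      have JC: "Jx j * C t \<in> cmat N N" using Jx[OF j] C(1) by simp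
      have "\<bar>ip (Jx j * C t) (H * (Jx j * C t))\<bar> \<le> fro (Jx j * C t) * fro (H * (Jx j * C t))"
        using JC by (intro ip_Cauchy_Schwarz[of _ N N]) auto
      also have "\<dots> \<le> fro (Jx j * C t) * (fro H * fro (Jx j * C t))"
        using fro_mult_le[OF H JC] by (intro mult_left_mono) auto
      finally show ?thesis by (simp add: power2_eq_square mult_ac)
    qed
    then show ?thesis unfolding g_sum p_def sum_distrib_left
      by (intro order_trans[OF sum_abs] sum_mono) auto
  qed
  have P1': "(p has_integral 1) {0..}" using P1 p_eq by (rule_tac has_integral_eq) auto
  have "integral {0..} (\<lambda>t. t * Re (tr (D (evol H J m dS dC t (B * adj B))))) = integral {0..} (\<lambda>t. t * p t)"
    using p_eq by (intro integral_cong) simp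
  then have P2': "(\<lambda>t. t * p t) integrable_on {0..}" "integral {0..} (\<lambda>t. t * p t) \<le> M1"
    using P2(2) integrable_eq[OF P2(1), of "\<lambda>t. t * p t"] p_eq by simp_all
  have n_int: "integral {0..T} p = 1 - n T" if "0 \<le> T" for T
  proof -
    have "((\<lambda>t. - p t) has_integral n T - n 0) {0..T}"
      by (rule fundamental_theorem_of_calculus[OF that])
        (use n' in \<open>auto simp flip: has_real_derivative_iff_has_vector_derivative intro: has_field_derivative_at_within\<close>)
    from has_integral_neg[OF this] have "(p has_integral - (n T - n 0)) {0..T}" by simp
    then show ?thesis using B(4) C(2) by (simp add: integral_unique n_def)
  qed
  \<comment> \<open>Total renewal probability 1 means that nothing survives forever.\<close>
  have n_lim: "(n \<longlongrightarrow> 0) at_top"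
  proof -
    have "((\<lambda>T. 1 - integral {0..T} p) \<longlongrightarrow> 1 - 1) at_top"
      by (intro tendsto_intros integral_atLeast_tendsto P1')
    moreover have "\<forall>\<^sub>F T in at_top. 1 - integral {0..T} p = n T"
      by (rule eventually_at_top_linorderI[of 0]) (simp add: n_int)
    ultimately show ?thesis by (simp add: tendsto_cong)
  qed
  have n_le: "integral {0..S} n \<le> M1" if "0 \<le> S" for S
    by (rule survival_integral_le[OF n' cp p0 n_lim P2' that])
  have k0: "0 \<le> k" by (simp add: k_def)
  have cn: "continuous_on S n" for S
    using n' DERIV_isCont continuous_at_imp_continuous_on by blast
  have a': "(a has_real_derivative ip (K * C t) (Ac * C t) + ip (C t) (Ac * (K * C t))) (at t)" for t
  proof -
    have "K * C t \<in> cmat N N" using C(1) by simp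
    then have "1\<^sub>m N * (K * C t) = K * C t" by (rule left_mult_one_mat)
    then show ?thesis
      using flow_ip_deriv[OF B(1) one_carrier_mat Ac, of t] one
      unfolding a_def[abs_def] C_def[symmetric] by simp
  qed
  have main: "e * (1 - n S) + a 0 - a S - k * M1 \<le> integral {0..S} g" if S: "0 \<le> S" for S
  proof -
    \<comment> \<open>Nondecreasing by \<open>energy_identity\<close>; the last summand absorbs its
      error term.\<close>
    define F where "F u = integral {0..u} g + e * n u + a u + k * integral {0..u} n" for u
    have "F 0 \<le> F S"
    proof (rule DERIV_nonneg_imp_increasing_open[OF S])
      fix u assume u: "0 < u" "u < S"
      have "(F has_real_derivative g u + e * (- p u) + (ip (K * C u) (Ac * C u) + ip (C u) (Ac * (K * C u))) + k * n u) (at u)"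
        unfolding F_def[abs_def] by (intro DERIV_add DERIV_cmult n' a' integral_has_derivative_at cg cn u)
      moreover have "0 \<le> g u + e * (- p u) + (ip (K * C u) (Ac * C u) + ip (C u) (Ac * (K * C u))) + k * n u"
        using energy_identity[OF C(1)[of u] HC]
        unfolding g_def p_def e_def k_def n_def Ac_def A_def Ht_def by simp
      ultimately show "\<exists>y. (F has_real_derivative y) (at u) \<and> 0 \<le> y" by blast
    next
      have "continuous_on {0..S} a" using a' DERIV_isCont continuous_at_imp_continuous_on by blast
      then show "continuous_on {0..S} F"
        unfolding F_def[abs_def] by (intro continuous_intros integral_continuous_upper cg cn)
    qed
    moreover have "n 0 = 1" using B(4) C(2) by (simp add: n_def)
    moreover have "k * integral {0..S} n \<le> k * M1" using n_le[OF S] k0 by (intro mult_left_mono)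
    ultimately show ?thesis by (simp add: F_def algebra_simps)
  qed
  have g0: "0 \<le> g t" for t
    unfolding g_sum using C(1)[of t] by (intro sum_nonneg psd_ip[OF H H_psd, of _ N]) auto
  \<comment> \<open>Integrability must be proved: without it \<open>integral\<close> takes the
    default value 0, and the limit of the truncated integrals would say nothing about the
    power.\<close>
  have g_int: "g integrable_on {0..}"
  proof (rule nonneg_integrable_atLeast[OF cg g0])
    fix T :: real assume T: "0 \<le> T"
    have "integral {0..T} g \<le> integral {0..T} (\<lambda>t. fro H * p t)"
      using g_le by (intro integral_le integrable_continuous_real continuous_intros cg cp) (auto simp: abs_le_iff)
    also have "\<dots> = fro H * (1 - n T)" using n_int[OF T] by simp
    also have "\<dots> \<le> fro H" by (simp add: n_def mult_left_le)
    finally show "integral {0..T} g \<le> fro H" .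
  qed
  have a_lim: "(a \<longlongrightarrow> 0) at_top"
  proof (rule tendsto_0_le[where K = "fro A"])
    show "(n \<longlongrightarrow> 0) at_top" by (rule n_lim)
    have "\<bar>a t\<bar> \<le> n t * fro A" for t
    proof -
      have "\<bar>a t\<bar> \<le> fro (C t) * fro (Ac * C t)"
        unfolding a_def using C(1)[of t] Ac by (intro ip_Cauchy_Schwarz[of _ N N]) auto
      also have "\<dots> \<le> fro (C t) * (fro A * fro (C t))"
        unfolding Ac_def using fro_kron_left_le[OF A C(1)] by (intro mult_left_mono) auto
      finally show ?thesis by (simp add: n_def power2_eq_square mult_ac)
    qed
    then show "\<forall>\<^sub>F t in at_top. norm (a t) \<le> norm (n t) * fro A" by (simp add: n_def)
  qed
  have "((\<lambda>S. integral {0..S} g) \<longlongrightarrow> integral {0..} g) at_top"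
    by (rule integral_atLeast_tendsto[OF integrable_integral[OF g_int]])
  moreover have "((\<lambda>S. e * (1 - n S) + a 0 - a S - k * M1) \<longlongrightarrow> e * (1 - 0) + a 0 - 0 - k * M1) at_top"
    by (intro tendsto_intros n_lim a_lim)
  ultimately have lim: "e * (1 - 0) + a 0 - 0 - k * M1 \<le> integral {0..} g"
    by (rule tendsto_le[rotated 1]) (use main in \<open>auto simp: eventually_at_top_linorder\<close>)
  have "ip B (H * B) = Re (tr (H * (B * adj B)))"
    using B(1) carrier_matD[OF H] by (simp add: ip_eq_tr[of _ N N] mult_assoc_dim)
  also have "\<dots> = Re (tr (Ac * (B * adj B))) + Re (tr (HC * \<rho>C0) * tr (B * adj B))"
    using tr_product_state[OF B(3) HC(1)] unfolding B(2) Ac_def A_def Ht_def by simp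
  also have "tr (B * adj B) = 1" using tr_mult_adj_self[OF B(1)] B(4) by simp
  also have "Re (tr (Ac * (B * adj B))) = a 0"
    using B(1) Ac by (simp add: a_def C(2) ip_eq_tr[of _ N N] mult_assoc_dim)
  finally have "ip B (H * B) = e + a 0" by (simp add: e_def)
  moreover have "integral {0..} (\<lambda>t. Re (tr (H * D (evol H J m dS dC t (B * adj B))))) = integral {0..} g"
    using ev by (intro integral_cong) (simp add: g_def)
  ultimately show ?thesis using lim by (simp add: k_def)
qed

end

subsection \<open>Gate errors and semi-classical states\<close>

lemma ket_bra_carrier [simp]: "v \<in> carrier_vec n \<Longrightarrow> w \<in> carrier_vec q \<Longrightarrow> ket_bra v w \<in> cmat n q"
  by (auto simp: ket_bra_def)

lemma adj_ket_bra [simp]: "adj (ket_bra v v) = ket_bra v v"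
  by (rule eq_matI) (auto simp: ket_bra_def)

lemma ket_bra_osum: "v k \<in> carrier_vec n \<Longrightarrow> ket_bra (v k) (v k) = osum n {k} (\<lambda>_. 1) v"
  by (rule eq_matI) (auto simp: ket_bra_def osum_def)

lemma ket_bra_idem:
  assumes "v \<in> carrier_vec n" "cinner v v = 1"
  shows "ket_bra v v * ket_bra v v = ket_bra v v"
proof -
  have "onf n {0::nat} (\<lambda>_. v)" using assms by (auto simp: onf_def)
  from osum_mult[OF this, of "\<lambda>_. 1" "\<lambda>_. 1"] show ?thesis
    using ket_bra_osum[of "\<lambda>_. v" "0::nat" n] assms by simp
qed

lemma ip_ket_bra:
  assumes v: "v \<in> carrier_vec n" and w: "w \<in> carrier_vec n"
  shows "ip (ket_bra v v) (ket_bra w w) = (cmod (cinner v w))\<^sup>2"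
proof -
  have "of_real ((cmod (cinner v w))\<^sup>2) = cinner v w * cnj (cinner v w)"
    by (rule complex_norm_square)
  also have "\<dots> = (\<Sum>i<n. \<Sum>j<n. (cnj (v $ i) * w $ i) * (v $ j * cnj (w $ j)))"
    using v by (simp add: cinner_carrier[OF v] sum_product)
  finally have "(cmod (cinner v w))\<^sup>2 = Re (\<Sum>i<n. \<Sum>j<n. (cnj (v $ i) * w $ i) * (v $ j * cnj (w $ j)))"
    by (metis Re_complex_of_real)
  also have "\<dots> = (\<Sum>i<n. \<Sum>j<n. inner (v $ i * cnj (v $ j)) (w $ i * cnj (w $ j)))"
    by (simp add: inner_complex_def algebra_simps)
  also have "\<dots> = ip (ket_bra v v) (ket_bra w w)"
    using v w by (simp add: ip_def ket_bra_def)
  finally show ?thesis by simp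
qed

lemma kron_projection:
  assumes P: "P \<in> cmat n n" "adj P = P" "P * P = P"
  shows "kron P (1\<^sub>m q) \<in> cmat (n*q) (n*q)" "adj (kron P (1\<^sub>m q)) = kron P (1\<^sub>m q)"
    "kron P (1\<^sub>m q) * kron P (1\<^sub>m q) = kron P (1\<^sub>m q)"
  using P by (simp_all add: adj_kron[of _ n n _ q q] kron_mult[of _ n _ q])

text \<open>Reads the population of the logical state \<open>v\<close> off the amplitude, so that
  gate errors become statements about projected norms.\<close>

lemma fro_ket_projection:
  assumes v: "v \<in> carrier_vec n" "cinner v v = 1" and C: "C \<in> cmat (n*q) (n*q)"
  shows "(fro (kron (ket_bra v v) (1\<^sub>m q) * C))\<^sup>2 = ip (ket_bra v v) (ptrace_right n q (C * adj C))"
proof -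
  let ?P = "kron (ket_bra v v) (1\<^sub>m q)"
  note P = kron_projection[OF ket_bra_carrier[OF v(1) v(1)] adj_ket_bra ket_bra_idem[OF v], of q]
  have CC: "C * adj C \<in> cmat (n*q) (n*q)" using C by simp
  have "(fro (?P * C))\<^sup>2 = ip C (?P * C)" by (rule fro_projection(1)[OF P C])
  also have "\<dots> = Re (tr (?P * C * adj C))" using P C by (intro ip_eq_tr) auto
  also have "?P * C * adj C = ?P * (C * adj C)"
    using carrier_matD[OF P(1)] carrier_matD[OF C] by (intro mult_assoc_dim) auto
  also have "tr \<dots> = tr (ket_bra v v * ptrace_right n q (C * adj C))"
    using v CC by (intro tr_kron_ptrace) auto
  also have "\<dots> = tr (ptrace_right n q (C * adj C) * ket_bra v v)"
    using v by (intro tr_comm[of _ n n]) auto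
  also have "Re \<dots> = ip (ket_bra v v) (ptrace_right n q (C * adj C))"
    using v by (simp add: ip_eq_tr[of _ n n])
  finally show ?thesis .
qed

lemma ptrace_smult: "ptrace_right n q (c \<cdot>\<^sub>m X) = c \<cdot>\<^sub>m ptrace_right n q X" if "X \<in> cmat (n*q) (n*q)"
  using that by (intro eq_matI) (auto simp: ptrace_right_def prod_index_less sum_distrib_left)

text \<open>The projector has Frobenius norm 1, so pairing with it changes by at most the Frobenius
  distance of the states, hence by 2 \<epsilon>. The factor \<parallel>C\<parallel>^2 undoes the
  normalization.\<close>

lemma gate_projection_bound:
  assumes v: "v \<in> carrier_vec n" "cinner v v = 1" and w: "w \<in> carrier_vec n"
    and C: "C \<in> cmat (n*q) (n*q)" "fro C \<noteq> 0"
    and T: "trace_dist (ptrace_right n q (nrm (C * adj C))) (ket_bra w w) \<le> \<epsilon>"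
  shows "\<bar>(fro (kron (ket_bra v v) (1\<^sub>m q) * C))\<^sup>2 - (cmod (cinner v w))\<^sup>2 * (fro C)\<^sup>2\<bar> \<le> 2 * \<epsilon> * (fro C)\<^sup>2"
proof -
  define X where "X = ptrace_right n q (C * adj C)"
  define \<rho> where "\<rho> = ptrace_right n q (nrm (C * adj C))"
  have X: "X \<in> cmat n n" by (simp add: X_def)
  have rho: "\<rho> = of_real (1 / (fro C)\<^sup>2) \<cdot>\<^sub>m X"
    unfolding \<rho>_def X_def nrm_def tr_mult_adj_self[OF C(1)] using C(1) by (simp add: ptrace_smult)
  have kb: "ket_bra v v \<in> cmat n n" "ket_bra w w \<in> cmat n n" using v w by auto
  have \<rho>: "\<rho> \<in> cmat n n" by (simp add: \<rho>_def)
  have "\<bar>ip (ket_bra v v) (\<rho> - ket_bra w w)\<bar> \<le> fro (ket_bra v v) * fro (\<rho> - ket_bra w w)"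
    using kb \<rho> by (intro ip_Cauchy_Schwarz) (auto simp: minus_carrier_mat)
  also have "fro (ket_bra v v) = 1"
    using ip_ket_bra[OF v(1) v(1)] v(2) ip_self[of "ket_bra v v"] fro_nonneg[of "ket_bra v v"]
    by (simp add: power2_eq_1_iff)
  also have "1 * fro (\<rho> - ket_bra w w) \<le> 2 * \<epsilon>"
    using fro_le_trace_dist[OF \<rho> kb(2)] T by (simp add: \<rho>_def)
  also have "ip (ket_bra v v) (\<rho> - ket_bra w w) = ip (ket_bra v v) \<rho> - (cmod (cinner v w))\<^sup>2"
    using kb \<rho> v w by (simp add: ip_minus_right[of _ n n] ip_ket_bra)
  also have "ip (ket_bra v v) \<rho> = (1 / (fro C)\<^sup>2) * ip (ket_bra v v) X"
    unfolding rho by (rule ip_smult_right[OF kb(1) X])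
  finally have "\<bar>1 / (fro C)\<^sup>2 * ip (ket_bra v v) X - (cmod (cinner v w))\<^sup>2\<bar> \<le> 2 * \<epsilon>" .
  then show ?thesis
    using fro_ket_projection[OF v C(1)] C(2) by (simp add: X_def abs_le_iff field_simps)
qed

text \<open>The projection onto the first logical state nearly fixes \<open>C\<^sub>1\<close> and nearly kills \<open>C\<^sub>2\<close>.\<close>

lemma gate_separation:
  assumes v: "v \<in> carrier_vec n" "cinner v v = 1" and w: "w \<in> carrier_vec n" "cinner v w = 0"
    and C: "C\<^sub>1 \<in> cmat (n*q) (n*q)" "C\<^sub>2 \<in> cmat (n*q) (n*q)"
    and norms: "99/100 \<le> fro C\<^sub>1" "0 < fro C\<^sub>2" "fro C\<^sub>2 \<le> 1" and \<epsilon>: "\<epsilon> \<le> 1/100" "0 \<le> \<epsilon>"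
    and T1: "trace_dist (ptrace_right n q (nrm (C\<^sub>1 * adj C\<^sub>1))) (ket_bra v v) \<le> \<epsilon>"
    and T2: "trace_dist (ptrace_right n q (nrm (C\<^sub>2 * adj C\<^sub>2))) (ket_bra w w) \<le> \<epsilon>"
    and z: "cmod z = 1"
  shows "4/5 \<le> fro (C\<^sub>2 - z \<cdot>\<^sub>m C\<^sub>1)"
proof -
  let ?P = "kron (ket_bra v v) (1\<^sub>m q)"
  note P = kron_projection[OF ket_bra_carrier[OF v(1) v(1)] adj_ket_bra ket_bra_idem[OF v], of q]
  \<comment> \<open>The numbers: 0.98 times 0.99^2 exceeds 0.97^2, and 0.02 is below 0.15^2, so the
    projected amplitudes differ in norm by at least 0.82.\<close>
  have "(1 - 2 * \<epsilon>) * (fro C\<^sub>1)\<^sup>2 \<le> (fro (?P * C\<^sub>1))\<^sup>2"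
    using gate_projection_bound[OF v v(1) C(1) _ T1] norms v(2) by (simp add: abs_le_iff algebra_simps)
  moreover have "(98/100) * (99/100)\<^sup>2 \<le> (1 - 2 * \<epsilon>) * (fro C\<^sub>1)\<^sup>2"
    using \<epsilon> norms by (intro mult_mono power_mono) auto
  ultimately have "(97/100)\<^sup>2 \<le> (fro (?P * C\<^sub>1))\<^sup>2" by (simp add: power2_eq_square)
  then have 1: "97/100 \<le> fro (?P * C\<^sub>1)" by (rule power2_le_imp_le) simp
  have "(fro (?P * C\<^sub>2))\<^sup>2 \<le> 2 * \<epsilon> * (fro C\<^sub>2)\<^sup>2"
    using gate_projection_bound[OF v w(1) C(2) _ T2] norms w(2) by simp
  also have "\<dots> \<le> (2/100) * 1\<^sup>2" using \<epsilon> norms by (intro mult_mono power_mono) auto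
  also have "\<dots> \<le> (15/100)\<^sup>2" by (simp add: power2_eq_square)
  finally have 2: "fro (?P * C\<^sub>2) \<le> 15/100" by (rule power2_le_imp_le) simp
  have zC: "z \<cdot>\<^sub>m C\<^sub>1 \<in> cmat (n*q) (n*q)" using C by simp
  have "?P * (z \<cdot>\<^sub>m C\<^sub>1 - C\<^sub>2) = z \<cdot>\<^sub>m (?P * C\<^sub>1) - ?P * C\<^sub>2"
    using P(1) C zC carrier_matD[OF P(1)] by (simp add: mult_minus_distrib_mat[OF P(1) zC C(2)] smult_mult_right del: dim_kron)
  moreover have "fro (z \<cdot>\<^sub>m (?P * C\<^sub>1)) - fro (?P * C\<^sub>2) \<le> fro (z \<cdot>\<^sub>m (?P * C\<^sub>1) - ?P * C\<^sub>2)"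
    using mult_carrier_mat[OF P(1) C(1)] mult_carrier_mat[OF P(1) C(2)]
    by (intro fro_minus_triangle2[of _ "n*q" "n*q"]) auto
  moreover have "fro (?P * (z \<cdot>\<^sub>m C\<^sub>1 - C\<^sub>2)) \<le> fro (z \<cdot>\<^sub>m C\<^sub>1 - C\<^sub>2)"
    using zC C by (intro fro_projection(2)[OF P]) (auto simp: minus_carrier_mat)
  moreover have "z \<cdot>\<^sub>m C\<^sub>1 - C\<^sub>2 = (-1) \<cdot>\<^sub>m (C\<^sub>2 - z \<cdot>\<^sub>m C\<^sub>1)"
    using C by (intro eq_matI) auto
  then have "fro (z \<cdot>\<^sub>m C\<^sub>1 - C\<^sub>2) = fro (C\<^sub>2 - z \<cdot>\<^sub>m C\<^sub>1)" by (simp only: fro_smult) simp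
  ultimately show ?thesis using 1 2 z by simp
qed

section \<open>Semi-classical states as approximate eigenstates\<close>

lemma ptrace_left_mult:
  assumes Y: "Y \<in> cmat n n" and X: "X \<in> cmat (n*q) (n*q)"
  shows "ptrace_right n q (kron Y (1\<^sub>m q) * X) = Y * ptrace_right n q X"
proof (rule mat_eqI[of _ n n])
  fix i j assume ij: "i < n" "j < n"
  have "ptrace_right n q (kron Y (1\<^sub>m q) * X) $$ (i,j) = (\<Sum>k<q. \<Sum>a<n. Y $$ (i,a) * X $$ (a*q+k, j*q+k))"
    using ij by (simp add: ptrace_right_def kron_left_mult_index[OF Y X] prod_index_less)
  also have "\<dots> = (\<Sum>a<n. \<Sum>k<q. Y $$ (i,a) * X $$ (a*q+k, j*q+k))" by (rule sum.swap)
  also have "\<dots> = (Y * ptrace_right n q X) $$ (i,j)"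
    unfolding mult_index[OF Y ptrace_carrier ij] using ij by (simp add: ptrace_right_def sum_distrib_left)
  finally show "ptrace_right n q (kron Y (1\<^sub>m q) * X) $$ (i,j) = (Y * ptrace_right n q X) $$ (i,j)" .
qed (use Y in simp_all)

text \<open>The operator acts on the left factor only, so the eigenvector equation of the
  purification survives the partial trace as an equation for the mixed state.\<close>

lemma semicl_eigen:
  assumes "\<rho> \<in> semicl d A B" "A \<in> cmat d d" "B \<in> cmat d d"
  obtains lam \<mu> where "cmod lam = 1" "(lam \<cdot>\<^sub>m A + \<i> \<cdot>\<^sub>m B) * \<rho> = \<mu> \<cdot>\<^sub>m \<rho>"
proof -
  obtain q \<psi> lam \<mu> where *: "\<rho> = ptrace_right d q (ket_bra \<psi> \<psi>)" "cmod lam = 1" "\<psi> \<in> carrier_vec (d*q)"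
    "is_eigvec (kron (lam \<cdot>\<^sub>m A + \<i> \<cdot>\<^sub>m B) (1\<^sub>m q)) \<psi> \<mu>"
    using assms(1) unfolding semicl_def by blast
  define Y where "Y = lam \<cdot>\<^sub>m A + \<i> \<cdot>\<^sub>m B"
  have Y: "Y \<in> cmat d d" using assms by (simp add: Y_def)
  have KY: "kron Y (1\<^sub>m q) \<in> cmat (d*q) (d*q)" using Y by simp
  have X: "ket_bra \<psi> \<psi> \<in> cmat (d*q) (d*q)" using *(3) by simp
  have ev: "kron Y (1\<^sub>m q) *\<^sub>v \<psi> = \<mu> \<cdot>\<^sub>v \<psi>" using *(4) by (simp add: is_eigvec_def Y_def)
  have "kron Y (1\<^sub>m q) * ket_bra \<psi> \<psi> = \<mu> \<cdot>\<^sub>m ket_bra \<psi> \<psi>"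
  proof (rule mat_eqI[of _ "d*q" "d*q"])
    fix i j assume ij: "i < d*q" "j < d*q"
    have "(kron Y (1\<^sub>m q) * ket_bra \<psi> \<psi>) $$ (i,j) = (\<Sum>l<d*q. kron Y (1\<^sub>m q) $$ (i,l) * (\<psi> $ l * cnj (\<psi> $ j)))"
      unfolding mult_index[OF KY X ij] using *(3) ij by (simp add: ket_bra_def)
    also have "\<dots> = (\<Sum>l<d*q. kron Y (1\<^sub>m q) $$ (i,l) * \<psi> $ l) * cnj (\<psi> $ j)"
      by (simp only: sum_distrib_right mult.assoc)
    also have "(\<Sum>l<d*q. kron Y (1\<^sub>m q) $$ (i,l) * \<psi> $ l) = (kron Y (1\<^sub>m q) *\<^sub>v \<psi>) $ i"
      using ij *(3) carrier_matD[OF KY] by (simp add: scalar_prod_def atLeast0LessThan del: dim_kron)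
    finally show "(kron Y (1\<^sub>m q) * ket_bra \<psi> \<psi>) $$ (i,j) = (\<mu> \<cdot>\<^sub>m ket_bra \<psi> \<psi>) $$ (i,j)"
      unfolding ev using ij *(3) by (simp add: ket_bra_def)
  qed (use KY X in simp_all)
  then have "Y * \<rho> = \<mu> \<cdot>\<^sub>m \<rho>"
    using ptrace_left_mult[OF Y X] ptrace_smult[OF X] *(1) by simp
  then show thesis using that *(2) by (simp add: Y_def)
qed

text \<open>The defect \<open>F\<close> satisfies \<open>F * adj C = 0\<close>, so
  \<open>C * adj F = 0\<close> and therefore \<open>F * adj F = 0\<close>. Thus an eigenvalue
  equation passes from a state to any of its amplitudes.\<close>

lemma eigen_gram:
  assumes Y: "Y \<in> cmat d d" and C: "C \<in> cmat d d" and eq: "Y * (C * adj C) = \<mu> \<cdot>\<^sub>m (C * adj C)"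
  shows "Y * C = \<mu> \<cdot>\<^sub>m C"
proof -
  define F where "F = Y * C - \<mu> \<cdot>\<^sub>m C"
  have F: "F \<in> cmat d d" using Y C by (simp add: F_def minus_carrier_mat)
  note [simp] = carrier_matD[OF Y] carrier_matD[OF C] carrier_matD[OF F]
  have "F * adj C = Y * C * adj C - \<mu> \<cdot>\<^sub>m C * adj C"
    unfolding F_def using Y C by (intro minus_mult_distrib_mat[of _ d d _ _ d]) auto
  also have "\<dots> = 0\<^sub>m d d" using eq C by (simp add: mult_assoc_dim smult_mult_left)
  finally have FC: "F * adj C = 0\<^sub>m d d" .
  have "adj (0\<^sub>m d d :: complex mat) = 0\<^sub>m d d" by (rule eq_matI) auto
  then have "adj (F * adj C) = 0\<^sub>m d d" using FC by simp
  then have CF: "C * adj F = 0\<^sub>m d d" using adj_mult[OF F adj_carrier[OF C]] by simp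
  have "F * Z = Y * C * Z - \<mu> \<cdot>\<^sub>m C * Z" if "Z \<in> cmat d d" for Z
    unfolding F_def using Y C that by (intro minus_mult_distrib_mat[of _ d d _ _ d]) auto
  then have "F * adj F = Y * C * adj F - \<mu> \<cdot>\<^sub>m C * adj F" using F by simp
  also have "\<dots> = 0\<^sub>m d d" using CF Y by (simp add: mult_assoc_dim smult_mult_left)
  finally have "tr (F * adj F) = 0" by (simp add: tr_def)
  then have "fro F = 0" using tr_mult_adj_self[OF F] by simp
  then have "F = 0\<^sub>m d d" by (rule fro_eq_0[OF _ F])
  then show ?thesis using Y C unfolding F_def by (intro eq_matI) (auto simp: mat_eq_iff)
qed

text \<open>\<open>(H - Re z) C\<close> and \<open>i (Im z) C\<close> are orthogonal since \<open>H\<close> is selfadjoint.\<close>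

lemma fro_shift_Re:
  assumes H: "H \<in> cmat d d" "adj H = H" and C: "C \<in> cmat d d"
  shows "fro (H * C - of_real (Re z) \<cdot>\<^sub>m C) \<le> fro (H * C - z \<cdot>\<^sub>m C)"
proof -
  define Hs where "Hs = H - of_real (Re z) \<cdot>\<^sub>m 1\<^sub>m d"
  have Hs: "Hs \<in> cmat d d" "adj Hs = Hs"
    using H by (simp_all add: Hs_def minus_carrier_mat adj_minus[of _ d d] adj_smult)
  have G: "Hs * C = H * C - of_real (Re z) \<cdot>\<^sub>m C"
    unfolding Hs_def using H C
    by (simp add: minus_mult_distrib_mat[of _ d d _ _ d] smult_mult_left left_mult_one_mat[OF C])
  define Y where "Y = of_real (Im z) \<cdot>\<^sub>m C"
  define V where "V = \<i> \<cdot>\<^sub>m Y"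
  have V: "V \<in> cmat d d" "Y \<in> cmat d d" "Hs * C \<in> cmat d d" using C Hs by (simp_all add: V_def Y_def)
  have eq: "H * C - z \<cdot>\<^sub>m C = Hs * C - V"
    unfolding G V_def Y_def using H C by (intro eq_matI) (auto simp: algebra_simps complex_eq_iff)
  have "ip (Hs * C) V = ip C (Hs * V)" using ip_selfadjoint[OF Hs C V(1)] by simp
  also have "Hs * V = of_real (- Im z) \<cdot>\<^sub>m ((- \<i>) \<cdot>\<^sub>m (Hs * C))"
    unfolding V_def Y_def using Hs C by (auto simp: smult_mult_right intro!: eq_matI)
  also have "ip C \<dots> = 0"
    using ip_smult_right[of C d d "(- \<i>) \<cdot>\<^sub>m (Hs * C)" "- Im z"] ip_skew[OF Hs C] V C by simp
  finally have z: "ip (Hs * C) V = 0" "ip V (Hs * C) = 0" using ip_commute[OF V(1) V(3)] by simp_all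
  have "(fro (Hs * C - V))\<^sup>2 = (fro (Hs * C))\<^sup>2 + (fro V)\<^sup>2"
    using V z by (simp flip: ip_self add: ip_minus_left[of _ d d] ip_minus_right[of _ d d] minus_carrier_mat)
  then have "(fro (Hs * C))\<^sup>2 \<le> (fro (Hs * C - V))\<^sup>2" by simp
  then show ?thesis unfolding eq G[symmetric] by (rule power2_le_imp_le) simp
qed

lemma Mbar_eq:
  assumes "\<And>k. k \<in> {1..dL} \<Longrightarrow> kets k \<in> carrier_vec dL"
  shows "Mbar T0 t1 dL kets j = of_real (t1 / T0) \<cdot>\<^sub>m osum dL {1..dL} (\<lambda>k. if k = j then 0 else 1) kets"
    (is "?M = ?N")
proof (rule mat_eqI[of _ dL dL])
  fix a b assume ab: "a < dL" "b < dL"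
  let ?f = "\<lambda>k. if 1 \<le> k \<and> k \<noteq> j then of_real (t1 / T0) \<cdot>\<^sub>m ket_bra (kets k) (kets k) else 0\<^sub>m dL dL"
  have "Mbar T0 t1 dL kets j $$ (a,b) = (\<Sum>k\<in>{..<Suc dL}. ?f k $$ (a,b))"
    using ab by (simp add: Mbar_def)
  \<comment> \<open>The sum in \<open>Mbar\<close> runs from index 0, which contributes the zero
    matrix; the kets are numbered from 1.\<close>
  also have "\<dots> = (\<Sum>k\<in>{1..dL}. ?f k $$ (a,b))"
    using ab by (intro sum.mono_neutral_right) auto
  also have "\<dots> = (\<Sum>k\<in>{1..dL}. of_real (t1 / T0) * ((if k = j then 0 else 1) * (kets k $ a * cnj (kets k $ b))))"
  proof (rule sum.cong[OF refl])
    fix k assume k: "k \<in> {1..dL}"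
    then show "?f k $$ (a,b) = of_real (t1 / T0) * ((if k = j then 0 else 1) * (kets k $ a * cnj (kets k $ b)))"
      using ab carrier_vecD[OF assms[OF k]] by (simp add: ket_bra_def)
  qed
  also have "\<dots> = ?N $$ (a,b)"
    using ab by (simp add: osum_def sum_distrib_left)
  finally show "?M $$ (a,b) = ?N $$ (a,b)" .
qed (simp_all add: Mbar_def)

lemma kron_smult_left: "kron (c \<cdot>\<^sub>m A) B = c \<cdot>\<^sub>m kron A B" if "A \<in> cmat n n" "B \<in> cmat q q"
proof (rule mat_eq_prodI[of _ n q n q])
  fix i k j l assume ij: "i < n" "k < q" "j < n" "l < q"
  show "kron (c \<cdot>\<^sub>m A) B $$ (i*q+k, j*q+l) = (c \<cdot>\<^sub>m kron A B) $$ (i*q+k, j*q+l)"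
    using that ij kron_index[of "c \<cdot>\<^sub>m A" n n B q q i k j l] kron_index[of A n n B q q i k j l]
    by (simp add: prod_index_less)
qed (use that in auto)

text \<open>Up to the factor t1 / T0 the extended \<open>Mbar\<close> is a projection, the one that
  removes the ket \<open>j\<close>.\<close>

lemma fro_Mext_le:
  assumes kets: "onf dL {1..dL} kets" and "0 < T0" "0 < t1" and C: "C \<in> cmat (dL*q) (dL*q)"
  shows "kron (Mbar T0 t1 dL kets j) (1\<^sub>m q) \<in> cmat (dL*q) (dL*q)"
    "fro (kron (Mbar T0 t1 dL kets j) (1\<^sub>m q) * C) \<le> t1 / T0 * fro C"
proof -
  define P where "P = osum dL {1..dL} (\<lambda>k. if k = j then 0 else 1) kets"
  have "P * P = P" unfolding P_def osum_mult[OF kets] by (rule osum_cong) auto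
  moreover have "adj P = P" unfolding P_def adj_osum by (rule osum_cong) auto
  moreover have P: "P \<in> cmat dL dL" by (simp add: P_def)
  ultimately have KP: "kron P (1\<^sub>m q) \<in> cmat (dL*q) (dL*q)" "adj (kron P (1\<^sub>m q)) = kron P (1\<^sub>m q)"
    "kron P (1\<^sub>m q) * kron P (1\<^sub>m q) = kron P (1\<^sub>m q)"
    by (auto intro!: kron_projection)
  have eq: "kron (Mbar T0 t1 dL kets j) (1\<^sub>m q) = of_real (t1 / T0) \<cdot>\<^sub>m kron P (1\<^sub>m q)"
  proof -
    have "Mbar T0 t1 dL kets j = of_real (t1 / T0) \<cdot>\<^sub>m P"
      unfolding P_def by (rule Mbar_eq) (rule onf_carrier[OF kets])
    then show ?thesis using P by (simp only:) (intro kron_smult_left, auto)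
  qed
  show "kron (Mbar T0 t1 dL kets j) (1\<^sub>m q) \<in> cmat (dL*q) (dL*q)" unfolding eq using KP by simp
  have "kron (Mbar T0 t1 dL kets j) (1\<^sub>m q) * C = of_real (t1 / T0) \<cdot>\<^sub>m (kron P (1\<^sub>m q) * C)"
    unfolding eq using carrier_matD[OF KP(1)] carrier_matD[OF C] by (intro smult_mult_left) auto
  then show "fro (kron (Mbar T0 t1 dL kets j) (1\<^sub>m q) * C) \<le> t1 / T0 * fro C"
    using fro_projection(2)[OF KP C] assms(2,3) by (simp add: mult_left_mono divide_right_mono norm_divide)
qed

text \<open>Solving lam A C + i T0 H C = \<mu> C for H C leaves the error (i lam / T0) A C. The
  shift is then made real, so that the approximate eigenvalue generates a pure phase.\<close>

lemma semicl_almost_eigen: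
  assumes H: "H \<in> cmat d d" "adj H = H" and A: "A \<in> cmat d d" and C: "C \<in> cmat d d" "fro C \<noteq> 0"
    and T0: "0 < T0" and A_le: "fro (A * C) \<le> c * fro C"
    and cl: "nrm (C * adj C) \<in> semicl d A (of_real T0 \<cdot>\<^sub>m H)"
  obtains e :: real where "fro (H * C - of_real e \<cdot>\<^sub>m C) \<le> c / T0 * fro C"
proof -
  have T0H: "of_real T0 \<cdot>\<^sub>m H \<in> cmat d d" using H by simp
  obtain lam \<mu> where lam: "cmod lam = 1"
    and ev: "(lam \<cdot>\<^sub>m A + \<i> \<cdot>\<^sub>m (of_real T0 \<cdot>\<^sub>m H)) * nrm (C * adj C) = \<mu> \<cdot>\<^sub>m nrm (C * adj C)"
    using semicl_eigen[OF cl A T0H] .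
  define Y where "Y = lam \<cdot>\<^sub>m A + \<i> \<cdot>\<^sub>m (of_real T0 \<cdot>\<^sub>m H)"
  have Y: "Y \<in> cmat d d" using A H by (simp add: Y_def)
  note [simp] = carrier_matD[OF Y] carrier_matD[OF C(1)] carrier_matD[OF A] carrier_matD[OF H(1)]
  define s where "s = complex_of_real ((fro C)\<^sup>2)"
  have s: "s \<noteq> 0" using C(2) by (simp add: s_def)
  have CC: "C * adj C = s \<cdot>\<^sub>m nrm (C * adj C)"
    unfolding nrm_def tr_mult_adj_self[OF C(1)] s_def[symmetric] using s by (intro eq_matI) auto
  have nC: "nrm (C * adj C) \<in> cmat d d" using C by (simp add: nrm_def)
  have "Y * (C * adj C) = s \<cdot>\<^sub>m (Y * nrm (C * adj C))"
    using nC by (subst CC) (simp add: smult_mult_right)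
  also have "\<dots> = s \<cdot>\<^sub>m (\<mu> \<cdot>\<^sub>m nrm (C * adj C))" unfolding Y_def ev ..
  also have "\<dots> = \<mu> \<cdot>\<^sub>m (s \<cdot>\<^sub>m nrm (C * adj C))" by (rule eq_matI) auto
  also have "\<dots> = \<mu> \<cdot>\<^sub>m (C * adj C)" using CC by simp
  finally have YC: "Y * C = \<mu> \<cdot>\<^sub>m C" by (rule eigen_gram[OF Y C(1)])
  have "Y * C = lam \<cdot>\<^sub>m (A * C) + \<i> \<cdot>\<^sub>m (of_real T0 \<cdot>\<^sub>m (H * C))"
    unfolding Y_def using A H C by (simp add: add_mult_distrib_mat[of _ d d _ _ d] smult_mult_left)
  then have eq: "lam * (A * C) $$ (i,j) + \<i> * (of_real T0 * (H * C) $$ (i,j)) = \<mu> * C $$ (i,j)"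
    if "i < d" "j < d" for i j
    using YC that by (simp add: mat_eq_iff)
  define z where "z = - \<i> * \<mu> / of_real T0"
  have "H * C - z \<cdot>\<^sub>m C = (\<i> * lam / of_real T0) \<cdot>\<^sub>m (A * C)"
  proof (rule mat_eqI[of _ d d])
    fix i j assume ij: "i < d" "j < d"
    have "(H * C) $$ (i,j) - z * C $$ (i,j) = (H * C) $$ (i,j) + \<i> / of_real T0 * (\<mu> * C $$ (i,j))"
      by (simp add: z_def)
    also have "\<dots> = (\<i> * lam / of_real T0) * (A * C) $$ (i,j)"
      unfolding eq[OF ij, symmetric] using T0 by (simp add: field_simps)
    finally show "(H * C - z \<cdot>\<^sub>m C) $$ (i,j) = ((\<i> * lam / of_real T0) \<cdot>\<^sub>m (A * C)) $$ (i,j)"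
      using ij by simp
  qed (use A C in \<open>simp_all add: minus_carrier_mat\<close>)
  then have "fro (H * C - z \<cdot>\<^sub>m C) = fro (A * C) / T0"
    using T0 lam by (simp add: norm_mult norm_divide)
  also have "\<dots> \<le> c * fro C / T0" using A_le T0 by (intro divide_right_mono) auto
  finally have "fro (H * C - of_real (Re z) \<cdot>\<^sub>m C) \<le> c / T0 * fro C"
    using fro_shift_Re[OF H C(1), of z] by simp
  then show thesis by (rule that)
qed

lemma psd_msum:
  assumes f: "\<And>j. j < m \<Longrightarrow> f j \<in> cmat n n" "\<And>j. j < m \<Longrightarrow> psd (f j)"
  shows "psd (msum n m f)"
proof (rule psdI[of _ n])
  show "adj (msum n m f) = msum n m f"
  proof (rule mat_eqI[of _ n n])
    fix a b assume ab: "a < n" "b < n"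
    have "cnj (f j $$ (b,a)) = f j $$ (a,b)" if "j < m" for j
      using psd_adj[OF f(2)[OF that]] carrier_matD[OF f(1)[OF that]] ab by (metis adj_index)
    then show "adj (msum n m f) $$ (a,b) = msum n m f $$ (a,b)"
      using ab by (simp add: carrier_matD[OF msum_carrier])
  qed simp_all
  fix x :: "complex vec" assume x: "x \<in> carrier_vec n"
  let ?g = "\<lambda>i j l. cnj (x $ i) * (f j $$ (i,l) * x $ l)"
  have "cinner x (msum n m f *\<^sub>v x) = (\<Sum>i<n. cnj (x $ i) * (\<Sum>l<n. (\<Sum>j<m. f j $$ (i,l)) * x $ l))"
    using x by (simp add: cinner_carrier[OF x] scalar_prod_def atLeast0LessThan carrier_matD[OF msum_carrier])
  also have "\<dots> = (\<Sum>i<n. \<Sum>l<n. \<Sum>j<m. ?g i j l)"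
    by (simp only: sum_distrib_left sum_distrib_right)
  also have "\<dots> = (\<Sum>i<n. \<Sum>j<m. \<Sum>l<n. ?g i j l)"
    by (intro sum.cong refl sum.swap)
  also have "\<dots> = (\<Sum>j<m. \<Sum>i<n. \<Sum>l<n. ?g i j l)"
    by (rule sum.swap)
  also have "\<dots> = (\<Sum>j<m. cinner x (f j *\<^sub>v x))"
  proof (rule sum.cong[OF refl])
    fix j assume "j \<in> {..<m}"
    then have "f j \<in> cmat n n" using f by simp
    then show "(\<Sum>i<n. \<Sum>l<n. ?g i j l) = cinner x (f j *\<^sub>v x)"
      using x by (simp add: cinner_carrier[OF x] scalar_prod_def atLeast0LessThan sum_distrib_left)
  qed
  finally have "Re (cinner x (msum n m f *\<^sub>v x)) = (\<Sum>j<m. Re (cinner x (f j *\<^sub>v x)))" by simp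
  also have "\<dots> \<ge> 0"
    using f x by (intro sum_nonneg) (fastforce simp: psd_def)
  finally show "0 \<le> Re (cinner x (msum n m f *\<^sub>v x))" .
qed simp

lemma mderiv_phase:
  assumes X: "X \<in> cmat d d"
  shows "mderiv d (\<lambda>t. cis (- e * (t - s)) \<cdot>\<^sub>m X) ((- \<i> * of_real e * cis (- e * (t - s))) \<cdot>\<^sub>m X) t"
  unfolding mderiv_def
proof (intro allI impI)
  fix i j assume ij: "i < d" "j < d"
  have "((\<lambda>z. exp (\<i> * (- of_real e * (z - of_real s))) * X $$ (i,j)) has_field_derivative
     (- \<i> * of_real e * exp (\<i> * (- of_real e * (of_real t - of_real s)))) * X $$ (i,j))
     (at (of_real t))"
    by (auto intro!: derivative_eq_intros)
  from has_vector_derivative_real_field[OF this] show "((\<lambda>t. (cis (- e * (t - s)) \<cdot>\<^sub>m X) $$ (i,j)) has_vector_derivative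
      ((- \<i> * of_real e * cis (- e * (t - s))) \<cdot>\<^sub>m X) $$ (i,j)) (at t)"
    using ij X by (simp add: cis_conv_exp)
qed

section \<open>States at the renewal times and comparison flows within a cycle\<close>

context renewal
begin

lemma D_psd:
  assumes C: "C \<in> cmat N N"
  shows "psd (D (C * adj C))"
  unfolding D_re_def Jx_def[symmetric]
proof (rule psd_msum)
  fix j assume j: "j < m"
  have JC: "Jx j * C \<in> cmat N N" using Jx[OF j] C by simp
  show "psd (Jx j * (C * adj C) * adj (Jx j))"
    unfolding Jx_conj[OF C j] using psd_gram[OF adj_carrier[OF JC]] by simp
  show "Jx j * (C * adj C) * adj (Jx j) \<in> cmat N N" using Jx[OF j] C by simp
qed

lemma evol_zero: "evol H J m dS dC t (0\<^sub>m N N) = 0\<^sub>m N N"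
proof -
  let ?z = "0\<^sub>m N N :: complex mat"
  have "sylv K (adj K) ?z = ?z"
    by (simp add: sylv_def right_mult_zero_mat[OF K] left_mult_zero_mat[OF adj_carrier[OF K]])
  then have "(sylv K (adj K) ^^ n) ?z = ?z" for n by (induction n) simp_all
  then show ?thesis
    unfolding evol_eq[OF zero_carrier_mat] super_exp_def by (intro eq_matI) auto
qed

text \<open>Only the product \<open>B * adj B\<close> matters, so a fresh amplitude is chosen after
  each renewal, namely the rescaled positive root of the renewed state. The product form on S and C
  comes from \<open>D_product\<close>.\<close>

lemma rho_init_factor:
  assumes S0: "density dS \<rho>S0" and \<tau>: "strict_mono \<tau>"
    and P: "\<And>l. (P_ren H J m dS dC \<rho>S0 \<rho>C0 \<tau> l has_integral 1) {0..}"
  shows "\<exists>B \<sigma>. B \<in> cmat N N \<and> \<sigma> \<in> cmat dS dS \<and>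
     rho_init H J m dS dC \<rho>S0 \<rho>C0 \<tau> l = B * adj B \<and> B * adj B = kron \<sigma> \<rho>C0 \<and> fro B = 1"
proof (induction l)
  case 0
  have S: "\<rho>S0 \<in> cmat dS dS" "psd \<rho>S0" "tr \<rho>S0 = 1" and C: "psd \<rho>C0"
    using S0 C0 by (auto simp: density_def)
  obtain R1 where R1: "R1 \<in> cmat dS dS" "psd R1" "R1 * R1 = \<rho>S0" using psd_root[OF S(1,2)] .
  obtain R2 where R2: "R2 \<in> cmat dC dC" "psd R2" "R2 * R2 = \<rho>C0" using psd_root[OF C0_carrier C] .
  define B where "B = kron R1 R2"
  have B: "B \<in> cmat N N" using R1 R2 by (simp add: B_def)
  have BB: "B * adj B = kron \<rho>S0 \<rho>C0"
    using R1 R2 by (simp add: B_def adj_kron[of _ dS dS _ dC dC] psd_adj kron_mult[of _ dS _ dC])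
  have "complex_of_real ((fro B)\<^sup>2) = 1"
    using tr_mult_adj_self[OF B] BB S tr_kron[OF S(1) C0_carrier] by simp
  then have "(fro B)\<^sup>2 = 1" using of_real_eq_1_iff by blast
  then have "fro B = 1" using fro_nonneg[of B] by (simp add: power2_eq_1_iff)
  then show ?case using B BB S(1) by (intro exI[of _ B] exI[of _ \<rho>S0]) simp
next
  case (Suc l)
  obtain B where B: "B \<in> cmat N N" "rho_init H J m dS dC \<rho>S0 \<rho>C0 \<tau> l = B * adj B"
    using Suc by blast
  define C where "C = flow K B (\<tau> (Suc l) - \<tau> l)"
  have C: "C \<in> cmat N N" using flow(1)[OF K B(1)] by (simp add: C_def)
  have "0 \<le> \<tau> (Suc l) - \<tau> l" using strict_monoD[OF \<tau>, of l "Suc l"] by simp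
  then have init: "rho_init H J m dS dC \<rho>S0 \<rho>C0 \<tau> (Suc l) = nrm (D (C * adj C))"
    using evol_factor[OF B(1)] B(2) by (simp add: C_def)
  define p where "p = (\<Sum>j<m. (fro (Jx j * C))\<^sup>2)"
  have trD: "tr (D (C * adj C)) = of_real p" unfolding p_def by (rule tr_D_self[OF C])
  have p0: "0 \<le> p" by (simp add: p_def sum_nonneg)
  \<comment> \<open>As 1 / 0 = 0, normalizing with trace 0 would give the zero matrix. The renewal
    density of the next cycle would then vanish identically and could not integrate to 1.\<close>
  have "p \<noteq> 0"
  proof
    assume "p = 0"
    then have "nrm (D (C * adj C)) = 0\<^sub>m N N"
      unfolding nrm_def trD by (intro eq_matI) (auto simp: carrier_matD[OF D_carrier])
    then have z: "rho_init H J m dS dC \<rho>S0 \<rho>C0 \<tau> (Suc l) = 0\<^sub>m N N" using init by simp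
    have "tr (D (0\<^sub>m N N)) = 2 * tr (0\<^sub>m N N)"
      using tr_D[OF zero_carrier_mat] by (simp only: right_mult_zero_mat[OF W])
    then have "P_ren H J m dS dC \<rho>S0 \<rho>C0 \<tau> (Suc l) t = 0" for t
      unfolding P_ren_def rho_un_def z evol_zero by (simp only:) (simp add: tr_def)
    then have "P_ren H J m dS dC \<rho>S0 \<rho>C0 \<tau> (Suc l) = (\<lambda>_. 0)" by (rule ext)
    then show False using has_integral_unique[OF P[of "Suc l"], of 0] by simp
  qed
  then have p: "0 < p" using p0 by simp
  obtain R where R: "R \<in> cmat N N" "psd R" "R * R = D (C * adj C)"
    using psd_root[OF D_carrier D_psd[OF C]] .
  define E where "E = of_real (1 / sqrt p) \<cdot>\<^sub>m R"
  have E: "E \<in> cmat N N" using R by (simp add: E_def)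
  have sq: "of_real (1 / sqrt p) * of_real (1 / sqrt p) = of_real (1 / p)"
    using p by (simp flip: of_real_mult)
  have "E * adj E = (of_real (1 / sqrt p) * of_real (1 / sqrt p)) \<cdot>\<^sub>m D (C * adj C)"
    unfolding E_def adj_smult psd_adj[OF R(2)] R(3)[symmetric] using carrier_matD[OF R(1)]
    by (simp add: smult_mult_left smult_mult_right) (auto intro!: eq_matI)
  then have EE: "E * adj E = of_real (1 / p) \<cdot>\<^sub>m D (C * adj C)" unfolding sq .
  define \<sigma> where "\<sigma> = of_real (1 / p) \<cdot>\<^sub>m ptrace_right dS dC (D (C * adj C))"
  have \<sigma>: "\<sigma> \<in> cmat dS dS" by (simp add: \<sigma>_def)
  have CC: "C * adj C \<in> cmat N N" using C by simp
  have "kron \<sigma> \<rho>C0 = E * adj E"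
    unfolding EE \<sigma>_def kron_smult_left[OF ptrace_carrier C0_carrier] D_product[OF CC, symmetric] ..
  moreover have "nrm (D (C * adj C)) = E * adj E" unfolding nrm_def trD EE by simp
  moreover have "fro E = 1"
  proof -
    have "complex_of_real ((fro E)\<^sup>2) = 1"
      using tr_mult_adj_self[OF E] p unfolding EE tr_smult[OF D_carrier] trD by simp
    then have "(fro E)\<^sup>2 = 1" using of_real_eq_1_iff by blast
    then show ?thesis using fro_nonneg[of E] by (simp add: power2_eq_1_iff)
  qed
  ultimately show ?case unfolding init using E \<sigma> by (intro exI[of _ E] exI[of _ \<sigma>]) auto
qed

text \<open>By orthonormality the projectors weighted with the squares of \<open>vval\<close> sum to
  the square of \<open>VC J m dC\<close>, so the radicand is the trace of
  \<open>W * W * (C * adj C)\<close>, a squared norm.\<close>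

lemma quality_integrand:
  assumes v: "onf dC {..<dC} vvec"
    and VC: "VC J m dC = msum dC dC (\<lambda>j. of_real (vval j) \<cdot>\<^sub>m ket_bra (vvec j) (vvec j))"
    and C: "C \<in> cmat N N"
  shows "sqrt (\<Sum>j<dC. (vval j)\<^sup>2 * Re (tr (kron (1\<^sub>m dS) (ket_bra (vvec j) (vvec j)) * (C * adj C)))) = fro (W * C)"
proof -
  let ?X = "C * adj C"
  let ?k = "\<lambda>j. ket_bra (vvec j) (vvec j)"
  let ?kk = "\<lambda>j. kron (1\<^sub>m dS) (?k j)" and ?c = "\<lambda>j. complex_of_real ((vval j)\<^sup>2)"
  have X: "?X \<in> cmat N N" using C by simp
  have kc: "?k j \<in> cmat dC dC" if "j < dC" for j using onf_carrier[OF v] that by simp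
  have msum_osum: "msum dC dC (\<lambda>j. c j \<cdot>\<^sub>m ?k j) = osum dC {..<dC} c vvec" for c
    by (intro mat_eqI[of _ dC dC])
      (auto simp: osum_def ket_bra_def carrier_vecD[OF onf_carrier[OF v]] intro!: sum.cong)
  have "VC J m dC * VC J m dC = msum dC dC (\<lambda>j. ?c j \<cdot>\<^sub>m ?k j)"
    unfolding VC msum_osum osum_mult[OF v] by (simp add: power2_eq_square)
  then have "W * W = kron (1\<^sub>m dS) (msum dC dC (\<lambda>j. ?c j \<cdot>\<^sub>m ?k j))"
    unfolding W_def by (simp add: kron_mult[of _ dS _ dC])
  then have WW: "W * W = msum N dC (\<lambda>j. ?c j \<cdot>\<^sub>m ?kk j)"
    using kron_one_msum[of dC ?k dC] kc by simp
  note [simp] = carrier_matD[OF W] carrier_matD[OF C]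
  have "(fro (W * C))\<^sup>2 = ip C (W * (W * C))"
    unfolding ip_self[symmetric] using ip_selfadjoint[OF W adj_W C, of "W * C"] C by simp
  also have "\<dots> = Re (tr (W * (W * C) * adj C))" using C by (intro ip_eq_tr[of _ N N]) auto
  also have "W * (W * C) * adj C = W * W * ?X" by (simp add: mult_assoc_dim)
  also have "tr \<dots> = tr (?X * (W * W))" using X by (intro tr_comm[of _ N N]) auto
  also have "\<dots> = (\<Sum>j<dC. tr (?X * (?c j \<cdot>\<^sub>m ?kk j)))"
    unfolding WW using X kc by (intro tr_mult_msum) auto
  also have "\<dots> = (\<Sum>j<dC. ?c j * tr (?kk j * ?X))"
  proof (rule sum.cong[OF refl])
    fix j assume "j \<in> {..<dC}"
    then have k: "?kk j \<in> cmat N N" using kc by simp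
    have "?X * (?c j \<cdot>\<^sub>m ?kk j) = ?c j \<cdot>\<^sub>m (?X * ?kk j)"
      using carrier_matD[OF k] by (intro smult_mult_right) (simp del: dim_kron)
    then show "tr (?X * (?c j \<cdot>\<^sub>m ?kk j)) = ?c j * tr (?kk j * ?X)"
      using tr_smult[of "?X * ?kk j" N] X k tr_comm[OF X k] by simp
  qed
  also have "Re \<dots> = (\<Sum>j<dC. (vval j)\<^sup>2 * Re (tr (?kk j * ?X)))"
    by (simp del: of_real_power)
  finally have "(\<Sum>j<dC. (vval j)\<^sup>2 * Re (tr (?kk j * ?X))) = (fro (W * C))\<^sup>2" by simp
  then show ?thesis by simp
qed

lemma flow_W_cont:
  assumes B: "B \<in> cmat N N"
  shows "continuous_on S (\<lambda>t. fro (W * flow K B t))"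
proof -
  have "(\<lambda>t. fro (W * flow K B t)) = (\<lambda>t. sqrt (ip (W * flow K B t) (W * flow K B t)))"
    by (simp add: ip_self)
  then show ?thesis using flow_ip_cont[OF B W W] by (simp only: continuous_on_real_sqrt)
qed

lemma unitary_flow:
  assumes B: "B \<in> cmat N N"
  defines "U \<equiv> flow ((- \<i>) \<cdot>\<^sub>m H) B"
  shows "U t \<in> cmat N N" "U 0 = B" "mderiv N U ((- \<i>) \<cdot>\<^sub>m (H * U t)) t"
proof -
  have h: "(- \<i>) \<cdot>\<^sub>m H \<in> cmat N N" by simp
  show u: "U t \<in> cmat N N" "U 0 = B" unfolding U_def by (rule flow[OF h B])+
  have "((- \<i>) \<cdot>\<^sub>m H) * U t = (- \<i>) \<cdot>\<^sub>m (H * U t)"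
    using carrier_matD[OF u(1)] carrier_matD[OF H] by (intro smult_mult_left) simp
  then show "mderiv N U ((- \<i>) \<cdot>\<^sub>m (H * U t)) t"
    using flow(3)[OF h B, of t] unfolding U_def by simp
qed

text \<open>The difference of the two flows starts at 0 and obeys the unitary equation with the
  source -W C.\<close>

lemma flow_unitary_close:
  assumes B: "B \<in> cmat N N" and t: "0 < T"
  shows "fro (flow K B T - flow ((- \<i>) \<cdot>\<^sub>m H) B T) \<le> integral {0..T} (\<lambda>t. fro (W * flow K B t))"
proof -
  define C U where "C = flow K B" and "U = flow ((- \<i>) \<cdot>\<^sub>m H) B"
  have C: "C t \<in> cmat N N" "C 0 = B" "mderiv N C (K * C t) t" for t
    unfolding C_def by (rule flow[OF K B])+
  have U: "U t \<in> cmat N N" "U 0 = B" "mderiv N U ((- \<i>) \<cdot>\<^sub>m (H * U t)) t" for t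
    unfolding U_def by (rule unitary_flow[OF B])+
  have "fro (C T - U T) \<le> fro (C 0 - U 0) + integral {0..T} (\<lambda>t. fro (W * C t))"
  proof (rule duhamel[OF H adj_H, where R = "\<lambda>t. (-1) \<cdot>\<^sub>m (W * C t)"])
    show "C t - U t \<in> cmat N N" for t using U by (simp add: minus_carrier_mat)
    show "(-1) \<cdot>\<^sub>m (W * C t) \<in> cmat N N" for t using C(1) by simp
    show "mderiv N (\<lambda>t. C t - U t) ((- \<i>) \<cdot>\<^sub>m (H * (C t - U t)) + (-1) \<cdot>\<^sub>m (W * C t)) t" for t
    proof -
      have "mderiv N (\<lambda>t. C t - U t) (K * C t - (- \<i>) \<cdot>\<^sub>m (H * U t)) t"
        using C U by (intro mderiv_minus) auto
      moreover have "H * (C t - U t) = H * C t - H * U t"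
        by (rule mult_minus_distrib_mat[OF H C(1) U(1)])
      then have "K * C t - (- \<i>) \<cdot>\<^sub>m (H * U t) = (- \<i>) \<cdot>\<^sub>m (H * (C t - U t)) + (-1) \<cdot>\<^sub>m (W * C t)"
        unfolding K_mult[OF C(1)]
        using carrier_matD[OF C(1)[of t]] carrier_matD[OF U(1)[of t]] carrier_matD[OF H] carrier_matD[OF W]
        by (auto intro!: eq_matI simp: algebra_simps)
      ultimately show ?thesis by simp
    qed
    show "continuous_on {0..T} (\<lambda>t. fro (W * C t))" unfolding C_def by (rule flow_W_cont[OF B])
  qed (use t in auto)
  moreover have "fro (C 0 - U 0) = 0" using C(2) U(2) by (simp add: fro_def)
  ultimately show ?thesis by (simp add: C_def U_def)
qed

text \<open>If C(s) were an exact eigenvector of \<open>H\<close>, the rotating e^(-i e (t - s))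
  C(s) would be its unitary evolution. In general it solves the unitary equation up to a source of
  norm at most \<open>c\<close>, which joins the source -W C.\<close>

lemma flow_phase_close:
  assumes B: "B \<in> cmat N N" and sT: "s < T"
    and ev: "fro (H * flow K B s - of_real e \<cdot>\<^sub>m flow K B s) \<le> c"
  shows "fro (flow K B T - cis (- e * (T - s)) \<cdot>\<^sub>m flow K B s) \<le>
    integral {s..T} (\<lambda>t. fro (W * flow K B t)) + c * (T - s)"
proof -
  define C where "C = flow K B"
  define x where "x t = cis (- e * (t - s))" for t
  define F where "F = H * C s - of_real e \<cdot>\<^sub>m C s"
  have C: "C t \<in> cmat N N" "mderiv N C (K * C t) t" for t
    unfolding C_def by (rule flow[OF K B])+
  have F: "F \<in> cmat N N" using C(1)[of s] by (simp add: F_def minus_carrier_mat)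
  note dims = carrier_matD[OF C(1)] carrier_matD[OF H] carrier_matD[OF W] carrier_matD[OF F]
  have "fro (C T - x T \<cdot>\<^sub>m C s) \<le> fro (C s - x s \<cdot>\<^sub>m C s) + integral {s..T} (\<lambda>t. fro (W * C t) + c)"
  proof (rule duhamel[OF H adj_H, where R = "\<lambda>t. (-1) \<cdot>\<^sub>m (W * C t) + (- \<i> * x t) \<cdot>\<^sub>m F"])
    show "C t - x t \<cdot>\<^sub>m C s \<in> cmat N N" for t using C(1)[of s] by (simp add: minus_carrier_mat)
    show "(-1) \<cdot>\<^sub>m (W * C t) + (- \<i> * x t) \<cdot>\<^sub>m F \<in> cmat N N" for t using C(1) F by simp
    show "mderiv N (\<lambda>t. C t - x t \<cdot>\<^sub>m C s)
        ((- \<i>) \<cdot>\<^sub>m (H * (C t - x t \<cdot>\<^sub>m C s)) + ((-1) \<cdot>\<^sub>m (W * C t) + (- \<i> * x t) \<cdot>\<^sub>m F)) t" for t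
    proof -
      have "mderiv N (\<lambda>t. C t - x t \<cdot>\<^sub>m C s) (K * C t - (- \<i> * of_real e * x t) \<cdot>\<^sub>m C s) t"
        using C unfolding x_def by (intro mderiv_minus mderiv_phase) auto
      moreover have "H * (C t - x t \<cdot>\<^sub>m C s) = H * C t - x t \<cdot>\<^sub>m (H * C s)"
        using mult_minus_distrib_mat[OF H C(1), of "x t \<cdot>\<^sub>m C s" t] C(1)[of s] dims by (simp add: smult_mult_right)
      then have "K * C t - (- \<i> * of_real e * x t) \<cdot>\<^sub>m C s =
          (- \<i>) \<cdot>\<^sub>m (H * (C t - x t \<cdot>\<^sub>m C s)) + ((-1) \<cdot>\<^sub>m (W * C t) + (- \<i> * x t) \<cdot>\<^sub>m F)"
        unfolding K_mult[OF C(1)] F_def using dims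
        by (auto intro!: eq_matI simp: algebra_simps)
      ultimately show ?thesis by simp
    qed
    show "continuous_on {s..T} (\<lambda>t. fro (W * C t) + c)"
      unfolding C_def by (intro continuous_on_add continuous_on_const flow_W_cont[OF B])
    show "fro ((-1) \<cdot>\<^sub>m (W * C t) + (- \<i> * x t) \<cdot>\<^sub>m F) \<le> fro (W * C t) + c" for t
    proof -
      have "fro ((-1) \<cdot>\<^sub>m (W * C t) + (- \<i> * x t) \<cdot>\<^sub>m F) \<le> fro ((-1) \<cdot>\<^sub>m (W * C t)) + fro ((- \<i> * x t) \<cdot>\<^sub>m F)"
        using C(1)[of t] F by (intro fro_triangle[of _ N N]) auto
      then show ?thesis using ev by (simp add: norm_mult x_def F_def C_def)
    qed
  qed (use sT in auto)
  moreover have "fro (C s - x s \<cdot>\<^sub>m C s) = 0" using C(1)[of s] by (simp add: fro_def x_def)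
  moreover have "integral {s..T} (\<lambda>t. fro (W * C t) + c) = integral {s..T} (\<lambda>t. fro (W * C t)) + c * (T - s)"
    unfolding C_def using sT flow_W_cont[OF B]
    by (subst integral_add) (auto intro: integrable_continuous_real)
  ultimately show ?thesis by (simp add: C_def x_def)
qed

lemma flow_fro_le:
  assumes B: "B \<in> cmat N N" and t: "0 \<le> t"
  shows "fro (flow K B t) \<le> fro B"
proof -
  have "(fro (flow K B t))\<^sup>2 \<le> (fro (flow K B 0))\<^sup>2"
  proof (rule DERIV_nonpos_imp_nonincreasing[OF t])
    show "\<exists>y. ((\<lambda>t. (fro (flow K B t))\<^sup>2) has_real_derivative y) (at s) \<and> y \<le> 0" for s
      using flow_norm_deriv[OF B, of s] by (intro exI conjI) (auto simp: sum_nonneg)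
  qed
  then show ?thesis unfolding flow(2)[OF K B] by (rule power2_le_imp_le) simp
qed

lemma unitary_flow_fro:
  assumes B: "B \<in> cmat N N"
  shows "fro (flow ((- \<i>) \<cdot>\<^sub>m H) B t) = fro B"
proof -
  define U where "U = flow ((- \<i>) \<cdot>\<^sub>m H) B"
  note U = unitary_flow[OF B, folded U_def]
  have "((\<lambda>t. ip (U t) (U t)) has_real_derivative 2 * ip (U t) ((- \<i>) \<cdot>\<^sub>m (H * U t))) (at t)" for t
    using U mult_carrier_mat[OF H U(1)] by (intro mderiv_ip_self[of _ N]) auto
  then have "((\<lambda>t. ip (U t) (U t)) has_real_derivative 0) (at t)" for t
    using ip_skew[OF H adj_H U(1)] by simp
  then have "ip (U t) (U t) = ip (U 0) (U 0)" by (intro DERIV_isconst_all) auto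
  then show ?thesis using U(2) by (simp add: ip_self U_def)
qed

end

section \<open>Frequency bounds from two consecutive gates\<close>

lemma gate_frequency_bounds:
  fixes T0 t1 \<epsilon>g tmax \<epsilon>H M1 :: real and dL dR dC m l :: nat
  assumes pos: "0 < T0" "0 < t1"
    and H: "H \<in> cmat (dL*dR*dC) (dL*dR*dC)" "hermitian H"
      "\<forall>v \<mu>. is_eigvec H v \<mu> \<longrightarrow> 0 \<le> Re \<mu>"
    and J: "\<forall>j<m. J j \<in> cmat dC dC"
    and dens: "density dC \<rho>C0" "density (dL*dR) \<rho>S0"
    and renew: "\<forall>\<sigma>. density dC \<sigma> \<longrightarrow>
           (\<exists>c::real. 0 \<le> c \<and> msum dC m (\<lambda>j. J j * \<sigma> * adj (J j)) = of_real c \<cdot>\<^sub>m \<rho>C0)"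
    and \<tau>: "strict_mono \<tau>"
    and P1: "\<forall>l'. (P_ren H J m (dL*dR) dC \<rho>S0 \<rho>C0 \<tau> l' has_integral 1) {0..}"
    and P2: "\<forall>l'. (\<lambda>t. t * P_ren H J m (dL*dR) dC \<rho>S0 \<rho>C0 \<tau> l' t) integrable_on {0..}
            \<and> integral {0..} (\<lambda>t. t * P_ren H J m (dL*dR) dC \<rho>S0 \<rho>C0 \<tau> l' t) \<le> M1"
    and HC: "HC \<in> cmat dC dC" "hermitian HC"
    and \<epsilon>H: "fro (ptrace_right (dL*dR) dC ((H - kron (1\<^sub>m (dL*dR)) HC) * kron (1\<^sub>m (dL*dR)) \<rho>C0))
        * fro (H - kron (1\<^sub>m (dL*dR)) HC) * 2 * M1 * T0 \<le> \<epsilon>H"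
    and v: "\<forall>j<dC. vvec j \<in> carrier_vec dC"
      "\<forall>j<dC. \<forall>k<dC. cinner (vvec j) (vvec k) = (if j = k then 1 else 0)"
      "VC J m dC = msum dC dC (\<lambda>j. of_real (vval j) \<cdot>\<^sub>m ket_bra (vvec j) (vvec j))"
    and \<epsilon>g: "0 \<le> \<epsilon>g" "\<epsilon>g \<le> 1/2"
    and tmax: "0 \<le> tmax" "1 / (4 * (1 + 464 / 100)\<^sup>2) =
        \<epsilon>g * (2 - \<epsilon>g) + 2 * eps_quality H J m (dL*dR) dC \<rho>S0 \<rho>C0 \<tau> vval vvec l tmax * sqrt (1 - \<epsilon>g)"
    and kets: "\<forall>j\<in>{1..dL}. kets j \<in> carrier_vec dL"
      "\<forall>j\<in>{1..dL}. \<forall>k\<in>{1..dL}. cinner (kets j) (kets k) = (if j = k then 1 else 0)"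
    and fits: "\<forall>j::nat. 1 \<le> j \<and> real j * t1 < tmax \<longrightarrow> j \<le> dL"
    and gates: "\<forall>j::nat. 1 \<le> j \<and> 0 < real j * t1 \<and> real j * t1 < tmax \<longrightarrow>
           trace_dist (ptrace_right dL dR (ptrace_right (dL*dR) dC
             (nrm (rho_un H J m (dL*dR) dC \<rho>S0 \<rho>C0 \<tau> l (real j * t1))))) (ket_bra (kets j) (kets j)) \<le> \<epsilon>g"
    and j: "1 \<le> (j::nat)" "real (j + 1) * t1 < tmax"
  shows "1 / t1 \<le> (T0\<^sup>2 * P_in T0 H J m (dL*dR) dC \<rho>S0 \<rho>C0 \<tau> l + \<epsilon>H) / ((464 / 100 + 1) * (1 / (8 * (464 / 100 + 1))) * T0)"
      (is ?general)
    and "nrm (rho_un H J m (dL*dR) dC \<rho>S0 \<rho>C0 \<tau> l (real j * t1)) \<in>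
          semicl (dL*dR*dC) (kron (Mbar T0 t1 dL kets j) (1\<^sub>m (dR * dC))) (of_real T0 \<cdot>\<^sub>m H) \<Longrightarrow>
        1 / t1 \<le> sqrt (T0\<^sup>2 * P_in T0 H J m (dL*dR) dC \<rho>S0 \<rho>C0 \<tau> l + \<epsilon>H) / ((464 / 100 + 1) * (1 / (4 * (464 / 100 + 1))) * T0)"
      (is "?semicl \<Longrightarrow> ?classical")
proof -
  define dS where "dS = dL*dR"
  define d where "d = dL*dR*dC"
  \<comment> \<open>The same composite index is read as L with one ancilla for the gates, and as S
    with C for the dynamics.\<close>
  have d_assoc: "d = dL * (dR * dC)" "d = dS * dC" by (simp_all add: d_def dS_def)
  have Hd: "H \<in> cmat d d" using H(1) by (simp only: d_def)
  have adjH: "adj H = H" using H(2) by (rule hermitian_adj)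
  interpret renewal H J m dS dC \<rho>C0
    using H J dens renew nonneg_eigenvalues_psd[OF H(1) adjH]
    by unfold_locales (auto simp: dS_def)
  obtain B \<sigma> where B: "B \<in> cmat (dS*dC) (dS*dC)" "\<sigma> \<in> cmat dS dS"
    "rho_init H J m dS dC \<rho>S0 \<rho>C0 \<tau> l = B * adj B" "B * adj B = kron \<sigma> \<rho>C0" "fro B = 1"
    using rho_init_factor[OF dens(2)[folded dS_def] \<tau> P1[rule_format, folded dS_def], of l] by blast
  define C where "C = flow K B"
  define U where "U = flow ((- \<i>) \<cdot>\<^sub>m H) B"
  define q where "q t = fro (W * C t)" for t
  have C: "C t \<in> cmat d d" for t using flow(1)[OF K B(1)] by (simp add: C_def d_assoc(2))
  have un: "rho_un H J m dS dC \<rho>S0 \<rho>C0 \<tau> l t = C t * adj (C t)" if "0 \<le> t" for t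
    using evol_factor[OF B(1) that] B(3) by (simp add: rho_un_def C_def)

  define E where "E = ip B (H * B)"
  define X where "X = T0\<^sup>2 * P_in T0 H J m dS dC \<rho>S0 \<rho>C0 \<tau> l + \<epsilon>H"
  \<comment> \<open>\<open>P_in\<close> carries 1 / T0 and the bound on \<epsilon>H carries T0, so
    the energy estimate is multiplied by T0 once.\<close>
  have EX: "T0 * E \<le> X"
  proof -
    define Ht where "Ht = H - kron (1\<^sub>m dS) HC"
    define A where "A = ptrace_right dS dC (Ht * kron (1\<^sub>m dS) \<rho>C0)"
    have P_ren_eq: "P_ren H J m dS dC \<rho>S0 \<rho>C0 \<tau> l = (\<lambda>t. Re (tr (D (evol H J m dS dC t (B * adj B)))))"
      by (rule ext) (simp add: P_ren_def rho_un_def B(3))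
    have "E \<le> integral {0..} (\<lambda>t. Re (tr (H * D (evol H J m dS dC t (B * adj B))))) + 2 * fro A * fro Ht * M1"
      unfolding E_def A_def Ht_def
      using P1[rule_format, of l] P2[rule_format, of l] unfolding dS_def[symmetric] P_ren_eq
      by (intro energy_bound[OF B(1,4,2,5) HC]) auto
    then have "T0 * E \<le> T0 * (integral {0..} (\<lambda>t. Re (tr (H * D (evol H J m dS dC t (B * adj B))))) + 2 * fro A * fro Ht * M1)"
      using pos by (intro mult_left_mono) auto
    also have "\<dots> \<le> X"
      using \<epsilon>H pos unfolding X_def P_in_def rho_un_def B(3) dS_def[symmetric] A_def Ht_def
      by (simp add: power2_eq_square algebra_simps)
    finally show ?thesis .
  qed

  have vo: "onf dC {..<dC} vvec" using v by (auto simp: onf_def)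
  have quality: "eps_quality H J m dS dC \<rho>S0 \<rho>C0 \<tau> vval vvec l T = integral {0..T} q" if "0 \<le> T" for T
    unfolding eps_quality_def q_def
    using un quality_integrand[OF vo v(3) C[unfolded d_assoc(2)]] by (intro integral_cong) simp
  have q_cont: "continuous_on S q" for S unfolding q_def[abs_def] C_def by (rule flow_W_cont[OF B(1)])
  have q0: "0 \<le> q t" for t by (simp add: q_def)
  have q_mono: "integral {a..b} q \<le> integral {0..tmax} q" if "0 \<le> a" "b \<le> tmax" for a b
    using that q0 by (intro integral_subset_le integrable_continuous_real q_cont) auto
  \<comment> \<open>With 1 + \<lambda> = 5.64 the left side of the equation for \<open>tmax\<close>
    is about 0.0079. Both summands on the right are nonnegative, so each is at most that.\<close>
  have small: "\<epsilon>g \<le> 1/100" "integral {0..tmax} q \<le> 1/100"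
  proof -
    define Q where "Q = integral {0..tmax} q"
    have Q0: "0 \<le> Q" unfolding Q_def using q0 by (intro integral_nonneg integrable_continuous_real q_cont) auto
    have eq: "1 / (4 * (1 + 464 / 100)\<^sup>2) = \<epsilon>g * (2 - \<epsilon>g) + 2 * Q * sqrt (1 - \<epsilon>g)"
      using tmax(2) quality[OF tmax(1)] by (simp add: Q_def dS_def)
    have num: "1 / (4 * (1 + 464 / 100)\<^sup>2) \<le> (8 / 1000 :: real)" by (simp add: power2_eq_square)
    have "\<epsilon>g * (3/2) \<le> \<epsilon>g * (2 - \<epsilon>g)" using \<epsilon>g by (intro mult_left_mono) auto
    moreover have "0 \<le> 2 * Q * sqrt (1 - \<epsilon>g)" using Q0 \<epsilon>g by simp
    ultimately have "\<epsilon>g * (3/2) \<le> 8/1000" using eq num by linarith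
    then show "\<epsilon>g \<le> 1/100" by simp
    \<comment> \<open>0.7 is a rational lower bound for the square root of 1/2.\<close>
    have "(7/10)\<^sup>2 \<le> 1 - \<epsilon>g" using \<epsilon>g by (simp add: power2_eq_square)
    then have "7/10 \<le> sqrt (1 - \<epsilon>g)" by (rule real_le_rsqrt)
    then have "2 * Q * (7/10) \<le> 2 * Q * sqrt (1 - \<epsilon>g)" using Q0 by (intro mult_left_mono) auto
    moreover have "0 \<le> \<epsilon>g * (2 - \<epsilon>g)" using \<epsilon>g by simp
    ultimately have "2 * Q * (7/10) \<le> 8/1000" using eq num by linarith
    then show "integral {0..tmax} q \<le> 1/100" by (simp add: Q_def)
  qed

  have U: "U t \<in> cmat d d" "mderiv d U ((- \<i>) \<cdot>\<^sub>m (H * U t)) t" "U 0 = B" "fro (U t) = 1" for t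
    using unitary_flow[OF B(1)] unitary_flow_fro[OF B(1)] B(5) by (auto simp: U_def d_assoc(2))
  have close: "fro (C t - U t) \<le> 1/100" if "0 < t" "t \<le> tmax" for t
    using flow_unitary_close[OF B(1) that(1)] q_mono[of 0 t] that small(2) unfolding C_def U_def q_def by simp
  have C_le: "fro (C t) \<le> 1" if "0 \<le> t" for t using flow_fro_le[OF B(1) that] B(5) by (simp add: C_def)
  have C_ge: "99/100 \<le> fro (C t)" if t: "0 < t" "t \<le> tmax" for t
  proof -
    have "U t - C t = (-1) \<cdot>\<^sub>m (C t - U t)"
      using carrier_matD[OF C[of t]] carrier_matD[OF U(1)[of t]] by (intro eq_matI) auto
    then have "fro (U t - C t) = fro (C t - U t)" by (simp only: fro_smult) simp
    then show ?thesis using fro_minus_triangle2[OF U(1) C, of t t] close[OF t] U(4)[of t] by simp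
  qed

  define a b where "a = real j * t1" and "b = real (j + 1) * t1"
  have ab: "0 < a" "a < b" "b < tmax" "b - a = t1" using j pos by (auto simp: a_def b_def algebra_simps)
  have jL: "j \<in> {1..dL}" "j + 1 \<in> {1..dL}"
    using fits[rule_format, of j] fits[rule_format, of "j+1"] j ab by (auto simp: a_def b_def)
  have rho_L: "ptrace_right dL dR (ptrace_right (dL*dR) dC (nrm (rho_un H J m (dL*dR) dC \<rho>S0 \<rho>C0 \<tau> l t)))
      = ptrace_right dL (dR*dC) (nrm (C t * adj (C t)))" if "0 \<le> t" for t
    using un[OF that] by (simp add: ptrace_ptrace dS_def)
  \<comment> \<open>Needed for every phase: \<open>z = 1\<close> enters the speed limit, the
    accumulated phase of the approximate eigenvector enters the semi-classical case.\<close>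
  have sep: "4/5 \<le> fro (C b - z \<cdot>\<^sub>m C a)" if "cmod z = 1" for z
  proof (rule gate_separation[where \<epsilon> = \<epsilon>g and v = "kets j" and w = "kets (j+1)"])
    show "trace_dist (ptrace_right dL (dR*dC) (nrm (C a * adj (C a)))) (ket_bra (kets j) (kets j)) \<le> \<epsilon>g"
      using gates[rule_format, of j] rho_L[of a] j ab by (simp add: a_def)
    show "trace_dist (ptrace_right dL (dR*dC) (nrm (C b * adj (C b)))) (ket_bra (kets (j+1)) (kets (j+1))) \<le> \<epsilon>g"
      using gates[rule_format, of "j+1"] rho_L[of b] j ab by (simp add: b_def)
    show "0 < fro (C b)" using C_ge[of b] ab by auto
  qed (use kets jL C[unfolded d_assoc(1)] C_ge[of a] C_le[of b] ab small \<epsilon>g that in auto)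

  have f8: "1 / t1 \<le> 8 * E"
  proof -
    have "4/5 \<le> fro (C b - 1 \<cdot>\<^sub>m C a)" by (rule sep) simp
    also have "C b - 1 \<cdot>\<^sub>m C a = (U b - U a) + ((C b - U b) - (C a - U a))"
      using carrier_matD[OF C] carrier_matD[OF U(1)] by (intro eq_matI) auto
    also have "fro \<dots> \<le> fro (U b - U a) + fro ((C b - U b) - (C a - U a))"
      using C U by (intro fro_triangle[of _ d d]) (auto simp: minus_carrier_mat)
    also have "fro ((C b - U b) - (C a - U a)) \<le> fro (C b - U b) + fro (C a - U a)"
      using C U by (intro fro_triangle_minus[of _ d d]) (auto simp: minus_carrier_mat)
    \<comment> \<open>What remains is 4/5 - 2/100, rounded down to 1/2; its square over 2 gives the
      constant 8.\<close>
    finally have "1/2 \<le> fro (U b - U a)" using close[of a] close[of b] ab by simp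
    then have "(1/2)\<^sup>2 \<le> (fro (U b - U a))\<^sup>2" by (rule power_mono) simp
    also have "\<dots> \<le> 2 * ip (U a) (H * U a) * (b - a)"
      using ab by (intro unitary_flow_speed[OF Hd H_psd U(1,2)]) auto
    also have "ip (U a) (H * U a) = ip (U 0) (H * U 0)"
      by (rule unitary_flow_conserved[OF Hd adjH U(1,2)])
    finally have "1/4 \<le> 2 * E * t1" using ab U(3) by (simp add: E_def power2_eq_square)
    then show ?thesis using pos by (simp add: field_simps)
  qed
  also have E_le: "8 * E \<le> 8 * X / T0" using EX pos by (simp add: field_simps)
  finally show ?general
    by (simp add: X_def dS_def algebra_simps)

  assume cl: ?semicl
  let ?A = "kron (Mbar T0 t1 dL kets j) (1\<^sub>m (dR * dC))"
  have ko: "onf dL {1..dL} kets" using kets by (auto simp: onf_def)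
  have A: "?A \<in> cmat d d" "fro (?A * C a) \<le> t1 / T0 * fro (C a)"
    using fro_Mext_le[OF ko pos, of "C a" "dR*dC" j] C[of a] by (simp_all add: d_assoc(1))
  have cl': "nrm (C a * adj (C a)) \<in> semicl d ?A (of_real T0 \<cdot>\<^sub>m H)"
    using cl un[of a] ab by (simp add: a_def d_def dS_def)
  obtain e :: real where e: "fro (H * C a - of_real e \<cdot>\<^sub>m C a) \<le> t1 / T0 / T0 * fro (C a)"
  proof (rule semicl_almost_eigen[OF Hd adjH A(1) C _ pos(1) A(2) cl'])
    show "fro (C a) \<noteq> 0" using C_ge[of a] ab by auto
  qed (rule that)
  have "t1 / T0 / T0 * fro (C a) \<le> t1 / T0 / T0 * 1" using C_le[of a] ab pos by (intro mult_left_mono) auto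
  then have "fro (C b - cis (- e * (b - a)) \<cdot>\<^sub>m C a) \<le> integral {a..b} q + t1 / T0 / T0 * (b - a)"
    using e ab unfolding C_def q_def by (intro flow_phase_close[OF B(1)]) auto
  moreover have "4/5 \<le> fro (C b - cis (- e * (b - a)) \<cdot>\<^sub>m C a)" by (rule sep) simp
  moreover have "integral {a..b} q \<le> 1/100" using q_mono[of a b] ab small(2) by simp
  \<comment> \<open>Here 4/5 - 1/100 is rounded down to the square of 1/2. The other side is the
    phase error: the rate t1 / T0^2 over the duration t1.\<close>
  ultimately have "(1/2)\<^sup>2 \<le> (t1 / T0)\<^sup>2" using ab(4) by (simp add: power2_eq_square)
  then have "1/2 \<le> t1 / T0" by (rule power2_le_imp_le) (use pos in simp)
  then have f2: "1 / t1 \<le> 2 / T0" using pos by (simp add: field_simps)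
  have "(1 / t1)\<^sup>2 \<le> (2 / T0) * (8 * X / T0)"
    unfolding power2_eq_square using f2 f8 E_le pos by (intro mult_mono) auto
  also have "\<dots> = 16 * X / T0\<^sup>2" by (simp add: power2_eq_square)
  finally have "1 / t1 \<le> sqrt (16 * X / T0\<^sup>2)" by (rule real_le_rsqrt)
  also have "\<dots> = 4 * sqrt X / T0"
    using pos by (simp add: real_sqrt_divide real_sqrt_mult)
  also have "\<dots> = sqrt X * 4 / T0" by simp
  finally show ?classical
    by (simp add: X_def dS_def)
qed

theorem theorem5:
  shows "\<exists>\<kappa> c\<^sub>0 :: real. 0 < \<kappa> \<and> 0 < c\<^sub>0 \<and>
   (\<forall>(T0::real) (dL::nat) (dR::nat) (dC::nat) (H::complex mat) (m::nat) (J::nat \<Rightarrow> complex mat)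
      (\<rho>S0::complex mat) (\<rho>C0::complex mat) (\<tau>::nat \<Rightarrow> real) (M1::real)
      (HC::complex mat) (\<epsilon>H::real) (vval::nat \<Rightarrow> real) (vvec::nat \<Rightarrow> complex vec)
      (l::nat) (\<epsilon>g::real) (tmax::real) (kets::nat \<Rightarrow> complex vec) (t1::real).
    let dS = dL * dR; d = dS * dC; lam = (464 / 100 :: real);
        \<rho>n = (\<lambda>t. nrm (rho_un H J m dS dC \<rho>S0 \<rho>C0 \<tau> l t));
        \<rho>L = (\<lambda>t. ptrace_right dL dR (ptrace_right dS dC (\<rho>n t)));
        Ht = H - kron (1\<^sub>m dS) HC;
        epsq = eps_quality H J m dS dC \<rho>S0 \<rho>C0 \<tau> vval vvec l;
        tmax_eq = (\<lambda>t. 1 / (4 * (1 + lam)\<^sup>2) = \<epsilon>g * (2 - \<epsilon>g) + 2 * epsq t * sqrt (1 - \<epsilon>g));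
        Pin = P_in T0 H J m dS dC \<rho>S0 \<rho>C0 \<tau> l;
        Mext = (\<lambda>j. kron (Mbar T0 t1 dL kets j) (1\<^sub>m (dR * dC)));
        f = 1 / t1
    in
    (0 < T0 \<and> 0 < dL \<and> 0 < dR \<and> 0 < dC
     \<comment> \<open>H_SC self-adjoint with smallest eigenvalue 0\<close>
     \<and> H \<in> carrier_mat d d \<and> hermitian H
     \<and> (\<exists>v. is_eigvec H v 0) \<and> (\<forall>v \<mu>. is_eigvec H v \<mu> \<longrightarrow> 0 \<le> Re \<mu>)
     \<comment> \<open>jump operators and renewal assumption\<close>
     \<and> (\<forall>j<m. J j \<in> carrier_mat dC dC)
     \<and> density dC \<rho>C0 \<and> density dS \<rho>S0
     \<and> (\<forall>\<sigma>. density dC \<sigma> \<longrightarrow>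
           (\<exists>c::real. 0 \<le> c \<and> msum dC m (\<lambda>j. J j * \<sigma> * adj (J j)) = complex_of_real c \<cdot>\<^sub>m \<rho>C0))
     \<comment> \<open>renewal times\<close>
     \<and> \<tau> 0 = 0 \<and> strict_mono \<tau>
     \<comment> \<open>normalisation and bounded first moments of the renewal distribution\<close>
     \<and> (\<forall>l'. (P_ren H J m dS dC \<rho>S0 \<rho>C0 \<tau> l' has_integral 1) {0..})
     \<and> (\<forall>l'. (\<lambda>t. t * P_ren H J m dS dC \<rho>S0 \<rho>C0 \<tau> l' t) integrable_on {0..}
            \<and> integral {0..} (\<lambda>t. t * P_ren H J m dS dC \<rho>S0 \<rho>C0 \<tau> l' t) \<le> M1)
     \<comment> \<open>instantaneous initial-cycle-state parameter\<close>
     \<and> HC \<in> carrier_mat dC dC \<and> hermitian HC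
     \<and> fro (ptrace_right dS dC (Ht * kron (1\<^sub>m dS) \<rho>C0)) * fro Ht * 2 * M1 * T0 \<le> \<epsilon>H
     \<comment> \<open>spectral decomposition of V_C\<close>
     \<and> (\<forall>j<dC. vvec j \<in> carrier_vec dC)
     \<and> (\<forall>j<dC. \<forall>k<dC. cinner (vvec j) (vvec k) = (if j = k then 1 else 0))
     \<and> VC J m dC = msum dC dC (\<lambda>j. complex_of_real (vval j) \<cdot>\<^sub>m ket_bra (vvec j) (vvec j))
     \<comment> \<open>gate error and isentropic interval\<close>
     \<and> 0 \<le> \<epsilon>g \<and> \<epsilon>g \<le> 1/2
     \<and> 0 \<le> tmax \<and> tmax_eq tmax \<and> (\<forall>t. 0 \<le> t \<and> tmax_eq t \<longrightarrow> t \<le> tmax)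
     \<comment> \<open>logical basis |1,l>, ..., |dL,l> and gates\<close>
     \<and> (\<forall>j\<in>{1..dL}. kets j \<in> carrier_vec dL)
     \<and> (\<forall>j\<in>{1..dL}. \<forall>k\<in>{1..dL}. cinner (kets j) (kets k) = (if j = k then 1 else 0))
     \<and> 0 < t1
     \<and> (\<forall>j::nat. 1 \<le> j \<and> real j * t1 < tmax \<longrightarrow> j \<le> dL)
     \<and> (\<forall>j::nat. 1 \<le> j \<and> 0 < real j * t1 \<and> real j * t1 < tmax \<longrightarrow>
           trace_dist (\<rho>L (real j * t1)) (ket_bra (kets j) (kets j)) \<le> \<epsilon>g)
     \<comment> \<open>gates are actually applied during the interval\<close>
     \<and> (\<exists>j::nat. 1 \<le> j \<and> real (j + 1) * t1 < tmax))
    \<longrightarrow>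
    \<comment> \<open>Case 1: semi-classical initial cycle state\<close>
    ((\<exists>j::nat. 1 \<le> j \<and> 0 \<le> real j * t1 \<and> real j * t1 < tmax
          \<and> 0 \<le> real (j + 1) * t1 \<and> real (j + 1) * t1 < tmax
          \<and> \<rho>n (real j * t1) \<in> semicl d (Mext j) (complex_of_real T0 \<cdot>\<^sub>m H)
          \<and> \<rho>n (real (j + 1) * t1) \<in> semicl d (Mext (j + 1)) (complex_of_real T0 \<cdot>\<^sub>m H))
       \<longrightarrow> f \<le> sqrt (T0\<^sup>2 * Pin + \<epsilon>H) / ((lam + 1) * c\<^sub>0 * T0))
    \<comment> \<open>Case 2: general\<close>
    \<and> f \<le> (T0\<^sup>2 * Pin + \<epsilon>H) / ((lam + 1) * \<kappa> * T0))"
\<comment> \<open>The factor \<lambda> + 1 of the claim is absorbed into the witnesses: (\<lambda> +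
  1) \<kappa> = 1/8 and (\<lambda> + 1) c0 = 1/4. With X the numerator of the general bound, these
  are the constants of f <= 8 X / T0 and f <= 4 sqrt X / T0.\<close>
proof (rule exI[of _ "1 / (8 * (464 / 100 + 1))"], rule exI[of _ "1 / (4 * (464 / 100 + 1))"],
    unfold Let_def, intro conjI allI impI, goal_cases)
  case 3
  then show ?case by (elim conjE exE) (rule gate_frequency_bounds(2); assumption)
next
  case 4
  then show ?case by (elim conjE exE) (rule gate_frequency_bounds(1); assumption)
qed simp_all

end
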